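(* Let $K\in\{\emptyset,\mathscr{D}_0,\mathscr{D}_1\}$, let $r\colon K\to\omega_1$ be upper semi-continuous, let $n\in\mathbb{N}_+\cup\{-\infty\}$ and let $\nu,\rho\in\omega_1$ satisfy: (i) $\rho_U(r)\leqslant\rho$; (ii) $\max(\rho,\lambda(r))\leqslant\nu$; (iii) $\nu$ is a successor ordinal if $\rho<\nu$; (iv) $n=-\infty$ precisely when $\max(\rho,\lambda(r))=\nu$. Then there is an $\omega$-Stone space $W$ such that $\nu(W)=\nu$, $\rho(W)=\rho$, $n(W)=n$ and $(K(W),r_W)\cong(K,r)$, and $W$ is unique up to homeomorphism.
   Context: An $\omega$-Stone space is a locally compact metrisable totally disconnected Hausdorff space. $\mathscr{D}_1$ denotes the Cantor set and $\mathscr{D}_0$ the Cantor set minus a point; $\omega_1$ is the set of countable ordinals; $\mathbb{N}_+$ the positive integers. A map $r\colon K\to\omega_1$ is upper semi-continuous if $\{x\mid r(x)\geqslant\xi\}$ is closed for every $\xi$. For such $r$: $\lambda(r)=\sup\{r(x)\mid x\in K\}$, $K_\xi(r)=\{x\in K\mid r(x)>\xi\}$, and $\rho_U(r)=\min\{\xi\mid K_\xi(r)\text{ is compact}\}$; if $K=\emptyset$, $\lambda(r)=\rho_U(r)=0$. For an $\omega$-Stone space $W$: $S'$ is the derived set of $S$; $W^{(0)}=W$, $W^{(\xi+1)}=(W^{(\xi)})'$, $W^{(\eta)}=\bigcap_{\xi<\eta}W^{(\xi)}$ for limit $\eta$; $W^{[\xi]}=W^{(\xi)}-W^{(\xi+1)}$;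 $\nu(W)=\min\{\xi\mid W^{(\xi)}=W^{(\xi+1)}\}$; $K(W)=W^{(\nu(W))}$; $n(W)=|W^{(\mu)}-K(W)|$ if $\nu(W)=\mu+1$ and this set is finite, else $n(W)=-\infty$; $r_W\colon K(W)\to\omega_1$, $r_W(x)=\min\{\xi\mid x\notin\overline{W^{(\xi)}-K(W)}\}$; $\rho(W)=\min\{\xi\mid\overline{W^{[\xi]}}\text{ is compact}\}$. $(U,r)\cong(V,s)$ means there is a homeomorphism $\phi\colon U\to V$ with $s(\phi(u))=r(u)$ for all $u$.
   Formalization: ω-Stone spaces are additionally required to be second countable; without this, uniqueness fails: countable and uncountable infinite discrete spaces both have ν = ρ = 1, n = −∞ and K empty. *)

theory Defs
  imports "HOL-Analysis.Analysis" "HOL-Library.Countable_Set_Type"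
begin

section \<open>The ordinal \<open>\<omega>\<^sub>1\<close> as a type\<close>

text \<open>
  The field of the cardinal successor of \<^term>\<open>natLeq\<close>, ordered by that relation. The type is
  pinned down up to order isomorphism by \<open>countable_below_omega1\<close> and \<open>uncountable_omega1\<close>.
\<close>

lemma Card_order_cardSuc_natLeq: "Card_order (cardSuc natLeq)"
  by (rule cardSuc_Card_order[OF natLeq_Card_order])

lemma Well_order_cardSuc_natLeq: "Well_order (cardSuc natLeq)"
  using Card_order_cardSuc_natLeq card_order_on_well_order_on by blast

lemma infinite_Field_cardSuc_natLeq: "infinite (Field (cardSuc natLeq))"
  using cardSuc_finite[OF natLeq_Card_order] natLeq_Cinfinite by (simp add: cinfinite_def)

typedef omega1 = "Field (cardSuc natLeq)"
proof -
  have "Field (cardSuc natLeq) \<noteq> {}"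
    using infinite_Field_cardSuc_natLeq by (metis finite.emptyI)
  then show ?thesis by blast
qed

instantiation omega1 :: wellorder
begin

definition less_eq_omega1 :: "omega1 \<Rightarrow> omega1 \<Rightarrow> bool"
  where "\<xi> \<le> \<eta> \<longleftrightarrow> (Rep_omega1 \<xi>, Rep_omega1 \<eta>) \<in> cardSuc natLeq"

definition less_omega1 :: "omega1 \<Rightarrow> omega1 \<Rightarrow> bool"
  where "(\<xi>::omega1) < \<eta> \<longleftrightarrow> \<xi> \<le> \<eta> \<and> \<xi> \<noteq> \<eta>"

instance
proof
  have W: "refl_on (Field (cardSuc natLeq)) (cardSuc natLeq)" "trans (cardSuc natLeq)"
    "antisym (cardSuc natLeq)" "total_on (Field (cardSuc natLeq)) (cardSuc natLeq)"
    "wf (cardSuc natLeq - Id)"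
    using Well_order_cardSuc_natLeq
    unfolding well_order_on_def linear_order_on_def partial_order_on_def preorder_on_def by auto
  fix x y z :: omega1
  show refl: "x \<le> x"
    using W(1) Rep_omega1 by (simp add: less_eq_omega1_def refl_on_def)
  show "x \<le> y \<Longrightarrow> y \<le> z \<Longrightarrow> x \<le> z"
    unfolding less_eq_omega1_def using W(2) by (meson transD)
  show antisym: "x \<le> y \<Longrightarrow> y \<le> x \<Longrightarrow> x = y"
    unfolding less_eq_omega1_def using W(3) by (meson Rep_omega1_inject antisymD)
  show "x < y \<longleftrightarrow> x \<le> y \<and> \<not> y \<le> x"
    using antisym refl by (auto simp: less_omega1_def)
  show "x \<le> y \<or> y \<le> x"
    using W(4) refl Rep_omega1 unfolding less_eq_omega1_def total_on_def
    by (metis Rep_omega1_inject)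
next
  fix P :: "omega1 \<Rightarrow> bool" and a :: omega1
  assume step: "\<And>x. (\<And>y. y < x \<Longrightarrow> P y) \<Longrightarrow> P x"
  have "wf (inv_image (cardSuc natLeq - Id) Rep_omega1)"
    using Well_order_cardSuc_natLeq by (simp add: well_order_on_def)
  also have "inv_image (cardSuc natLeq - Id) Rep_omega1 = {(x, y). x < y}"
    by (auto simp: inv_image_def less_omega1_def less_eq_omega1_def Rep_omega1_inject)
  finally have "wf {(x, y :: omega1). x < y}" .
  then show "P a"
    by (rule wf_induct_rule) (rule step, simp)
qed

end

lemma countable_below_omega1:
  includes cardinal_syntax
  shows "countable {..<\<xi>::omega1}"
proof -
  have "|underS (cardSuc natLeq) (Rep_omega1 \<xi>)| <o cardSuc natLeq"
    by (rule card_of_underS[OF Card_order_cardSuc_natLeq Rep_omega1])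
  then have "|underS (cardSuc natLeq) (Rep_omega1 \<xi>)| \<le>o natLeq"
    using cardSuc_ordLeq_ordLess[OF natLeq_Card_order card_of_Card_order] by blast
  then have c: "countable (underS (cardSuc natLeq) (Rep_omega1 \<xi>))"
    by (simp add: countable_card_le_natLeq)
  have "Rep_omega1 ` {..<\<xi>} \<subseteq> underS (cardSuc natLeq) (Rep_omega1 \<xi>)"
    by (auto simp: underS_def less_omega1_def less_eq_omega1_def Rep_omega1_inject)
  then have "countable (Rep_omega1 ` {..<\<xi>})"
    using c countable_subset by blast
  then show ?thesis
    by (rule countable_image_inj_on) (simp add: inj_on_def Rep_omega1_inject)
qed

lemma uncountable_omega1:
  includes cardinal_syntax
  shows "uncountable (UNIV :: omega1 set)"
proof
  assume "countable (UNIV :: omega1 set)"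
  then have "countable (range Rep_omega1)" by simp
  then have "countable (Field (cardSuc natLeq))"
    using type_definition.Rep_range[OF type_definition_omega1] by simp
  then have "|Field (cardSuc natLeq)| \<le>o natLeq"
    by (simp add: countable_card_le_natLeq)
  moreover have "natLeq <o |Field (cardSuc natLeq)|"
    using cardSuc_greater[OF natLeq_Card_order] card_of_Field_ordIso[OF Card_order_cardSuc_natLeq]
    by (meson ordIso_symmetric ordLess_ordIso_trans)
  ultimately show False
    using not_ordLess_ordLeq by blast
qed

instantiation omega1 :: zero
begin
definition zero_omega1 :: omega1 where "0 = (LEAST \<xi>::omega1. True)"
instance ..
end

lemma omega1_zero_le [simp]: "(0::omega1) \<le> \<xi>"
  unfolding zero_omega1_def by (rule Least_le) simp

instantiation omega1 :: conditionally_complete_linorder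
begin

definition inf_omega1 :: "omega1 \<Rightarrow> omega1 \<Rightarrow> omega1" where "inf_omega1 = min"
definition sup_omega1 :: "omega1 \<Rightarrow> omega1 \<Rightarrow> omega1" where "sup_omega1 = max"
definition Inf_omega1 :: "omega1 set \<Rightarrow> omega1" where "Inf (A :: omega1 set) = (LEAST \<xi>. \<xi> \<in> A)"
definition Sup_omega1 :: "omega1 set \<Rightarrow> omega1" where "Sup (A :: omega1 set) = (LEAST \<xi>. \<forall>\<alpha>\<in>A. \<alpha> \<le> \<xi>)"

instance
proof
  fix x z :: omega1 and X :: "omega1 set"
  show "x \<in> X \<Longrightarrow> bdd_below X \<Longrightarrow> Inf X \<le> x"
    by (simp add: Inf_omega1_def Least_le)
  show "X \<noteq> {} \<Longrightarrow> (\<And>x. x \<in> X \<Longrightarrow> z \<le> x) \<Longrightarrow> z \<le> Inf X"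
    unfolding Inf_omega1_def by (metis (no_types, lifting) LeastI_ex ex_in_conv)
  show "x \<in> X \<Longrightarrow> bdd_above X \<Longrightarrow> x \<le> Sup X"
  proof -
    assume "x \<in> X" "bdd_above X"
    then have "\<exists>\<xi>. \<forall>\<alpha>\<in>X. \<alpha> \<le> \<xi>" by (auto simp: bdd_above_def)
    then have "\<forall>\<alpha>\<in>X. \<alpha> \<le> Sup X" unfolding Sup_omega1_def by (rule LeastI_ex)
    then show "x \<le> Sup X" using \<open>x \<in> X\<close> by blast
  qed
  show "X \<noteq> {} \<Longrightarrow> (\<And>x. x \<in> X \<Longrightarrow> x \<le> z) \<Longrightarrow> Sup X \<le> z"
    unfolding Sup_omega1_def by (rule Least_le) blast
qed (auto simp: inf_omega1_def sup_omega1_def)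

end

lemma omega1_Sup_empty [simp]: "Sup {} = (0::omega1)"
  by (simp add: Sup_omega1_def zero_omega1_def)

lemma countable_atMost_omega1: "countable {..\<xi>::omega1}"
proof -
  have "{..\<xi>} = insert \<xi> {..<\<xi>}" by auto
  then show ?thesis by (simp add: countable_below_omega1)
qed

lemma omega1_ex_greater: "\<exists>\<eta>. \<xi> < (\<eta>::omega1)"
proof (rule ccontr)
  assume "\<nexists>\<eta>. \<xi> < \<eta>"
  then have "UNIV = {..\<xi>}" by (auto simp: not_less)
  then show False using countable_atMost_omega1 uncountable_omega1 by metis
qed

definition osuc :: "omega1 \<Rightarrow> omega1"
  where "osuc \<xi> = (LEAST \<eta>. \<xi> < \<eta>)"

lemma osuc_greater [simp]: "\<xi> < osuc \<xi>"
  unfolding osuc_def using omega1_ex_greater by (rule LeastI_ex)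

lemma osuc_le_iff: "osuc \<xi> \<le> \<eta> \<longleftrightarrow> \<xi> < \<eta>"
  using osuc_greater[of \<xi>] Least_le[of "\<lambda>\<eta>. \<xi> < \<eta>" \<eta>] unfolding osuc_def by auto

lemma inj_osuc: "inj osuc"
proof (rule injI)
  fix \<xi> \<eta> assume "osuc \<xi> = osuc \<eta>"
  then have "osuc \<xi> \<le> \<zeta> \<longleftrightarrow> osuc \<eta> \<le> \<zeta>" for \<zeta> by simp
  then have "\<xi> < \<zeta> \<longleftrightarrow> \<eta> < \<zeta>" for \<zeta> by (simp add: osuc_le_iff)
  from this[of \<xi>] this[of \<eta>] show "\<xi> = \<eta>" by (metis less_irrefl less_linear)
qed

definition is_osuc :: "omega1 \<Rightarrow> bool"
  where "is_osuc \<xi> \<longleftrightarrow> (\<exists>\<mu>. \<xi> = osuc \<mu>)"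

definition opred :: "omega1 \<Rightarrow> omega1"
  where "opred \<xi> = (THE \<mu>. \<xi> = osuc \<mu>)"

lemma opred_osuc [simp]: "opred (osuc \<mu>) = \<mu>"
  using inj_osuc by (auto simp: opred_def inj_def)

lemma is_osuc_osuc [simp]: "is_osuc (osuc \<mu>)"
  by (auto simp: is_osuc_def)

lemma not_is_osuc_zero [simp]: "\<not> is_osuc 0"
proof
  assume "is_osuc 0"
  then obtain \<mu> where "0 = osuc \<mu>" by (auto simp: is_osuc_def)
  then have "\<mu> < 0" using osuc_greater[of \<mu>] by simp
  then show False by (simp add: leD)
qed

lemma opred_less: "is_osuc \<xi> \<Longrightarrow> opred \<xi> < \<xi>"
  by (auto simp: is_osuc_def)


section \<open>\<open>\<omega>\<close>-Stone spaces\<close>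

definition second_countable_space :: "'a topology \<Rightarrow> bool"
  where "second_countable_space X \<longleftrightarrow>
    (\<exists>\<B>. countable \<B> \<and> (\<forall>B\<in>\<B>. openin X B) \<and>
         (\<forall>U. openin X U \<longrightarrow> (\<exists>\<U>\<subseteq>\<B>. \<Union>\<U> = U)))"

definition totally_disconnected_space :: "'a topology \<Rightarrow> bool"
  where "totally_disconnected_space X \<longleftrightarrow> (\<forall>S. connectedin X S \<longrightarrow> (\<exists>a. S \<subseteq> {a}))"

text \<open>
  Second countability is what the \<open>\<omega>\<close> stands for: such spaces are the Stone spaces of countable
  Boolean rings. For compact spaces it follows from metrisability. Without it the
  Cantor-Bendixson length need not be countable, and the invariants below do not determine the
  space: all infinite discrete spaces share them.
\<close>

definition omega_Stone_space :: "'a topology \<Rightarrow> bool"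
  where "omega_Stone_space X \<longleftrightarrow>
    locally_compact_space X \<and> metrizable_space X \<and> second_countable_space X \<and>
    totally_disconnected_space X \<and> Hausdorff_space X"

definition Cantor_space :: "(nat \<Rightarrow> bool) topology"
  where "Cantor_space = product_topology (\<lambda>_. discrete_topology UNIV) UNIV"

text \<open>The choice of the removed point is immaterial, the Cantor set being homogeneous.\<close>

definition Cantor_space_minus_point :: "(nat \<Rightarrow> bool) topology"
  where "Cantor_space_minus_point = subtopology Cantor_space (UNIV - {\<lambda>_. False})"


section \<open>Upper semi-continuous maps to \<open>\<omega>\<^sub>1\<close>\<close>

text \<open>Maps \<open>r\<close> on a space \<open>K\<close> are used only through their values on \<^term>\<open>topspace K\<close>.\<close>

definition usc_map :: "'a topology \<Rightarrow> ('a \<Rightarrow> omega1) \<Rightarrow> bool"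
  where "usc_map K r \<longleftrightarrow> (\<forall>\<xi>. closedin K {x \<in> topspace K. r x \<ge> \<xi>})"

definition rank_sup :: "'a topology \<Rightarrow> ('a \<Rightarrow> omega1) \<Rightarrow> omega1"
  where "rank_sup K r = (SUP x\<in>topspace K. r x)"

definition rank_above :: "'a topology \<Rightarrow> ('a \<Rightarrow> omega1) \<Rightarrow> omega1 \<Rightarrow> 'a set"
  where "rank_above K r \<xi> = {x \<in> topspace K. r x > \<xi>}"

definition rho_U :: "'a topology \<Rightarrow> ('a \<Rightarrow> omega1) \<Rightarrow> omega1"
  where "rho_U K r = (LEAST \<xi>. compactin K (rank_above K r \<xi>))"

definition rank_homeomorphic ::
    "'a topology \<Rightarrow> ('a \<Rightarrow> omega1) \<Rightarrow> 'b topology \<Rightarrow> ('b \<Rightarrow> omega1) \<Rightarrow> bool"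
  where "rank_homeomorphic U r V s \<longleftrightarrow>
    (\<exists>\<phi>. homeomorphic_map U V \<phi> \<and> (\<forall>u\<in>topspace U. s (\<phi> u) = r u))"

lemma rank_sup_empty: "topspace K = {} \<Longrightarrow> rank_sup K r = 0"
  by (simp add: rank_sup_def)

lemma rho_U_empty: "topspace K = {} \<Longrightarrow> rho_U K r = 0"
  by (simp add: rho_U_def rank_above_def zero_omega1_def)


section \<open>Cantor-Bendixson invariants\<close>

function CB :: "'a topology \<Rightarrow> omega1 \<Rightarrow> 'a set" where
  "CB W \<xi> =
    (if \<xi> = 0 then topspace W
     else if is_osuc \<xi> then W derived_set_of (CB W (opred \<xi>))
     else (\<Inter>\<eta>\<in>{..<\<xi>}. CB W \<eta>))"
  by pat_completeness auto
termination
  by (relation "inv_image {(\<xi>, \<eta>). \<xi> < \<eta>} snd") (auto simp: wf opred_less)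

declare CB.simps [simp del]

lemma CB_zero: "CB W 0 = topspace W"
  by (simp add: CB.simps)

lemma CB_osuc: "CB W (osuc \<xi>) = W derived_set_of (CB W \<xi>)"
proof -
  have "osuc \<xi> \<noteq> 0" using is_osuc_osuc[of \<xi>] not_is_osuc_zero by metis
  then show ?thesis by (subst CB.simps) simp
qed

lemma CB_limit: "\<eta> \<noteq> 0 \<Longrightarrow> \<not> is_osuc \<eta> \<Longrightarrow> CB W \<eta> = (\<Inter>\<xi>\<in>{..<\<eta>}. CB W \<xi>)"
  by (subst CB.simps) simp

definition CB_diff :: "'a topology \<Rightarrow> omega1 \<Rightarrow> 'a set"
  where "CB_diff W \<xi> = CB W \<xi> - CB W (osuc \<xi>)"

definition CB_length :: "'a topology \<Rightarrow> omega1"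
  where "CB_length W = (LEAST \<xi>. CB W \<xi> = CB W (osuc \<xi>))"

definition CB_kernel :: "'a topology \<Rightarrow> 'a set"
  where "CB_kernel W = CB W (CB_length W)"

definition CB_count :: "'a topology \<Rightarrow> ereal"
  where "CB_count W =
    (if is_osuc (CB_length W) \<and> finite (CB W (opred (CB_length W)) - CB_kernel W)
     then ereal (real (card (CB W (opred (CB_length W)) - CB_kernel W)))
     else -\<infinity>)"

definition kernel_rank :: "'a topology \<Rightarrow> 'a \<Rightarrow> omega1"
  where "kernel_rank W x = (LEAST \<xi>. x \<notin> W closure_of (CB W \<xi> - CB_kernel W))"

definition rho :: "'a topology \<Rightarrow> omega1"
  where "rho W = (LEAST \<xi>. compactin W (W closure_of (CB_diff W \<xi>)))"

definition has_invariants ::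
    "'a topology \<Rightarrow> omega1 \<Rightarrow> omega1 \<Rightarrow> ereal \<Rightarrow> 'k topology \<Rightarrow> ('k \<Rightarrow> omega1) \<Rightarrow> bool"
  where "has_invariants W \<nu> \<rho> n K r \<longleftrightarrow>
    CB_length W = \<nu> \<and> rho W = \<rho> \<and> CB_count W = n \<and>
    rank_homeomorphic (subtopology W (CB_kernel W)) (kernel_rank W) K r"

end

theory Submission
  imports Defs "HOL-Library.Sublist"
begin

text \<open>
  Let \<open>W\<close> be an \<open>\<omega>\<close>-Stone space and rank its points by the Cantor-Bendixson rank off the kernel and
  by \<open>r\<^sub>W\<close> on it. A point is then an accumulation point of the set of non-kernel points of rank at
  least \<open>\<xi>\<close> if and only if its own rank exceeds \<open>\<xi>\<close>. The point added by the one-point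
  compactification obeys the same law once it is put into the kernel with rank \<open>\<rho>(W)\<close>, so
  non-compact spaces need no separate treatment.

  Uniqueness is a back-and-forth argument on clopen sets of the compactifications. Call \<open>A\<close> and
  \<open>B\<close> matched if the given isomorphism \<open>\<phi>\<close> of kernels carries the kernel part of \<open>A\<close> to that of \<open>B\<close>,
  and if \<open>A\<close> and \<open>B\<close> have the same maximal rank, attained by the same finite number of non-kernel
  points. Every clopen splitting of one of two matched sets can be copied in the other. For the
  whole space, the maximal rank and the number of points amount to \<open>\<nu>\<close> and \<open>n\<close>.

  For existence, compactify \<open>K\<close> by a point \<open>c\<close> of rank \<open>\<rho>\<close> and attach to it a null sequence of
  well-founded trees, infinitely many of rank \<open>\<xi>\<close> near each point of a countable dense subset of
  the points of rank above \<open>\<xi>\<close>, together with \<open>n\<close> trees of the top rank. Then remove \<open>c\<close>.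
\<close>

section \<open>A back-and-forth lemma for Boolean spaces\<close>

text \<open>One number n suffices because all other levels are infinite wherever they matter: near a
  point of rank above \<xi> there are infinitely many non-kernel points of rank exactly \<xi>, so
  that only the points of maximal rank of a clopen set can be counted. The maximum exists by
  compactness, as the sets of points of rank above \<xi> are closed. This explains (iii) and (iv).
  If the maximum \<tau> of the compactification is attained only in the kernel or at infinity, then
  \<nu> = \<tau> and n = -\<infinity>; otherwise \<nu> is the successor of \<tau>, and n counts the
  non-kernel points of rank \<tau>. Condition (i) makes the sets of points of K of rank above \<xi>
  compact for \<xi> at least \<rho>, so that r stays upper semi-continuous when the point at
  infinity receives rank \<rho>. In the construction, the danger is that attached trees create new
  limit points. An infinite branch would do so, and strictly decreasing ranks exclude it.\<close>

definition clopenin :: "'a topology \<Rightarrow> 'a set \<Rightarrow> bool"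
  where "clopenin X A \<longleftrightarrow> openin X A \<and> closedin X A"

lemma clopenin_subset: "clopenin X A \<Longrightarrow> A \<subseteq> topspace X"
  by (simp add: clopenin_def openin_subset)

lemma clopenin_topspace [simp]: "clopenin X (topspace X)"
  by (simp add: clopenin_def)

lemma clopenin_Int: "clopenin X A \<Longrightarrow> clopenin X B \<Longrightarrow> clopenin X (A \<inter> B)"
  by (simp add: clopenin_def openin_Int closedin_Int)

lemma clopenin_Diff: "clopenin X A \<Longrightarrow> clopenin X B \<Longrightarrow> clopenin X (A - B)"
  by (simp add: clopenin_def openin_diff closedin_diff)

text \<open>These are the Stone spaces of countable Boolean algebras. They are given by the
  countable family that the back-and-forth tree consumes; Hausdorffness and the separation of closed
  sets by clopen ones follow by compactness.\<close>

definition Boolean_space :: "'a topology \<Rightarrow> bool"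
  where "Boolean_space X \<longleftrightarrow> compact_space X \<and>
    (\<exists>\<C>. countable \<C> \<and> (\<forall>C\<in>\<C>. clopenin X C) \<and>
      (\<forall>x\<in>topspace X. \<forall>y\<in>topspace X. (\<forall>C\<in>\<C>. x \<in> C \<longleftrightarrow> y \<in> C) \<longrightarrow> x = y))"

lemma Boolean_space_imp_compact: "Boolean_space X \<Longrightarrow> compact_space X"
  by (simp add: Boolean_space_def)

lemma Boolean_space_separates_points:
  assumes "Boolean_space X" "x \<in> topspace X" "y \<in> topspace X" "x \<noteq> y"
  shows "separated_between X {x} {y}"
proof -
  obtain C where "clopenin X C" "(x \<in> C) \<noteq> (y \<in> C)"
    using assms unfolding Boolean_space_def by metis
  then have "\<not> quasi_component_of X x y"
    by (auto simp: quasi_component_of_def clopenin_def)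
  then show ?thesis
    using assms by (simp add: separated_between_singletons)
qed

lemma Boolean_space_imp_Hausdorff:
  assumes "Boolean_space X" shows "Hausdorff_space X"
  unfolding Hausdorff_space_def
  using Boolean_space_separates_points[OF assms] unfolding separated_between_def
  by (metis insert_subset)

lemma Boolean_space_separates_closed:
  assumes X: "Boolean_space X" and S: "closedin X S" and T: "closedin X T" and "S \<inter> T = {}"
  obtains D where "clopenin X D" "S \<subseteq> D" "D \<inter> T = {}"
proof -
  have cS: "compactin X S" and cT: "compactin X T"
    using X S T Boolean_space_imp_compact closedin_compact_space by blast+
  have "separated_between X S T"
    using closedin_subset[OF S] closedin_subset[OF T] assms(4)
      Boolean_space_separates_points[OF X]
    apply (simp add: separated_between_pointwise_left[OF cS] separated_between_pointwise_right[OF cT])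
    apply blast
    done
  then obtain U where "openin X U" "closedin X U" "S \<subseteq> U" "T \<subseteq> topspace X - U"
    by (auto simp: separated_between)
  then show ?thesis
    by (intro that[of U]) (auto simp: clopenin_def)
qed

lemma Boolean_space_sequence:
  assumes "Boolean_space X"
  obtains C :: "nat \<Rightarrow> 'a set" where "\<And>n. clopenin X (C n)"
    "\<And>x y. x \<in> topspace X \<Longrightarrow> y \<in> topspace X \<Longrightarrow> (\<And>n. x \<in> C n \<longleftrightarrow> y \<in> C n) \<Longrightarrow> x = y"
proof -
  obtain \<C> where "countable \<C>" and clo: "\<forall>C\<in>\<C>. clopenin X C"
    and sep: "\<forall>x\<in>topspace X. \<forall>y\<in>topspace X. (\<forall>C\<in>\<C>. x \<in> C \<longleftrightarrow> y \<in> C) \<longrightarrow> x = y"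
    using assms by (auto simp: Boolean_space_def)
  \<comment> \<open>Adding the whole space makes the family nonempty, so that
    \<open>from_nat_into\<close> enumerates it in every case.\<close>
  define C where "C = from_nat_into (insert (topspace X) \<C>)"
  have ran: "range C = insert (topspace X) \<C>"
    unfolding C_def using \<open>countable \<C>\<close> by (intro range_from_nat_into) auto
  show thesis
  proof
    show "clopenin X (C n)" for n
      using ran clo clopenin_topspace by (metis insertE rangeI)
    show "x = y" if "x \<in> topspace X" "y \<in> topspace X" "\<And>n. x \<in> C n \<longleftrightarrow> y \<in> C n" for x y
    proof -
      have "\<forall>C\<in>\<C>. x \<in> C \<longleftrightarrow> y \<in> C"
        using that(3) ran by (metis insertCI rangeE)
      then show ?thesis using sep that by blast
    qed
  qed
qed

section \<open>Binary schemes of clopen sets, indexed by bit lists with the newest bit first\<close>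

locale binary_scheme =
  fixes X :: "'a topology" and H :: "bool list \<Rightarrow> 'a set"
  assumes compact: "compact_space X"
    and Nil: "H [] = topspace X"
    and True_sub: "H (True # s) \<subseteq> H s"
    and False_eq: "H (False # s) = H s - H (True # s)"
    and clopen: "clopenin X (H s)"
    and separating: "x \<in> topspace X \<Longrightarrow> y \<in> topspace X \<Longrightarrow> (\<And>s. x \<in> H s \<longleftrightarrow> y \<in> H s) \<Longrightarrow> x = y"
begin

lemma Cons_sub: "H (b # s) \<subseteq> H s"
  using True_sub False_eq by (cases b) auto

lemma ex_address: "x \<in> topspace X \<Longrightarrow> \<exists>s. length s = n \<and> x \<in> H s"
proof (induction n)
  case 0
  then show ?case by (simp add: Nil)
next
  case (Suc n)
  then obtain s where "length s = n" "x \<in> H s" by blast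
  then show ?case
    using False_eq[of s] by (metis DiffI length_Cons)
qed

lemma address_unique: "x \<in> H s \<Longrightarrow> x \<in> H t \<Longrightarrow> length s = length t \<Longrightarrow> s = t"
proof (induction s arbitrary: t)
  case (Cons b s)
  then obtain c t' where t: "t = c # t'" by (cases t) auto
  with Cons Cons_sub have "s = t'" by (metis length_Cons nat.inject subsetD)
  then show ?case using Cons.prems t False_eq by (cases b; cases c) auto
qed simp

definition address :: "'a \<Rightarrow> nat \<Rightarrow> bool list"
  where "address x n = (SOME s. length s = n \<and> x \<in> H s)"

lemma address:
  assumes "x \<in> topspace X"
  shows "length (address x n) = n" "x \<in> H (address x n)"
  using someI_ex[OF ex_address[OF assms, of n]] by (auto simp: address_def)

lemma in_iff_address:
  assumes "x \<in> topspace X"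
  shows "x \<in> H s \<longleftrightarrow> address x (length s) = s"
  using address[OF assms, of "length s"] address_unique by metis

lemma address_Suc: "x \<in> topspace X \<Longrightarrow> \<exists>b. address x (Suc n) = b # address x n"
  using address[of x "Suc n"] address[of x n] Cons_sub address_unique
  by (metis length_Suc_conv subsetD)

text \<open>If no cell around \<open>x\<close> were inside \<open>U\<close>, compactness would give
  a point outside \<open>U\<close> that lies in all cells of \<open>x\<close>; such a point equals
  \<open>x\<close>, since the cells separate points.\<close>

lemma small_neighbourhood:
  assumes "openin X U" "x \<in> U"
  obtains s where "x \<in> H s" "H s \<subseteq> U"
proof (rule ccontr)
  note that
  assume contra: "\<not> thesis"
  have x: "x \<in> topspace X" using assms openin_subset by blast
  have "(\<Inter>n. H (address x n) - U) \<noteq> {}"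
  proof (rule compact_space_imp_nest[OF compact])
    show "closedin X (H (address x n) - U)" for n
      using clopen assms(1) by (auto simp: clopenin_def)
    show "H (address x n) - U \<noteq> {}" for n
      using address[OF x] contra that by blast
    show "decseq (\<lambda>n. H (address x n) - U)"
      using address_Suc[OF x] Cons_sub by (intro decseq_SucI) (metis Diff_mono order_refl)
  qed
  then obtain y where y: "\<And>n. y \<in> H (address x n)" "y \<notin> U" by blast
  have yX: "y \<in> topspace X" using y(1)[of 0] clopen clopenin_subset by blast
  have "x = y"
    using separating[OF x yX] in_iff_address[OF x] in_iff_address[OF yX] y(1)
    by (metis address(1) address_unique x yX in_iff_address)
  then show False using y assms by blast
qed

end

text \<open>The cells of \<open>x\<close> trace a branch whose cells in \<open>Y\<close> are
  nonempty and closed, and compactness gives a point on it. Cells off the branch miss this point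
  because cells of equal length are disjoint.\<close>

lemma binary_scheme_match:
  assumes H: "binary_scheme X H" and G: "binary_scheme Y G"
    and ne: "\<And>s. H s \<noteq> {} \<Longrightarrow> G s \<noteq> {}" and x: "x \<in> topspace X"
  shows "\<exists>y\<in>topspace Y. \<forall>s. x \<in> H s \<longleftrightarrow> y \<in> G s"
proof -
  interpret H: binary_scheme X H by fact
  interpret G: binary_scheme Y G by fact
  have "(\<Inter>n. G (H.address x n)) \<noteq> {}"
  proof (rule compact_space_imp_nest[OF G.compact])
    show "closedin Y (G (H.address x n))" for n
      using G.clopen by (auto simp: clopenin_def)
    show "G (H.address x n) \<noteq> {}" for n
      using H.address[OF x] ne by blast
    show "decseq (\<lambda>n. G (H.address x n))"
      using H.address_Suc[OF x] G.Cons_sub by (intro decseq_SucI) metis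
  qed
  then obtain y where y: "\<And>n. y \<in> G (H.address x n)" by blast
  have yY: "y \<in> topspace Y" using y[of 0] G.clopen clopenin_subset by blast
  have "x \<in> H s \<longleftrightarrow> y \<in> G s" for s
    using H.in_iff_address[OF x] y H.address(1)[OF x] G.address_unique by metis
  then show ?thesis using yY by blast
qed

lemma binary_scheme_continuous:
  assumes H: "binary_scheme X H" and G: "binary_scheme Y G"
    and f: "\<And>x. x \<in> topspace X \<Longrightarrow> f x \<in> topspace Y \<and> (\<forall>s. x \<in> H s \<longleftrightarrow> f x \<in> G s)"
  shows "continuous_map X Y f"
  unfolding continuous_map_def
proof (intro conjI allI impI)
  interpret H: binary_scheme X H by fact
  interpret G: binary_scheme Y G by fact
  show "f \<in> topspace X \<rightarrow> topspace Y" using f by blast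
  fix U assume U: "openin Y U"
  show "openin X {x \<in> topspace X. f x \<in> U}"
  proof (subst openin_subopen, intro ballI)
    fix x assume "x \<in> {x \<in> topspace X. f x \<in> U}"
    then have x: "x \<in> topspace X" "f x \<in> U" by auto
    obtain s where s: "f x \<in> G s" "G s \<subseteq> U"
      using G.small_neighbourhood[OF U x(2)] .
    show "\<exists>T. openin X T \<and> x \<in> T \<and> T \<subseteq> {x \<in> topspace X. f x \<in> U}"
      using H.clopen[of s] clopenin_subset[OF H.clopen[of s]] f x s
      by (intro exI[of _ "H s"]) (auto simp: clopenin_def)
  qed
qed

lemma binary_scheme_homeomorphic:
  assumes H: "binary_scheme X H" and G: "binary_scheme Y G"
    and ne: "\<And>s. H s \<noteq> {} \<longleftrightarrow> G s \<noteq> {}"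
  shows "\<exists>f. homeomorphic_map X Y f \<and> (\<forall>x\<in>topspace X. \<forall>s. x \<in> H s \<longleftrightarrow> f x \<in> G s)"
proof -
  interpret H: binary_scheme X H by fact
  interpret G: binary_scheme Y G by fact
  obtain f where f: "\<And>x. x \<in> topspace X \<Longrightarrow> f x \<in> topspace Y \<and> (\<forall>s. x \<in> H s \<longleftrightarrow> f x \<in> G s)"
    using binary_scheme_match[OF H G] ne by metis
  obtain g where g: "\<And>y. y \<in> topspace Y \<Longrightarrow> g y \<in> topspace X \<and> (\<forall>s. y \<in> G s \<longleftrightarrow> g y \<in> H s)"
    using binary_scheme_match[OF G H] ne by metis
  have "homeomorphic_maps X Y f g"
    unfolding homeomorphic_maps_def
    using binary_scheme_continuous[OF H G f] binary_scheme_continuous[OF G H g]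
      f g H.separating G.separating by metis
  then show ?thesis using f homeomorphic_maps_map by blast
qed

text \<open>The tree alternates between splitting along a separating sequence of \<open>X\<close> and one of \<open>Y\<close>.\<close>

lemma back_and_forth:
  fixes X :: "'a topology" and Y :: "'b topology"
  assumes X: "Boolean_space X" and Y: "Boolean_space Y"
    and top: "R (topspace X) (topspace Y)"
    and R: "\<And>A B. R A B \<Longrightarrow> clopenin X A \<and> clopenin Y B \<and> (A = {} \<longleftrightarrow> B = {})"
    and forward: "\<And>A B A1. R A B \<Longrightarrow> clopenin X A1 \<Longrightarrow> A1 \<subseteq> A \<Longrightarrow>
      \<exists>B1\<subseteq>B. R A1 B1 \<and> R (A - A1) (B - B1)"
    and backward: "\<And>A B B1. R A B \<Longrightarrow> clopenin Y B1 \<Longrightarrow> B1 \<subseteq> B \<Longrightarrow>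
      \<exists>A1\<subseteq>A. R A1 B1 \<and> R (A - A1) (B - B1)"
  obtains f P Q where "homeomorphic_map X Y f" "binary_scheme X P" "binary_scheme Y Q"
    "\<And>s. R (P s) (Q s)" "\<And>x s. x \<in> topspace X \<Longrightarrow> x \<in> P s \<longleftrightarrow> f x \<in> Q s"
proof -
  obtain C where C: "\<And>n::nat. clopenin X (C n)"
    "\<And>x y. x \<in> topspace X \<Longrightarrow> y \<in> topspace X \<Longrightarrow> (\<And>n. x \<in> C n \<longleftrightarrow> y \<in> C n) \<Longrightarrow> x = y"
    using Boolean_space_sequence[OF X] by blast
  obtain D where D: "\<And>n::nat. clopenin Y (D n)"
    "\<And>x y. x \<in> topspace Y \<Longrightarrow> y \<in> topspace Y \<Longrightarrow> (\<And>n. x \<in> D n \<longleftrightarrow> y \<in> D n) \<Longrightarrow> x = y"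
    using Boolean_space_sequence[OF Y] by blast
  define good where "good n AB AB1 \<longleftrightarrow> fst AB1 \<subseteq> fst AB \<and> snd AB1 \<subseteq> snd AB \<and> R (fst AB1) (snd AB1) \<and>
      R (fst AB - fst AB1) (snd AB - snd AB1) \<and>
      (if even n then fst AB1 = fst AB \<inter> C (n div 2) else snd AB1 = snd AB \<inter> D (n div 2))"
    for n :: nat and AB AB1
  have ex: "\<exists>AB1. good n AB AB1" if "R (fst AB) (snd AB)" for n AB
  proof (cases "even n")
    case True
    have "clopenin X (fst AB \<inter> C (n div 2))" using R[OF that] C clopenin_Int by blast
    from forward[OF that this] obtain B1 where "B1 \<subseteq> snd AB" "R (fst AB \<inter> C (n div 2)) B1"
      "R (fst AB - fst AB \<inter> C (n div 2)) (snd AB - B1)" by auto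
    then show ?thesis
      using True by (intro exI[of _ "(fst AB \<inter> C (n div 2), B1)"]) (auto simp: good_def)
  next
    case False
    have "clopenin Y (snd AB \<inter> D (n div 2))" using R[OF that] D clopenin_Int by blast
    from backward[OF that this] obtain A1 where "A1 \<subseteq> fst AB" "R A1 (snd AB \<inter> D (n div 2))"
      "R (fst AB - A1) (snd AB - snd AB \<inter> D (n div 2))" by auto
    then show ?thesis
      using False by (intro exI[of _ "(A1, snd AB \<inter> D (n div 2))"]) (auto simp: good_def)
  qed
  define step where "step n AB = (SOME AB1. good n AB AB1)" for n AB
  have step: "good n AB (step n AB)" if "R (fst AB) (snd AB)" for n AB
    unfolding step_def using someI_ex[OF ex[OF that]] .
  define F where "F = rec_list (topspace X, topspace Y)
     (\<lambda>b s AB. if b then step (length s) AB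
       else (fst AB - fst (step (length s) AB), snd AB - snd (step (length s) AB)))"
  have F_simps: "F [] = (topspace X, topspace Y)" "F (True # s) = step (length s) (F s)"
    "F (False # s) = (fst (F s) - fst (F (True # s)), snd (F s) - snd (F (True # s)))" for s
    by (simp_all add: F_def)
  have RF: "R (fst (F s)) (snd (F s))" for s
  proof (induction s)
    case (Cons b s)
    show ?case using step[OF Cons, of "length s"] by (cases b) (auto simp: F_simps good_def)
  qed (simp add: F_simps top)
  have gF: "good (length s) (F s) (F (True # s))" for s
    using step[OF RF] by (simp add: F_simps)
  have 1: "binary_scheme X (fst \<circ> F)"
  proof
    show "compact_space X" using X by (rule Boolean_space_imp_compact)
    fix x y assume x: "x \<in> topspace X" and y: "y \<in> topspace X"
      and eq: "\<And>s. (x \<in> (fst \<circ> F) s) = (y \<in> (fst \<circ> F) s)"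
    have *: "\<exists>s. length s = n \<and> x \<in> fst (F s)" for n
    proof (induction n)
      case 0
      then show ?case using x by (simp add: F_simps)
    next
      case (Suc n)
      then obtain s where "length s = n" "x \<in> fst (F s)" by blast
      then show ?case
        using F_simps(3)[of s] by (metis DiffI length_Cons prod.sel)
    qed
    show "x = y"
    proof (rule C(2)[OF x y])
      fix n
      \<comment> \<open>The cells at depth \<open>2 * n\<close> were cut along \<open>C n\<close>,
        so the cell of \<open>x\<close> and its \<open>True\<close> child decide membership in
        \<open>C n\<close>.\<close>
      obtain s where s: "length s = 2 * n" "x \<in> fst (F s)" using * by blast
      then show "x \<in> C n \<longleftrightarrow> y \<in> C n"
        using gF[of s] eq[of s] eq[of "True # s"] by (auto simp: good_def)
    qed
  qed (use R[OF RF] gF in \<open>auto simp: F_simps(1,3) good_def\<close>)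
  have 2: "binary_scheme Y (snd \<circ> F)"
  proof
    show "compact_space Y" using Y by (rule Boolean_space_imp_compact)
    fix x y assume x: "x \<in> topspace Y" and y: "y \<in> topspace Y"
      and eq: "\<And>s. (x \<in> (snd \<circ> F) s) = (y \<in> (snd \<circ> F) s)"
    have *: "\<exists>s. length s = n \<and> x \<in> snd (F s)" for n
    proof (induction n)
      case 0
      then show ?case using x by (simp add: F_simps)
    next
      case (Suc n)
      then obtain s where "length s = n" "x \<in> snd (F s)" by blast
      then show ?case
        using F_simps(3)[of s] by (metis DiffI length_Cons prod.sel)
    qed
    show "x = y"
    proof (rule D(2)[OF x y])
      fix n
      \<comment> \<open>The cuts along \<open>D n\<close> were made at the odd depth
        \<open>2 * n + 1\<close>.\<close>
      obtain s where s: "length s = 2 * n + 1" "x \<in> snd (F s)" using * by blast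
      then show "x \<in> D n \<longleftrightarrow> y \<in> D n"
        using gF[of s] eq[of s] eq[of "True # s"] by (auto simp: good_def)
    qed
  qed (use R[OF RF] gF in \<open>auto simp: F_simps(1,3) good_def\<close>)
  obtain f where "homeomorphic_map X Y f"
      "\<And>x s. x \<in> topspace X \<Longrightarrow> x \<in> (fst \<circ> F) s \<longleftrightarrow> f x \<in> (snd \<circ> F) s"
    using binary_scheme_homeomorphic[OF 1 2] R[OF RF] by (metis comp_apply)
  then show thesis using that[OF _ 1 2] RF by auto
qed

section \<open>Ranked spaces\<close>

text \<open>The maximum takes the points of \<open>K\<close> into account, the number does not:
  \<open>K\<close> is already controlled by the given isomorphism. Thus \<open>m = 0\<close> means
  that \<tau> is attained in \<open>K\<close> only.\<close>

definition peak :: "'a set \<Rightarrow> ('a \<Rightarrow> omega1) \<Rightarrow> 'a set \<Rightarrow> omega1 \<Rightarrow> nat \<Rightarrow> bool"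
  where "peak K rk A \<tau> m \<longleftrightarrow> (\<exists>x\<in>A. rk x = \<tau>) \<and> (\<forall>x\<in>A. rk x \<le> \<tau>) \<and>
    finite {x \<in> A - K. rk x = \<tau>} \<and> card {x \<in> A - K. rk x = \<tau>} = m"

text \<open>Counts add only on a tie. For \<tau>1 < \<tau>2 the peak of \<open>A\<close> says
  nothing about \<open>m1\<close>, which then has to be matched from an infinite supply of
  points.\<close>

lemma peak_split:
  assumes A: "peak K rk A \<tau> m" and A1: "peak K rk A1 \<tau>1 m1" and A2: "peak K rk (A - A1) \<tau>2 m2"
    and sub: "A1 \<subseteq> A" and le: "\<tau>1 \<le> \<tau>2"
  shows "\<tau> = \<tau>2" "m = (if \<tau>1 = \<tau>2 then m1 + m2 else m2)"
proof -
  show \<tau>: "\<tau> = \<tau>2"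
  proof (rule order_antisym)
    obtain x where "x \<in> A" "rk x = \<tau>" using A by (auto simp: peak_def)
    then show "\<tau> \<le> \<tau>2"
      using A1 A2 le unfolding peak_def by (metis DiffI order_trans)
    show "\<tau>2 \<le> \<tau>" using A A2 by (auto simp: peak_def)
  qed
  show "m = (if \<tau>1 = \<tau>2 then m1 + m2 else m2)"
  proof (cases "\<tau>1 = \<tau>2")
    case True
    have "{x \<in> A - K. rk x = \<tau>} = {x \<in> A1 - K. rk x = \<tau>} \<union> {x \<in> (A - A1) - K. rk x = \<tau>}"
      using sub by auto
    moreover have "card \<dots> = m1 + m2"
      using A1 A2 True \<tau> by (subst card_Un_disjoint) (auto simp: peak_def)
    ultimately show ?thesis using A True by (simp add: peak_def)
  next
    case False
    then have "\<And>x. x \<in> A1 \<Longrightarrow> rk x \<noteq> \<tau>" using A1 le \<tau> by (force simp: peak_def)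
    then have "{x \<in> A - K. rk x = \<tau>} = {x \<in> (A - A1) - K. rk x = \<tau>}" by auto
    then show ?thesis using A A2 False \<tau> by (simp add: peak_def)
  qed
qed

locale ranked_space =
  fixes X :: "'a topology" and K :: "'a set" and rk :: "'a \<Rightarrow> omega1"
  assumes Hausdorff: "Hausdorff_space X"
    and closed_kernel: "closedin X K"
    and rank_iff: "x \<in> topspace X \<Longrightarrow>
      x \<in> X derived_set_of {p \<in> topspace X - K. \<xi> \<le> rk p} \<longleftrightarrow> \<xi> < rk x"
begin

definition high :: "omega1 \<Rightarrow> 'a set"
  where "high \<xi> = {p \<in> topspace X - K. \<xi> \<le> rk p}"

lemma derived_high: "X derived_set_of high \<xi> = {x \<in> topspace X. \<xi> < rk x}"
  using rank_iff derived_set_of_subset_topspace by (fastforce simp: high_def)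

lemma high_antimono: "\<xi> \<le> \<eta> \<Longrightarrow> high \<eta> \<subseteq> high \<xi>"
  by (auto simp: high_def)

text \<open>A derived set is closed in a Hausdorff space, so the rank law alone makes
  \<open>rk\<close> upper semi-continuous on the whole space.\<close>

lemma closedin_above: "closedin X {x \<in> topspace X. \<xi> < rk x}"
  using closedin_derived_set_of[OF Hausdorff, of "high \<xi>"] by (simp add: derived_high)

text \<open>A point of minimal rank above \<open>\<xi>\<close> has rank \<open>\<xi>\<close>, as otherwise it would accumulate points of lower rank.\<close>

lemma rank_values_below:
  assumes U: "openin X U" and p: "p \<in> U" "p \<notin> K" and le: "\<xi> \<le> rk p"
  obtains q where "q \<in> U" "q \<notin> K" "rk q = \<xi>"
proof -
  let ?V = "U - K"
  have V: "openin X ?V" using U closed_kernel by (rule openin_diff)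
  define \<eta> where "\<eta> = (LEAST \<eta>. \<xi> \<le> \<eta> \<and> (\<exists>q\<in>?V. rk q = \<eta>))"
  have ex: "\<xi> \<le> \<eta> \<and> (\<exists>q\<in>?V. rk q = \<eta>)"
    unfolding \<eta>_def by (rule LeastI[of _ "rk p"]) (use p le in auto)
  have least: "\<eta> \<le> rk q" if "q \<in> ?V" "\<xi> \<le> rk q" for q
    unfolding \<eta>_def by (rule Least_le) (use that in auto)
  obtain q where q: "q \<in> ?V" "rk q = \<eta>" using ex by blast
  have "\<not> \<xi> < \<eta>"
  proof
    assume "\<xi> < \<eta>"
    have qX: "q \<in> topspace X" using q V openin_subset by blast
    have "q \<in> X derived_set_of high \<xi>"
      using \<open>\<xi> < \<eta>\<close> q qX by (simp add: derived_high)
    then have "q \<in> X derived_set_of (?V \<inter> high \<xi>)"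
      using openin_Int_derived_set_of_eq[OF V] q by blast
    moreover have "?V \<inter> high \<xi> \<subseteq> high \<eta>" using least by (auto simp: high_def)
    ultimately have "q \<in> X derived_set_of high \<eta>" using derived_set_of_mono by blast
    then show False using q by (simp add: derived_high)
  qed
  then show thesis using that q ex by auto
qed

text \<open>Every neighbourhood of \<open>x\<close>, with \<open>x\<close> deleted, contains a
  non-kernel point of rank at least \<xi>, and \<open>rank_values_below\<close> lowers it to rank
  exactly \<xi> inside that open set. So \<open>x\<close> accumulates the level \<xi> itself. This
  is the infinite supply used for copying clopen sets.\<close>

lemma infinite_rank_values_below:
  assumes U: "openin X U" and x: "x \<in> U" and lt: "\<xi> < rk x"
  shows "infinite {q \<in> U - K. rk q = \<xi>}"
proof -
  have xX: "x \<in> topspace X" using U x openin_subset by blast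
  have "x \<in> X derived_set_of {q \<in> topspace X - K. rk q = \<xi>}"
    unfolding in_derived_set_of
  proof (intro conjI allI impI xX)
    fix V assume V: "x \<in> V \<and> openin X V"
    have "x \<in> X derived_set_of high \<xi>" using lt xX by (simp add: derived_high)
    then obtain y where y: "y \<noteq> x" "y \<in> high \<xi>" "y \<in> V"
      using V unfolding in_derived_set_of by blast
    have "openin X (V - {x})"
      using V Hausdorff by (simp add: open_in_Hausdorff_delete)
    then obtain q where "q \<in> V - {x}" "q \<notin> K" "rk q = \<xi>"
      using rank_values_below[of "V - {x}" y \<xi>] y by (auto simp: high_def)
    then show "\<exists>y. y \<noteq> x \<and> y \<in> {q \<in> topspace X - K. rk q = \<xi>} \<and> y \<in> V"
      using V openin_subset by fastforce
  qed
  then have "infinite ({q \<in> topspace X - K. rk q = \<xi>} \<inter> U)"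
    using U x by (simp add: derived_set_of_infinite_openin[OF Hausdorff])
  moreover have "{q \<in> topspace X - K. rk q = \<xi>} \<inter> U = {q \<in> U - K. rk q = \<xi>}"
    using openin_subset[OF U] by auto
  ultimately show ?thesis by simp
qed

end

section \<open>Maximal ranks and prescribed clopen sets in the compact case\<close>

locale compact_ranked_space = ranked_space +
  assumes Boolean: "Boolean_space X"
begin

text \<open>Without a maximum, the closed sets of points of rank above \<open>rk y\<close>, for
  \<open>y\<close> in \<open>A\<close>, would have the finite intersection property on
  \<open>A\<close>, and a common point would exceed its own rank. If infinitely many non-kernel
  points attained the maximum, they would accumulate in \<open>A\<close> at a point of still larger
  rank.\<close>

lemma ex_peak:
  assumes A: "clopenin X A" and ne: "A \<noteq> {}"
  shows "\<exists>\<tau> m. peak K rk A \<tau> m"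
proof -
  have clA: "closedin X A" and AX: "A \<subseteq> topspace X"
    using A clopenin_subset by (auto simp: clopenin_def)
  have cA: "compactin X A"
    using clA Boolean Boolean_space_imp_compact closedin_compact_space by blast
  have "\<exists>x\<in>A. \<forall>y\<in>A. rk y \<le> rk x"
  proof (rule ccontr)
    assume "\<not> ?thesis"
    then have nomax: "\<And>x. x \<in> A \<Longrightarrow> \<exists>y\<in>A. rk x < rk y" by (meson not_le)
    let ?F = "\<lambda>y. {x \<in> topspace X. rk y < rk x}"
    have "A \<inter> \<Inter>(?F ` A) \<noteq> {}"
    proof (rule cA[unfolded compactin_fip, THEN conjunct2, rule_format], intro conjI allI ballI impI)
      show "closedin X C" if "C \<in> ?F ` A" for C using that closedin_above by auto
      fix \<F> assume "finite \<F> \<and> \<F> \<subseteq> ?F ` A"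
      then obtain T where T: "finite T" "T \<subseteq> A" "\<F> = ?F ` T" by (meson finite_subset_image)
      have "\<exists>z\<in>A. \<forall>y\<in>T. rk y < rk z"
        using T(1,2)
      proof (induction T rule: finite_induct)
        case (insert y T)
        then obtain z where z: "z \<in> A" "\<forall>y\<in>T. rk y < rk z" by auto
        obtain w where "w \<in> A" "max (rk z) (rk y) < rk w"
          using nomax z insert.prems by (metis insert_subset max_def)
        then show ?case using z by (intro bexI[of _ w]) auto
      qed (use ne in auto)
      then show "A \<inter> \<Inter>\<F> \<noteq> {}" using T AX by auto
    qed
    then show False by auto
  qed
  then obtain x where x: "x \<in> A" "\<And>y. y \<in> A \<Longrightarrow> rk y \<le> rk x" by blast
  have "finite {y \<in> A - K. rk y = rk x}" (is "finite ?S")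
  proof (rule ccontr)
    assume "infinite ?S"
    then obtain y where y: "y \<in> A" "y \<in> X derived_set_of ?S"
      using compactin_imp_Bolzano_Weierstrass[OF cA, of ?S] by auto
    have "?S \<subseteq> high (rk x)" using AX by (auto simp: high_def)
    then have "y \<in> X derived_set_of high (rk x)" using y derived_set_of_mono by blast
    then show False using x y by (auto simp: derived_high not_less[symmetric])
  qed
  then show ?thesis using x unfolding peak_def by blast
qed

text \<open>Let S be the set of the remaining non-kernel points of \<open>B\<close> of rank at least
  \<tau>. Its accumulation points lie in \<open>B\<close> and have rank above \<tau>, hence are
  neither in \<open>C1\<close> nor in \<open>P\<close>, so they belong to \<open>C2\<close> or to S.
  Therefore \<open>C2\<close> together with S is closed, and a clopen set separates it from
  \<open>C1 \<union> P\<close>.\<close>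

lemma carve:
  assumes B: "clopenin X B" and cl: "closedin X C1" "closedin X C2"
    and C: "C1 \<union> C2 = B \<inter> K" "C1 \<inter> C2 = {}"
    and le: "\<And>y. y \<in> C1 \<Longrightarrow> rk y \<le> \<tau>"
    and P: "finite P" "P \<subseteq> {y \<in> B - K. rk y = \<tau>}"
  obtains D where "clopenin X D" "D \<subseteq> B" "D \<inter> K = C1" "{y \<in> D - K. \<tau> \<le> rk y} = P"
proof -
  have BX: "B \<subseteq> topspace X" using B clopenin_subset by blast
  let ?S = "{y \<in> B - K. \<tau> \<le> rk y} - P"
  have "closedin X (C2 \<union> ?S)"
    unfolding closedin_contains_derived_set derived_set_of_Un
  proof (intro conjI Un_least)
    show "X derived_set_of C2 \<subseteq> C2 \<union> ?S"
      using cl(2) unfolding closedin_contains_derived_set by blast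
    have "?S \<subseteq> high \<tau>" using BX by (auto simp: high_def)
    then have *: "X derived_set_of ?S \<subseteq> {x \<in> topspace X. \<tau> < rk x}"
      using derived_set_of_mono derived_high by blast
    have **: "X derived_set_of ?S \<subseteq> B"
      using derived_set_of_mono[of ?S B] B unfolding clopenin_def closedin_contains_derived_set by blast
    show "X derived_set_of ?S \<subseteq> C2 \<union> ?S"
    proof (intro subsetI)
      fix y assume "y \<in> X derived_set_of ?S"
      then have y: "y \<in> B" "\<tau> < rk y" using * ** by auto
      then have "y \<notin> C1" "y \<notin> P" using le[of y] P(2) by (auto simp: not_le[symmetric])
      moreover have "y \<notin> K \<or> y \<in> C1 \<union> C2" using y C(1) by blast
      ultimately show "y \<in> C2 \<union> ?S" using y by auto
    qed
    show "C2 \<subseteq> topspace X" using cl(2) by (rule closedin_subset)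
    show "?S \<subseteq> topspace X" using BX by blast
  qed
  moreover have "closedin X (C1 \<union> P)"
  proof (rule closedin_Un[OF cl(1)])
    have "P \<subseteq> topspace X" using P(2) BX by blast
    then show "closedin X P" using closedin_Hausdorff_finite_eq[OF Hausdorff P(1)] by blast
  qed
  moreover have "(C1 \<union> P) \<inter> (C2 \<union> ?S) = {}"
    using C P by auto
  ultimately obtain D where D: "clopenin X D" "C1 \<union> P \<subseteq> D" "D \<inter> (C2 \<union> ?S) = {}"
    using Boolean_space_separates_closed[OF Boolean, of "C1 \<union> P" "C2 \<union> ?S"] by blast
  show thesis
  proof (rule that[of "D \<inter> B"])
    show "clopenin X (D \<inter> B)" using D B clopenin_Int by blast
    show "D \<inter> B \<inter> K = C1" using D C by auto
    show "{y \<in> D \<inter> B - K. \<tau> \<le> rk y} = P" using D P by auto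
  qed auto
qed

end

text \<open>For closed \<open>K\<close> and \<open>L\<close> this is a rank-preserving homeomorphism
  of the subspaces. Closedness is tested in the ambient spaces because \<open>carve\<close> needs
  the images of kernel parts to be closed there.\<close>

definition kernel_iso ::
    "'a topology \<Rightarrow> 'a set \<Rightarrow> ('a \<Rightarrow> omega1) \<Rightarrow> 'b topology \<Rightarrow> 'b set \<Rightarrow> ('b \<Rightarrow> omega1) \<Rightarrow> ('a \<Rightarrow> 'b) \<Rightarrow> bool"
  where "kernel_iso X K rk Y L rk' \<phi> \<longleftrightarrow> bij_betw \<phi> K L \<and>
    (\<forall>S\<subseteq>K. closedin X S \<longleftrightarrow> closedin Y (\<phi> ` S)) \<and> (\<forall>x\<in>K. rk' (\<phi> x) = rk x)"

lemma kernel_iso_inv: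
  assumes "kernel_iso X K rk Y L rk' \<phi>"
  shows "kernel_iso Y L rk' X K rk (inv_into K \<phi>)"
  unfolding kernel_iso_def
proof (intro conjI allI impI ballI)
  have bij: "bij_betw \<phi> K L" using assms by (simp add: kernel_iso_def)
  show bij': "bij_betw (inv_into K \<phi>) L K" using bij by (rule bij_betw_inv_into)
  show "closedin Y S \<longleftrightarrow> closedin X (inv_into K \<phi> ` S)" if "S \<subseteq> L" for S
  proof -
    have "inv_into K \<phi> ` S \<subseteq> K" using bij' that by (auto simp: bij_betw_def)
    moreover have "\<phi> ` inv_into K \<phi> ` S = S"
      using bij that by (simp add: bij_betw_def image_inv_into_cancel)
    ultimately show ?thesis using assms unfolding kernel_iso_def by metis
  qed
  show "rk (inv_into K \<phi> x) = rk' x" if "x \<in> L" for x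
    using assms that bij unfolding kernel_iso_def
    by (metis bij_betw_inv_into_right bij_betw_apply bij')
qed

text \<open>The junk case of two empty sets is needed because an empty set has no peak.\<close>

definition matched ::
    "'a topology \<Rightarrow> 'a set \<Rightarrow> ('a \<Rightarrow> omega1) \<Rightarrow> 'b topology \<Rightarrow> 'b set \<Rightarrow> ('b \<Rightarrow> omega1) \<Rightarrow> ('a \<Rightarrow> 'b) \<Rightarrow>
      'a set \<Rightarrow> 'b set \<Rightarrow> bool"
  where "matched X K rk Y L rk' \<phi> A B \<longleftrightarrow> clopenin X A \<and> clopenin Y B \<and> \<phi> ` (A \<inter> K) = B \<inter> L \<and>
    (A = {} \<and> B = {} \<or> (\<exists>\<tau> m. peak K rk A \<tau> m \<and> peak L rk' B \<tau> m))"

lemma matched_inv: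
  assumes iso: "kernel_iso X K rk Y L rk' \<phi>" and m: "matched X K rk Y L rk' \<phi> A B"
  shows "matched Y L rk' X K rk (inv_into K \<phi>) B A"
proof -
  have "inj_on \<phi> K" using iso by (simp add: kernel_iso_def bij_betw_def)
  then have "inv_into K \<phi> ` (\<phi> ` (A \<inter> K)) = A \<inter> K"
    by (simp add: inv_into_image_cancel)
  then show ?thesis using m by (auto simp: matched_def)
qed

text \<open>
  The part with the smaller peak is copied first, by a clopen set around the image of its kernel
  part and \<open>m1\<close> suitable points that avoids all other points of rank at least \<open>\<tau>1\<close>. The
  complement then has the right peak without further choices.
\<close>

lemma matched_split_le:
  assumes X: "compact_ranked_space X K rk" and Y: "compact_ranked_space Y L rk'"
    and iso: "kernel_iso X K rk Y L rk' \<phi>" and m: "matched X K rk Y L rk' \<phi> A B"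
    and A1: "clopenin X A1" "A1 \<subseteq> A"
    and p1: "peak K rk A1 \<tau>1 m1" and p2: "peak K rk (A - A1) \<tau>2 m2" and le: "\<tau>1 \<le> \<tau>2"
  shows "\<exists>B1\<subseteq>B. matched X K rk Y L rk' \<phi> A1 B1 \<and> matched X K rk Y L rk' \<phi> (A - A1) (B - B1)"
proof -
  interpret X: compact_ranked_space X K rk by fact
  interpret Y: compact_ranked_space Y L rk' by fact
  have "A \<noteq> {}" using p1 A1 by (auto simp: peak_def)
  then obtain \<tau> m where A: "peak K rk A \<tau> m" and B: "peak L rk' B \<tau> m"
    and clA: "clopenin X A" and clB: "clopenin Y B" and AB: "\<phi> ` (A \<inter> K) = B \<inter> L"
    using m unfolding matched_def by metis
  note \<tau> = peak_split(1)[OF A p1 p2 A1(2) le] and mm = peak_split(2)[OF A p1 p2 A1(2) le]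
  define A2 where "A2 = A - A1"
  have clA2: "clopenin X A2" using clA A1 by (simp add: A2_def clopenin_Diff)
  have inj: "inj_on \<phi> K" and surj: "\<phi> ` K = L" using iso by (auto simp: kernel_iso_def bij_betw_def)
  have closed: "closedin Y (\<phi> ` (A' \<inter> K))" if "clopenin X A'" for A'
    using that iso X.closed_kernel by (auto simp: kernel_iso_def clopenin_def closedin_Int)
  have C: "\<phi> ` (A1 \<inter> K) \<union> \<phi> ` (A2 \<inter> K) = B \<inter> L" "\<phi> ` (A1 \<inter> K) \<inter> \<phi> ` (A2 \<inter> K) = {}"
  proof -
    have "A1 \<inter> K \<union> A2 \<inter> K = A \<inter> K" using A1(2) by (auto simp: A2_def)
    then show "\<phi> ` (A1 \<inter> K) \<union> \<phi> ` (A2 \<inter> K) = B \<inter> L" using AB by (metis image_Un)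
    show "\<phi> ` (A1 \<inter> K) \<inter> \<phi> ` (A2 \<inter> K) = {}"
      using inj by (auto simp: A2_def inj_on_def)
  qed
  let ?S = "{y \<in> B - L. rk' y = \<tau>1}"
  \<comment> \<open>On a tie, \<open>m1\<close> is a summand of \<open>m\<close>, so
    \<open>B\<close> has enough points of the top rank. Otherwise \<open>B\<close> has a point of
    rank above \<tau>1, and the level \<tau>1 is infinite in \<open>B\<close>.\<close>
  have "\<exists>P\<subseteq>?S. finite P \<and> card P = m1"
  proof (cases "\<tau>1 = \<tau>2")
    case True
    then have "m1 \<le> card ?S" using mm B \<tau> by (simp add: peak_def)
    then show ?thesis by (meson obtain_subset_with_card_n)
  next
    case False
    obtain y where "y \<in> B" "rk' y = \<tau>" using B by (auto simp: peak_def)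
    then have "infinite ?S"
      using Y.infinite_rank_values_below[of B y \<tau>1] False \<tau> le clB by (simp add: clopenin_def)
    then show ?thesis using infinite_arbitrarily_large[of ?S m1] by blast
  qed
  then obtain P where P: "P \<subseteq> ?S" "finite P" "card P = m1" by blast
  have le1: "rk' y \<le> \<tau>1" if "y \<in> \<phi> ` (A1 \<inter> K)" for y
    using that iso p1 by (auto simp: kernel_iso_def peak_def)
  obtain B1 where B1: "clopenin Y B1" "B1 \<subseteq> B" "B1 \<inter> L = \<phi> ` (A1 \<inter> K)" "{y \<in> B1 - L. \<tau>1 \<le> rk' y} = P"
    using Y.carve[OF clB closed[OF A1(1)] closed[OF clA2] C le1 P(2,1)] by blast
  \<comment> \<open>When the count is 0, the maximum is attained at a kernel point, and \<phi>
    carries this point over; only a positive count relies on the choice of non-kernel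
    points.\<close>
  have attained: "\<exists>y\<in>B'. rk' y = \<sigma>"
    if "peak K rk A' \<sigma> n" "\<phi> ` (A' \<inter> K) \<subseteq> B'" "n > 0 \<Longrightarrow> \<exists>y\<in>B'. rk' y = \<sigma>" for A' \<sigma> n B'
  proof (cases "n = 0")
    case True
    then have "{x \<in> A' - K. rk x = \<sigma>} = {}"
      using that(1) unfolding peak_def by (metis card_eq_0_iff)
    moreover have "\<exists>x\<in>A'. rk x = \<sigma>" using that(1) by (simp add: peak_def)
    ultimately obtain x where "x \<in> A'" "x \<in> K" "rk x = \<sigma>" by blast
    then show ?thesis using that(2) iso by (force simp: kernel_iso_def)
  qed (use that in blast)
  have eqP: "{y \<in> B1 - L. rk' y = \<tau>1} = P" using B1(4) P(1) by auto
  have "peak L rk' B1 \<tau>1 m1"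
    unfolding peak_def eqP
  proof (intro conjI ballI)
    show "\<exists>y\<in>B1. rk' y = \<tau>1"
    proof (rule attained[OF p1])
      show "\<phi> ` (A1 \<inter> K) \<subseteq> B1" using B1(3) by blast
      assume "m1 > 0"
      then have "P \<noteq> {}" using P(3) by auto
      then show "\<exists>y\<in>B1. rk' y = \<tau>1" using eqP by blast
    qed
    show "rk' y \<le> \<tau>1" if "y \<in> B1" for y
    proof (cases "y \<in> L")
      case True
      then show ?thesis using le1 that B1(3) by blast
    next
      case False
      show ?thesis
      proof (rule ccontr)
        assume "\<not> rk' y \<le> \<tau>1"
        then have "y \<in> P" using B1(4) that False by auto
        then show False using P(1) \<open>\<not> rk' y \<le> \<tau>1\<close> by auto
      qed
    qed
  qed (use P in auto)
  then have 1: "matched X K rk Y L rk' \<phi> A1 B1"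
    using A1 B1 p1 unfolding matched_def by blast
  have eq2: "{y \<in> (B - B1) - L. rk' y = \<tau>2} = {y \<in> B - L. rk' y = \<tau>} - P"
    using B1(4) le \<tau> P(1) by auto
  \<comment> \<open>Removing \<open>P\<close> lowers the count of the top level by \<open>m1\<close>
    on a tie. Otherwise \<open>P\<close> lies in a lower level and nothing is lost.\<close>
  have card2: "card ({y \<in> B - L. rk' y = \<tau>} - P) = m2"
  proof (cases "\<tau>1 = \<tau>2")
    case True
    then show ?thesis using P B mm \<tau> by (subst card_Diff_subset) (auto simp: peak_def)
  next
    case False
    then have "{y \<in> B - L. rk' y = \<tau>} - P = {y \<in> B - L. rk' y = \<tau>}" using P \<tau> by auto
    then show ?thesis using False B mm by (simp add: peak_def)
  qed
  have fin2: "finite ({y \<in> B - L. rk' y = \<tau>} - P)" using B by (auto simp: peak_def)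
  have C2: "\<phi> ` (A2 \<inter> K) = (B - B1) \<inter> L" using B1(3) C by blast
  have "peak L rk' (B - B1) \<tau>2 m2"
    unfolding peak_def eq2
  proof (intro conjI ballI card2 fin2)
    show "\<exists>y\<in>B - B1. rk' y = \<tau>2"
    proof (rule attained)
      show "peak K rk A2 \<tau>2 m2" using p2 by (simp add: A2_def)
      show "\<phi> ` (A2 \<inter> K) \<subseteq> B - B1" using C2 by blast
      assume "m2 > 0"
      then have "{y \<in> (B - B1) - L. rk' y = \<tau>2} \<noteq> {}"
        unfolding eq2 using card2 by (metis card.empty less_irrefl)
      then show "\<exists>y\<in>B - B1. rk' y = \<tau>2" by blast
    qed
    show "rk' y \<le> \<tau>2" if "y \<in> B - B1" for y using that B \<tau> by (auto simp: peak_def)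
  qed
  then have 2: "matched X K rk Y L rk' \<phi> (A - A1) (B - B1)"
    using clA2 clB B1 C2 p2 clopenin_Diff unfolding matched_def A2_def by blast
  show ?thesis using 1 2 B1(2) by blast
qed

lemma matched_split:
  assumes X: "compact_ranked_space X K rk" and Y: "compact_ranked_space Y L rk'"
    and iso: "kernel_iso X K rk Y L rk' \<phi>" and m: "matched X K rk Y L rk' \<phi> A B"
    and A1: "clopenin X A1" "A1 \<subseteq> A"
  shows "\<exists>B1\<subseteq>B. matched X K rk Y L rk' \<phi> A1 B1 \<and> matched X K rk Y L rk' \<phi> (A - A1) (B - B1)"
proof -
  interpret X: compact_ranked_space X K rk by fact
  have empty: "matched X K rk Y L rk' \<phi> {} {}" by (simp add: matched_def clopenin_def)
  have clA2: "clopenin X (A - A1)" using m A1 by (simp add: matched_def clopenin_Diff)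
  show ?thesis
  proof (cases "A1 = {} \<or> A - A1 = {}")
    case True
    then show ?thesis
    proof
      assume "A1 = {}"
      then show ?thesis using empty m by (intro exI[of _ "{}"]) auto
    next
      assume "A - A1 = {}"
      then have "A1 = A" using A1 by auto
      then show ?thesis using empty m by (intro exI[of _ B]) auto
    qed
  next
    case False
    obtain \<tau>1 m1 \<tau>2 m2 where p: "peak K rk A1 \<tau>1 m1" "peak K rk (A - A1) \<tau>2 m2"
      using X.ex_peak A1 clA2 False by meson
    \<comment> \<open>This allows the two halves to change roles when \<open>A1\<close> is the one
      with the larger maximum.\<close>
    have eq: "A - (A - A1) = A1" using A1 by auto
    show ?thesis
    proof (cases "\<tau>1 \<le> \<tau>2")
      case True
      then show ?thesis using matched_split_le[OF X Y iso m A1 p] by blast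
    next
      case False
      then have "\<tau>2 \<le> \<tau>1" by simp
      then obtain B2 where B2: "B2 \<subseteq> B" "matched X K rk Y L rk' \<phi> (A - A1) B2"
          "matched X K rk Y L rk' \<phi> A1 (B - B2)"
        using matched_split_le[OF X Y iso m clA2 _ p(2), unfolded eq, OF _ p(1)] by auto
      moreover have "B - (B - B2) = B2" using B2 by auto
      ultimately show ?thesis by (intro exI[of _ "B - B2"]) auto
    qed
  qed
qed

text \<open>Agreement with \<phi> on \<open>K\<close> will make the map of compactifications fix the
  point at infinity. It holds because \<phi> carries the kernel part of each cell \<open>P s\<close>
  onto that of \<open>Q s\<close>, and the cells \<open>Q s\<close> separate points.\<close>

theorem compact_ranked_space_homeomorphism:
  assumes X: "compact_ranked_space X K rk" and Y: "compact_ranked_space Y L rk'"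
    and iso: "kernel_iso X K rk Y L rk' \<phi>"
    and peak: "peak K rk (topspace X) \<tau> m" "peak L rk' (topspace Y) \<tau> m"
  obtains f where "homeomorphic_map X Y f" "\<And>x. x \<in> K \<Longrightarrow> f x = \<phi> x"
proof -
  interpret X: compact_ranked_space X K rk by fact
  interpret Y: compact_ranked_space Y L rk' by fact
  have KX: "K \<subseteq> topspace X" and LY: "L \<subseteq> topspace Y"
    using X.closed_kernel Y.closed_kernel closedin_subset by auto
  have inj: "inj_on \<phi> K" and surj: "\<phi> ` K = L" using iso by (auto simp: kernel_iso_def bij_betw_def)
  let ?R = "matched X K rk Y L rk' \<phi>" and ?R' = "matched Y L rk' X K rk (inv_into K \<phi>)"
  have inv_inv: "?R A B" if "?R' B A" for A B
  proof -
    have "\<phi> ` inv_into K \<phi> ` (B \<inter> L) = B \<inter> L"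
      using surj by (intro image_inv_into_cancel[OF surj]) auto
    then show ?thesis using that unfolding matched_def by metis
  qed
  obtain f P Q where f: "homeomorphic_map X Y f" and Q: "binary_scheme Y Q"
    and R: "\<And>s. ?R (P s) (Q s)" and fP: "\<And>x s. x \<in> topspace X \<Longrightarrow> x \<in> P s \<longleftrightarrow> f x \<in> Q s"
  proof (rule back_and_forth[OF X.Boolean Y.Boolean, of ?R])
    show "?R (topspace X) (topspace Y)"
      using peak KX LY surj by (auto simp: matched_def Int_absorb1)
    show "clopenin X A \<and> clopenin Y B \<and> (A = {} \<longleftrightarrow> B = {})" if "?R A B" for A B
      using that by (auto simp: matched_def peak_def)
    show "\<exists>B1\<subseteq>B. ?R A1 B1 \<and> ?R (A - A1) (B - B1)"
      if "?R A B" "clopenin X A1" "A1 \<subseteq> A" for A B A1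
      using matched_split[OF X Y iso that] .
    show "\<exists>A1\<subseteq>A. ?R A1 B1 \<and> ?R (A - A1) (B - B1)"
      if "?R A B" "clopenin Y B1" "B1 \<subseteq> B" for A B B1
      using matched_split[OF Y X kernel_iso_inv[OF iso] matched_inv[OF iso that(1)] that(2,3)] inv_inv
      by blast
  qed blast
  interpret Q: binary_scheme Y Q by fact
  have "f x = \<phi> x" if "x \<in> K" for x
  proof (rule Q.separating)
    have xX: "x \<in> topspace X" using that KX by blast
    show "f x \<in> topspace Y" using f xX homeomorphic_imp_surjective_map by blast
    show "\<phi> x \<in> topspace Y" using that surj LY by blast
    show "f x \<in> Q s \<longleftrightarrow> \<phi> x \<in> Q s" for s
    proof -
      have "\<phi> ` (P s \<inter> K) = Q s \<inter> L" using R by (simp add: matched_def)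
      then have "x \<in> P s \<longleftrightarrow> \<phi> x \<in> Q s"
        using that inj surj by (metis Int_iff imageI inj_on_image_mem_iff inf_le2)
      then show ?thesis using fP[OF xX] by simp
    qed
  qed
  then show thesis using that f by blast
qed

section \<open>Countable ordinals and second countability\<close>

lemma omega1_pos: "\<xi> \<noteq> (0::omega1) \<Longrightarrow> 0 < \<xi>"
  using omega1_zero_le[of \<xi>] by (metis order_le_less)

lemma less_osuc_iff: "\<eta> < osuc \<xi> \<longleftrightarrow> \<eta> \<le> \<xi>"
  by (metis linorder_not_le osuc_le_iff)

lemma omega1_cases:
  obtains (zero) "\<xi> = 0" | (succ) \<mu> where "\<xi> = osuc \<mu>" | (limit) "\<xi> \<noteq> 0" "\<not> is_osuc \<xi>"
  by (metis is_osuc_def)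

lemma limit_ordinal_less:
  assumes "\<not> is_osuc \<xi>" "\<eta> < \<xi>" shows "osuc \<eta> < \<xi>"
  using assms by (metis is_osuc_osuc order_le_less osuc_le_iff)

lemma countable_omega1_bounded:
  assumes "countable (S :: omega1 set)" shows "\<exists>\<beta>. \<forall>\<xi>\<in>S. \<xi> \<le> \<beta>"
proof (rule ccontr)
  assume "\<not> ?thesis"
  then have unbounded: "\<exists>\<xi>\<in>S. \<beta> < \<xi>" for \<beta> by (meson not_le)
  have "UNIV \<subseteq> (\<Union>\<xi>\<in>S. {..\<xi>})"
  proof
    fix \<beta> obtain \<xi> where "\<xi> \<in> S" "\<beta> < \<xi>" using unbounded by blast
    then show "\<beta> \<in> (\<Union>\<xi>\<in>S. {..\<xi>})" by (intro UN_I[of \<xi>]) auto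
  qed
  moreover have "countable (\<Union>\<xi>\<in>S. {..\<xi>})"
    using assms countable_atMost_omega1 by blast
  ultimately show False
    using uncountable_omega1 countable_subset by blast
qed

lemma second_countable_space_iff: "second_countable_space X \<longleftrightarrow> second_countable X"
  unfolding second_countable_space_def second_countable_def
proof (intro ex_cong1 conj_cong refl iffI allI impI)
  fix \<B> U x assume "\<forall>U. openin X U \<longrightarrow> (\<exists>\<U>\<subseteq>\<B>. \<Union>\<U> = U)" "openin X U \<and> x \<in> U"
  then obtain \<U> where "\<U> \<subseteq> \<B>" "\<Union>\<U> = U" by blast
  then show "\<exists>V\<in>\<B>. x \<in> V \<and> V \<subseteq> U" using \<open>openin X U \<and> x \<in> U\<close> by blast
next
  fix \<B> U assume "\<forall>U x. openin X U \<and> x \<in> U \<longrightarrow> (\<exists>V\<in>\<B>. x \<in> V \<and> V \<subseteq> U)" "openin X U"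
  then show "\<exists>\<U>\<subseteq>\<B>. \<Union>\<U> = U"
    by (intro exI[of _ "{V \<in> \<B>. V \<subseteq> U}"]) blast
qed

text \<open>Choose a basic set between \<open>p \<xi>\<close> and \<open>V \<xi>\<close>. For \<xi>
  < \<eta> the two choices differ, since the later one contains \<open>p \<eta>\<close> and the
  earlier one does not. Both the stabilization of the derivatives and the boundedness of upper
  semi-continuous maps rest on this.\<close>

lemma second_countable_right_separated:
  fixes p :: "omega1 \<Rightarrow> 'a"
  assumes sc: "second_countable X"
    and V: "\<And>\<xi>. \<xi> \<in> S \<Longrightarrow> openin X (V \<xi>) \<and> p \<xi> \<in> V \<xi>"
    and sep: "\<And>\<xi> \<eta>. \<xi> \<in> S \<Longrightarrow> \<eta> \<in> S \<Longrightarrow> \<xi> < \<eta> \<Longrightarrow> p \<eta> \<notin> V \<xi>"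
  shows "countable S"
proof -
  obtain \<B> where \<B>: "countable \<B>"
    "\<And>U x. openin X U \<Longrightarrow> x \<in> U \<Longrightarrow> \<exists>V\<in>\<B>. x \<in> V \<and> V \<subseteq> U"
    using sc unfolding second_countable_def by metis
  obtain b where b: "\<And>\<xi>. \<xi> \<in> S \<Longrightarrow> b \<xi> \<in> \<B> \<and> p \<xi> \<in> b \<xi> \<and> b \<xi> \<subseteq> V \<xi>"
  proof -
    have "\<forall>\<xi>\<in>S. \<exists>B. B \<in> \<B> \<and> p \<xi> \<in> B \<and> B \<subseteq> V \<xi>" using \<B>(2) V by blast
    then show thesis using that by metis
  qed
  have "inj_on b S"
  proof (rule linorder_inj_onI)
    fix \<xi> \<eta> assume "\<xi> < \<eta>" "\<xi> \<in> S" "\<eta> \<in> S"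
    then show "b \<xi> \<noteq> b \<eta>" using b sep by blast
  qed auto
  moreover have "countable (b ` S)"
    using \<B>(1) b by (meson countable_subset image_subsetI)
  ultimately show ?thesis by (rule countable_image_inj_on[rotated])
qed

section \<open>Cantor-Bendixson ranks\<close>

lemma closedin_CB:
  assumes "Hausdorff_space X" shows "closedin X (CB X \<xi>)"
proof (induction \<xi> rule: less_induct)
  case (less \<xi>)
  show ?case
  proof (cases \<xi> rule: omega1_cases)
    case zero
    then show ?thesis by (simp add: CB_zero)
  next
    case (succ \<mu>)
    then show ?thesis using closedin_derived_set_of[OF assms] by (simp add: CB_osuc)
  next
    case limit
    then have "{..<\<xi>} \<noteq> {}" using omega1_pos by auto
    then show ?thesis using limit less by (auto simp: CB_limit)
  qed
qed

lemma CB_antimono: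
  assumes X: "Hausdorff_space X" and "\<eta> \<le> \<xi>" shows "CB X \<xi> \<subseteq> CB X \<eta>"
  using assms(2)
proof (induction \<xi> rule: less_induct)
  case (less \<xi>)
  show ?case
  proof (cases "\<eta> = \<xi>")
    case False
    then have lt: "\<eta> < \<xi>" using less by simp
    show ?thesis
    proof (cases \<xi> rule: omega1_cases)
      case zero
      then show ?thesis using lt by (simp add: leD)
    next
      case (succ \<mu>)
      have "CB X (osuc \<mu>) \<subseteq> CB X \<mu>"
        using closedin_CB[OF X, of \<mu>] by (simp add: CB_osuc closedin_contains_derived_set)
      then show ?thesis using less.IH[of \<mu>] lt succ by (auto simp: less_osuc_iff)
    next
      case limit
      then show ?thesis using lt by (auto simp: CB_limit)
    qed
  qed simp
qed

text \<open>If every derivative were proper, each stage would have a point that is isolated in it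
  and lost at the next stage. The isolating neighbourhoods miss all later points, so there would be
  a right-separated family indexed by all countable ordinals.\<close>

lemma CB_stabilizes:
  assumes X: "Hausdorff_space X" and sc: "second_countable X"
  shows "\<exists>\<xi>. CB X \<xi> = CB X (osuc \<xi>)"
proof (rule ccontr)
  assume "\<not> ?thesis"
  then have "\<exists>p V. p \<in> CB X \<xi> \<and> p \<notin> CB X (osuc \<xi>) \<and> openin X V \<and> p \<in> V \<and> V \<inter> CB X \<xi> \<subseteq> {p}" for \<xi>
  proof -
    have "CB X (osuc \<xi>) \<subseteq> CB X \<xi>" by (rule CB_antimono[OF X]) (simp add: less_imp_le)
    then obtain p where p: "p \<in> CB X \<xi>" "p \<notin> CB X (osuc \<xi>)"
      using \<open>\<nexists>\<xi>. CB X \<xi> = CB X (osuc \<xi>)\<close> by blast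
    have "p \<in> topspace X" using p closedin_subset[OF closedin_CB[OF X]] by blast
    then show ?thesis using p unfolding CB_osuc in_derived_set_of by blast
  qed
  then obtain p V where pV: "\<And>\<xi>. p \<xi> \<in> CB X \<xi> \<and> p \<xi> \<notin> CB X (osuc \<xi>) \<and> openin X (V \<xi>) \<and>
      p \<xi> \<in> V \<xi> \<and> V \<xi> \<inter> CB X \<xi> \<subseteq> {p \<xi>}"
    by metis
  have "countable (UNIV :: omega1 set)"
  proof (rule second_countable_right_separated[OF sc])
    show "openin X (V \<xi>) \<and> p \<xi> \<in> V \<xi>" for \<xi> using pV by blast
    show "p \<eta> \<notin> V \<xi>" if "\<xi> < \<eta>" for \<xi> \<eta>
    proof
      assume "p \<eta> \<in> V \<xi>"
      moreover have "p \<eta> \<in> CB X (osuc \<xi>)"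
        using pV CB_antimono[OF X, of "osuc \<xi>" \<eta>] that by (auto simp: osuc_le_iff)
      moreover have "CB X (osuc \<xi>) \<subseteq> CB X \<xi>" by (rule CB_antimono[OF X]) (simp add: less_imp_le)
      ultimately have "p \<eta> = p \<xi>" using pV by blast
      then show False using pV \<open>p \<eta> \<in> CB X (osuc \<xi>)\<close> by metis
    qed
  qed
  then show False using uncountable_omega1 by simp
qed

lemma CB_above_length:
  assumes X: "Hausdorff_space X" and sc: "second_countable X" and "CB_length X \<le> \<xi>"
  shows "CB X \<xi> = CB_kernel X"
  using assms(3)
proof (induction \<xi> rule: less_induct)
  case (less \<xi>)
  let ?\<nu> = "CB_length X"
  have \<nu>: "CB X ?\<nu> = CB X (osuc ?\<nu>)"
    unfolding CB_length_def by (rule LeastI_ex[OF CB_stabilizes[OF X sc]])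
  show ?case
  proof (cases "?\<nu> = \<xi>")
    case True
    then show ?thesis by (simp add: CB_kernel_def)
  next
    case False
    then have lt: "?\<nu> < \<xi>" using less by simp
    show ?thesis
    proof (cases \<xi> rule: omega1_cases)
      case zero
      then show ?thesis using lt by (simp add: leD)
    next
      case (succ \<mu>)
      then have "CB X \<mu> = CB X ?\<nu>" using less.IH[of \<mu>] lt by (simp add: less_osuc_iff CB_kernel_def)
      then show ?thesis using succ \<nu> by (metis CB_osuc CB_kernel_def)
    next
      case limit
      have "CB X \<xi> \<subseteq> CB_kernel X" using CB_antimono[OF X less.prems] by (simp add: CB_kernel_def)
      moreover have "CB_kernel X \<subseteq> CB X \<eta>" if "\<eta> < \<xi>" for \<eta>
      proof (cases "?\<nu> \<le> \<eta>")
        case True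
        then show ?thesis using less.IH[OF that] by simp
      next
        case False
        then show ?thesis using CB_antimono[OF X, of \<eta> ?\<nu>] by (simp add: CB_kernel_def)
      qed
      ultimately show ?thesis using limit by (auto simp: CB_limit)
    qed
  qed
qed

lemma CB_kernel_subset:
  assumes "Hausdorff_space X" "second_countable X" shows "CB_kernel X \<subseteq> CB X \<xi>"
  using CB_above_length[OF assms, of \<xi>] CB_antimono[OF assms(1), of \<xi> "CB_length X"]
  by (cases "CB_length X \<le> \<xi>") (auto simp: CB_kernel_def)

definition CB_rank :: "'a topology \<Rightarrow> 'a \<Rightarrow> omega1"
  where "CB_rank X x = (if x \<in> CB_kernel X then kernel_rank X x else LEAST \<xi>. x \<notin> CB X (osuc \<xi>))"

text \<open>The first stage that misses a point is never a limit, because limit stages are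
  intersections. Hence a non-kernel point lies in the stage of its own rank and is lost exactly at
  the successor.\<close>

lemma in_CB_iff:
  assumes X: "Hausdorff_space X" and sc: "second_countable X"
    and x: "x \<in> topspace X" "x \<notin> CB_kernel X"
  shows "x \<in> CB X \<xi> \<longleftrightarrow> \<xi> \<le> CB_rank X x"
proof -
  have rk: "CB_rank X x = (LEAST \<xi>. x \<notin> CB X (osuc \<xi>))" using x by (simp add: CB_rank_def)
  have "x \<notin> CB X (osuc (CB_length X))"
    using x CB_above_length[OF X sc, of "osuc (CB_length X)"] by (simp add: less_imp_le)
  then have notin: "x \<notin> CB X (osuc (CB_rank X x))"
    unfolding rk by (rule LeastI)
  have below: "x \<in> CB X (osuc \<eta>)" if "\<eta> < CB_rank X x" for \<eta>
    using not_less_Least that unfolding rk by blast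
  have "x \<in> CB X (CB_rank X x)"
  proof (cases "CB_rank X x" rule: omega1_cases)
    case zero
    then show ?thesis using x by (simp add: CB_zero)
  next
    case (succ \<mu>)
    then show ?thesis using below[of \<mu>] by simp
  next
    case limit
    then show ?thesis
      using below CB_antimono[OF X, OF less_imp_le[OF osuc_greater]] by (auto simp: CB_limit)
  qed
  show ?thesis
  proof
    show "\<xi> \<le> CB_rank X x \<Longrightarrow> x \<in> CB X \<xi>"
      using \<open>x \<in> CB X (CB_rank X x)\<close> CB_antimono[OF X] by blast
    show "x \<in> CB X \<xi> \<Longrightarrow> \<xi> \<le> CB_rank X x"
    proof (rule ccontr)
      assume "x \<in> CB X \<xi>" "\<not> \<xi> \<le> CB_rank X x"
      then have "osuc (CB_rank X x) \<le> \<xi>" by (simp add: osuc_le_iff)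
      then show False using notin CB_antimono[OF X] \<open>x \<in> CB X \<xi>\<close> by blast
    qed
  qed
qed

text \<open>The rank function is kept abstract so that the invariants can be computed both for a
  given space, with \<open>CB_rank\<close>, and for the constructed space, whose ranks are known in
  advance.\<close>

locale CB_ranked_space = ranked_space +
  assumes CB_eq: "CB X \<xi> = high \<xi> \<union> K"
    and bounded: "\<exists>\<xi>. high \<xi> = {}"
begin

lemma high_disjoint: "high \<xi> \<inter> K = {}"
  by (auto simp: high_def)

lemma high_osuc: "high (osuc \<xi>) = {p \<in> topspace X - K. \<xi> < rk p}"
  by (auto simp: high_def osuc_le_iff)

lemma CB_diff_eq: "CB_diff X \<xi> = {q \<in> topspace X - K. rk q = \<xi>}"
  by (auto simp: CB_diff_def CB_eq high_osuc) (auto simp: high_def)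

lemma ex_rank_value: "high \<xi> \<noteq> {} \<Longrightarrow> \<exists>q\<in>topspace X - K. rk q = \<xi>"
  using rank_values_below[OF openin_topspace] unfolding high_def by blast

text \<open>The ranks of non-kernel points have no gaps: if some rank is at least \<xi>, the value
  \<xi> itself occurs, and the derivative at stage \<xi> removes a point.\<close>

lemma CB_eq_iff: "CB X \<xi> = CB X (osuc \<xi>) \<longleftrightarrow> high \<xi> = {}"
proof
  assume "high \<xi> = {}"
  then show "CB X \<xi> = CB X (osuc \<xi>)"
    using high_antimono[of \<xi> "osuc \<xi>"] by (auto simp: CB_eq less_imp_le)
next
  assume eq: "CB X \<xi> = CB X (osuc \<xi>)"
  show "high \<xi> = {}"
  proof (rule ccontr)
    assume "high \<xi> \<noteq> {}"
    then obtain q where q: "q \<in> topspace X - K" "rk q = \<xi>" using ex_rank_value by blast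
    then have "q \<in> CB X \<xi>" "q \<notin> CB X (osuc \<xi>)"
      by (auto simp: CB_eq high_osuc) (auto simp: high_def)
    then show False using eq by blast
  qed
qed

lemma CB_length_eq: "CB_length X = (LEAST \<xi>. high \<xi> = {})"
  by (simp add: CB_length_def CB_eq_iff)

lemma high_CB_length: "high (CB_length X) = {}"
  unfolding CB_length_eq by (rule LeastI_ex[OF bounded])

lemma CB_kernel_eq: "CB_kernel X = K"
  by (simp add: CB_kernel_def CB_eq high_CB_length)

text \<open>A kernel point is outside \<open>high \<xi>\<close>, so belonging to the closure means
  being an accumulation point, and the rank law applies.\<close>

lemma kernel_rank_eq:
  assumes "x \<in> K" shows "kernel_rank X x = rk x"
proof -
  have xX: "x \<in> topspace X" using assms closed_kernel closedin_subset by blast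
  have "x \<in> X closure_of (CB X \<xi> - CB_kernel X) \<longleftrightarrow> \<xi> < rk x" for \<xi>
  proof -
    have "CB X \<xi> - CB_kernel X = high \<xi>" using high_disjoint by (auto simp: CB_eq CB_kernel_eq)
    then show ?thesis
      using xX assms high_disjoint[of \<xi>] derived_high[of \<xi>] by (auto simp: closure_of_alt)
  qed
  then have "kernel_rank X x = (LEAST \<xi>. rk x \<le> \<xi>)"
    by (simp add: kernel_rank_def not_less)
  then show ?thesis by (simp add: Least_equality)
qed

text \<open>Points of rank exactly \<xi> are dense in \<open>high \<xi>\<close> by
  \<open>rank_values_below\<close>. The invariant \<open>rho\<close> can thus be computed from sets
  that decrease with \<xi>, which single levels do not.\<close>

lemma closure_of_CB_diff: "X closure_of CB_diff X \<xi> = X closure_of high \<xi>"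
proof
  show "X closure_of CB_diff X \<xi> \<subseteq> X closure_of high \<xi>"
    by (rule closure_of_mono) (auto simp: CB_diff_eq high_def)
  have "high \<xi> \<subseteq> X closure_of CB_diff X \<xi>"
  proof
    fix p assume p: "p \<in> high \<xi>"
    show "p \<in> X closure_of CB_diff X \<xi>"
      unfolding in_closure_of CB_diff_eq
    proof (intro conjI allI impI)
      show "p \<in> topspace X" using p by (simp add: high_def)
      fix T assume T: "p \<in> T \<and> openin X T"
      have "p \<notin> K" "\<xi> \<le> rk p" using p by (auto simp: high_def)
      then obtain q where "q \<in> T" "q \<notin> K" "rk q = \<xi>"
        using rank_values_below[of T p \<xi>] T by blast
      then show "\<exists>y. y \<in> {q \<in> topspace X - K. rk q = \<xi>} \<and> y \<in> T"
        using T openin_subset by fastforce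
    qed
  qed
  then show "X closure_of high \<xi> \<subseteq> X closure_of CB_diff X \<xi>"
    by (simp add: closure_of_minimal)
qed

text \<open>By monotonicity, \<open>rho X\<close> is a threshold and not merely the first compact
  stage. This threshold becomes the rank law at the point at infinity.\<close>

lemma compact_closure_high_iff: "compactin X (X closure_of high \<xi>) \<longleftrightarrow> rho X \<le> \<xi>"
proof
  have rho: "rho X = (LEAST \<xi>. compactin X (X closure_of high \<xi>))"
    by (simp add: rho_def closure_of_CB_diff)
  show "compactin X (X closure_of high \<xi>) \<Longrightarrow> rho X \<le> \<xi>"
    unfolding rho by (rule Least_le)
  have "\<exists>\<xi>. compactin X (X closure_of high \<xi>)" using bounded by (metis closure_of_empty compactin_empty)
  then have c: "compactin X (X closure_of high (rho X))"
    unfolding rho by (rule LeastI_ex)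
  assume "rho X \<le> \<xi>"
  then have "X closure_of high \<xi> \<subseteq> X closure_of high (rho X)"
    by (intro closure_of_mono high_antimono)
  then show "compactin X (X closure_of high \<xi>)"
    by (rule closed_compactin[OF c]) simp
qed

text \<open>A point of rank above \<tau> would force infinitely many of rank \<tau>. So \<tau> is
  the last level that can be nonempty, and whether it is empty decides between \<tau> and its
  successor.\<close>

lemma CB_length_count:
  assumes fin: "finite (high \<tau>)" and card: "card (high \<tau>) = m"
    and inf: "\<And>\<xi>. \<xi> < \<tau> \<Longrightarrow> infinite (high \<xi>)"
  shows "CB_length X = (if m = 0 then \<tau> else osuc \<tau>)"
    and "CB_count X = (if m = 0 then -\<infinity> else ereal (real m))"
proof -
  have top: "high (osuc \<tau>) = {}"
  proof (rule ccontr)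
    assume "high (osuc \<tau>) \<noteq> {}"
    then obtain p where "p \<in> topspace X" "\<tau> < rk p" by (auto simp: high_osuc)
    then have "infinite {q \<in> topspace X - K. rk q = \<tau>}"
      using infinite_rank_values_below[OF openin_topspace] by blast
    moreover have "{q \<in> topspace X - K. rk q = \<tau>} \<subseteq> high \<tau>" by (auto simp: high_def)
    ultimately show False using fin finite_subset by blast
  qed
  show len: "CB_length X = (if m = 0 then \<tau> else osuc \<tau>)"
  proof (cases "m = 0")
    case True
    then have "high \<tau> = {}" using fin card by simp
    moreover have "\<tau> \<le> \<xi>" if "high \<xi> = {}" for \<xi>
      using inf[of \<xi>] that by (metis finite.emptyI leI)
    ultimately have "(LEAST \<xi>. high \<xi> = {}) = \<tau>"
      by (intro Least_equality)
    then show ?thesis using True by (simp add: CB_length_eq)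
  next
    case False
    then have ne: "high \<tau> \<noteq> {}" using card by auto
    have "osuc \<tau> \<le> \<xi>" if "high \<xi> = {}" for \<xi>
      using that ne high_antimono[of \<xi> \<tau>] by (auto simp: osuc_le_iff intro: leI)
    then have "(LEAST \<xi>. high \<xi> = {}) = osuc \<tau>"
      using top by (intro Least_equality)
    then show ?thesis using False by (simp add: CB_length_eq)
  qed
  have diff: "CB X \<xi> - CB_kernel X = high \<xi>" for \<xi>
    using high_disjoint by (auto simp: CB_eq CB_kernel_eq)
  show "CB_count X = (if m = 0 then -\<infinity> else ereal (real m))"
  proof (cases "m = 0")
    case True
    \<comment> \<open>The length is now \<tau>. If it is a successor, its predecessor is below
      \<tau> and indexes an infinite set; in either case the default value applies.\<close>
    then have "\<not> (is_osuc (CB_length X) \<and> finite (high (opred (CB_length X))))"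
      using len inf opred_less by auto
    then show ?thesis using True by (simp add: CB_count_def diff)
  next
    case False
    then show ?thesis using len fin card by (simp add: CB_count_def diff)
  qed
qed

end

text \<open>Off the kernel the rank law restates the derivative step, as the closed kernel can be
  ignored near \<open>x\<close>. On the kernel it unfolds \<open>kernel_rank\<close>, since closure
  and derived set agree at points outside the set.\<close>

lemma CB_ranked_space_CB_rank:
  assumes X: "Hausdorff_space X" and sc: "second_countable X"
  shows "CB_ranked_space X (CB_kernel X) (CB_rank X)"
proof -
  let ?K = "CB_kernel X" and ?rk = "CB_rank X"
  have K: "closedin X ?K" using closedin_CB[OF X] by (simp add: CB_kernel_def)
  have high: "{p \<in> topspace X - ?K. \<xi> \<le> ?rk p} = CB X \<xi> - ?K" for \<xi>
    using in_CB_iff[OF X sc] closedin_subset[OF closedin_CB[OF X, of \<xi>]] by blast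
  have rank: "x \<in> X derived_set_of (CB X \<xi> - ?K) \<longleftrightarrow> \<xi> < ?rk x" if x: "x \<in> topspace X" for x \<xi>
  proof (cases "x \<in> ?K")
    case False
    have "openin X (topspace X - ?K)" using K by blast
    then have "x \<in> X derived_set_of (CB X \<xi> - ?K) \<longleftrightarrow> x \<in> X derived_set_of (CB X \<xi>)"
    proof -
      have "(topspace X - ?K) \<inter> CB X \<xi> = CB X \<xi> - ?K"
        using closedin_subset[OF closedin_CB[OF X, of \<xi>]] by blast
      then show ?thesis
        using openin_Int_derived_set_of_eq[OF \<open>openin X (topspace X - ?K)\<close>, of "CB X \<xi>"] x False
        by auto
    qed
    then show ?thesis
      using in_CB_iff[OF X sc x False, of "osuc \<xi>"] by (simp add: CB_osuc osuc_le_iff)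
  next
    case True
    have "x \<in> X derived_set_of (CB X \<xi> - ?K) \<longleftrightarrow> x \<in> X closure_of (CB X \<xi> - ?K)"
      using True x by (auto simp: closure_of_alt)
    also have "\<dots> \<longleftrightarrow> \<xi> < ?rk x"
    proof -
      have rk: "?rk x = (LEAST \<xi>. x \<notin> X closure_of (CB X \<xi> - ?K))"
        using True by (simp add: CB_rank_def kernel_rank_def)
      have "x \<notin> X closure_of (CB X (CB_length X) - ?K)" by (simp add: CB_kernel_def)
      then have "x \<notin> X closure_of (CB X (?rk x) - ?K)" unfolding rk by (rule LeastI)
      moreover have "X closure_of (CB X \<xi> - ?K) \<subseteq> X closure_of (CB X (?rk x) - ?K)" if "?rk x \<le> \<xi>"
        using CB_antimono[OF X that] by (intro closure_of_mono) auto
      moreover have "x \<in> X closure_of (CB X \<xi> - ?K)" if "\<xi> < ?rk x"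
        using not_less_Least that unfolding rk by blast
      ultimately show ?thesis by (meson not_less subsetD)
    qed
    finally show ?thesis .
  qed
  interpret ranked_space X ?K ?rk
    by unfold_locales (use X K rank high in auto)
  show ?thesis
  proof
    show "CB X \<xi> = high \<xi> \<union> ?K" for \<xi>
      using CB_kernel_subset[OF X sc, of \<xi>] unfolding high_def high by blast
    show "\<exists>\<xi>. high \<xi> = {}"
      unfolding high_def high by (intro exI[of _ "CB_length X"]) (simp add: CB_kernel_def)
  qed
qed


section \<open>One-point compactifications\<close>

lemma derived_set_of_Some:
  "Some x \<in> Alexandroff_compactification X derived_set_of (Some ` S) \<longleftrightarrow> x \<in> X derived_set_of S"
proof
  assume L: "Some x \<in> Alexandroff_compactification X derived_set_of (Some ` S)"
  show "x \<in> X derived_set_of S"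
    unfolding in_derived_set_of
  proof (intro conjI allI impI)
    show "x \<in> topspace X" using L by (auto simp: in_derived_set_of)
    fix T assume "x \<in> T \<and> openin X T"
    then have "Some x \<in> Some ` T" "openin (Alexandroff_compactification X) (Some ` T)" by auto
    then have "\<exists>y. y \<noteq> Some x \<and> y \<in> Some ` S \<and> y \<in> Some ` T"
      using L[unfolded in_derived_set_of] by simp
    then show "\<exists>y. y \<noteq> x \<and> y \<in> S \<and> y \<in> T" by auto
  qed
next
  assume R: "x \<in> X derived_set_of S"
  then have xX: "x \<in> topspace X" by (simp add: in_derived_set_of)
  show "Some x \<in> Alexandroff_compactification X derived_set_of (Some ` S)"
    unfolding in_derived_set_of
  proof (intro conjI allI impI)
    show "Some x \<in> topspace (Alexandroff_compactification X)"
      using xX by simp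
    fix T assume T: "Some x \<in> T \<and> openin (Alexandroff_compactification X) T"
    have "openin X {y \<in> topspace X. Some y \<in> T}"
      by (rule openin_continuous_map_preimage[OF continuous_map_Some]) (use T in blast)
    moreover have "x \<in> {y \<in> topspace X. Some y \<in> T}"
      using T xX by simp
    ultimately have "\<exists>y. y \<noteq> x \<and> y \<in> S \<and> y \<in> {y \<in> topspace X. Some y \<in> T}"
      using R[unfolded in_derived_set_of, THEN conjunct2, THEN spec[of _ "{y \<in> topspace X. Some y \<in> T}"]]
      by iprover
    then show "\<exists>y. y \<noteq> Some x \<and> y \<in> Some ` S \<and> y \<in> T" by auto
  qed
qed

text \<open>Open neighbourhoods of \<open>None\<close> are complements of closed compact sets, and
  \<open>S\<close> avoids one of them exactly when it lies in such a set.\<close>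

lemma None_derived_set_of_Some:
  assumes S: "S \<subseteq> topspace X"
  shows "None \<in> Alexandroff_compactification X derived_set_of (Some ` S) \<longleftrightarrow>
    \<not> compactin X (X closure_of S)"
proof
  assume L: "None \<in> Alexandroff_compactification X derived_set_of (Some ` S)"
  show "\<not> compactin X (X closure_of S)"
  proof
    assume "compactin X (X closure_of S)"
    then have "openin (Alexandroff_compactification X) (insert None (Some ` (topspace X - X closure_of S)))"
      unfolding openin_Alexandroff_compactification by (metis closedin_closure_of)
    then have "\<exists>y. y \<in> Some ` S \<and> y \<in> insert None (Some ` (topspace X - X closure_of S))"
      using L[unfolded in_derived_set_of] by (metis insertI1)
    then show False using closure_of_subset[OF S] by auto
  qed
next
  assume R: "\<not> compactin X (X closure_of S)"
  show "None \<in> Alexandroff_compactification X derived_set_of (Some ` S)"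
    unfolding in_derived_set_of
  proof (intro conjI allI impI)
    fix T assume T: "None \<in> T \<and> openin (Alexandroff_compactification X) T"
    then obtain C where C: "compactin X C" "closedin X C" "T = insert None (Some ` (topspace X - C))"
      unfolding openin_Alexandroff_compactification by blast
    have "\<not> S \<subseteq> C"
    proof
      assume "S \<subseteq> C"
      then have "X closure_of S \<subseteq> C" using C(2) by (rule closure_of_minimal)
      then show False using R closed_compactin[OF C(1)] by simp
    qed
    then show "\<exists>y. y \<noteq> None \<and> y \<in> Some ` S \<and> y \<in> T" using C(3) S by blast
  qed simp
qed

text \<open>In a compact neighbourhood \<open>C\<close> of \<open>x\<close>, quasi-components are
  components, hence single points. So a set \<open>D\<close>, clopen in \<open>C\<close>, separates
  \<open>x\<close> from the rest of \<open>C\<close> outside \<open>U \<inter> V\<close>. Staying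
  inside the open set \<open>V\<close> makes \<open>D\<close> open in \<open>W\<close>, not just in
  \<open>C\<close>.\<close>

lemma omega_Stone_compact_open_base:
  assumes W: "omega_Stone_space W" and U: "openin W U" "x \<in> U"
  obtains D where "openin W D" "compactin W D" "x \<in> D" "D \<subseteq> U"
proof -
  have lc: "locally_compact_space W" and td: "totally_disconnected_space W" and H: "Hausdorff_space W"
    using W by (auto simp: omega_Stone_space_def)
  have xW: "x \<in> topspace W" using U openin_subset by blast
  obtain V C where VC: "openin W V" "compactin W C" "x \<in> V" "V \<subseteq> C"
    using lc xW unfolding locally_compact_space_def by blast
  let ?C = "subtopology W C"
  have CW: "C \<subseteq> topspace W" using VC by (simp add: compactin_subset_topspace)
  have xC: "x \<in> topspace ?C" using VC CW by auto
  have comp: "compact_space ?C" using VC by (simp add: compact_space_subtopology)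
  have HC: "Hausdorff_space ?C" using H by (simp add: Hausdorff_space_subtopology)
  have "quasi_components_of ?C = connected_components_of ?C"
    using comp HC by (intro quasi_eq_connected_components_of) blast
  then have "\<forall>y. quasi_component_of ?C y = connected_component_of ?C y"
    by (simp add: quasi_eq_connected_components_of_pointwise_alt)
  then have "connectedin ?C (quasi_component_of_set ?C x)"
    by (simp add: connectedin_connected_component_of)
  then have "connectedin W (quasi_component_of_set ?C x)"
    by (simp add: connectedin_subtopology)
  then obtain a where "quasi_component_of_set ?C x \<subseteq> {a}"
    using td unfolding totally_disconnected_space_def by blast
  moreover have "x \<in> quasi_component_of_set ?C x" using xC by (simp add: quasi_component_of_refl)
  ultimately have single: "quasi_component_of_set ?C x = {x}" by blast
  have comp': "compactin ?C (C - U \<inter> V)"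
  proof -
    have "closedin W (C - U \<inter> V)"
      using U VC H by (meson closedin_diff compactin_imp_closedin openin_Int)
    then have "compactin W (C - U \<inter> V)" using VC(2) closed_compactin by (metis Diff_subset)
    then show ?thesis by (simp add: compactin_subtopology)
  qed
  have "{x} \<in> quasi_components_of ?C"
    using xC single unfolding quasi_components_of_def by blast
  then have "separated_between ?C {x} (C - U \<inter> V)"
    using separated_between_quasi_component_compact[OF _ comp', of "{x}"] U VC by (auto simp: disjnt_def)
  then obtain D where D: "closedin ?C D" "openin ?C D" "x \<in> D" "C - U \<inter> V \<subseteq> topspace ?C - D"
    unfolding separated_between by blast
  have DC: "D \<subseteq> C" using D(2) openin_subset by fastforce
  have DUV: "D \<subseteq> U \<inter> V" using D DC by blast
  show thesis
  proof
    obtain O' where "openin W O'" "D = O' \<inter> C" using D(2) by (auto simp: openin_subtopology)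
    then have "D = O' \<inter> V" using DUV VC by blast
    then show "openin W D" using \<open>openin W O'\<close> VC by blast
    have "compactin ?C D" using comp D(1) by (rule closedin_compact_space)
    then show "compactin W D" by (simp add: compactin_subtopology)
  qed (use D DUV in auto)
qed

text \<open>A compact open set is a finite union of basic sets, so there are only countably many.
  Their copies are clopen in the compactification and separate all points, including
  \<open>None\<close> from the others.\<close>

lemma Boolean_space_Alexandroff:
  assumes W: "omega_Stone_space W"
  shows "Boolean_space (Alexandroff_compactification W)"
proof -
  have H: "Hausdorff_space W" and sc: "second_countable W"
    using W by (auto simp: omega_Stone_space_def second_countable_space_iff)
  obtain \<B> where \<B>: "countable \<B>" "\<And>V. V \<in> \<B> \<Longrightarrow> openin W V"
    "\<And>U x. openin W U \<and> x \<in> U \<longrightarrow> (\<exists>V \<in> \<B>. x \<in> V \<and> V \<subseteq> U)"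
    using sc unfolding second_countable_def by metis
  define \<D> where "\<D> = {D. openin W D \<and> compactin W D}"
  have "\<D> \<subseteq> Union ` {\<F>. finite \<F> \<and> \<F> \<subseteq> \<B>}"
  proof
    fix D assume "D \<in> \<D>"
    then have D: "openin W D" "compactin W D" by (auto simp: \<D>_def)
    have "\<exists>\<F>. finite \<F> \<and> \<F> \<subseteq> {V \<in> \<B>. V \<subseteq> D} \<and> D \<subseteq> \<Union>\<F>"
    proof (rule compactinD[OF D(2)])
      show "D \<subseteq> \<Union>{V \<in> \<B>. V \<subseteq> D}" using \<B>(3) D(1) by blast
    qed (use \<B>(2) in blast)
    then obtain \<F> where "finite \<F>" "\<F> \<subseteq> {V \<in> \<B>. V \<subseteq> D}" "D \<subseteq> \<Union>\<F>" by blast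
    then show "D \<in> Union ` {\<F>. finite \<F> \<and> \<F> \<subseteq> \<B>}"
      by (intro image_eqI[of _ _ \<F>]) auto
  qed
  moreover have "countable {\<F>. finite \<F> \<and> \<F> \<subseteq> \<B>}"
    using \<B>(1) by (rule countable_Collect_finite_subset)
  ultimately have count: "countable \<D>" by (meson countable_image countable_subset)
  have clo: "clopenin (Alexandroff_compactification W) (Some ` D)" if "D \<in> \<D>" for D
    using that H by (auto simp: clopenin_def \<D>_def compactin_imp_closedin)
  have sep: "\<exists>D\<in>\<D>. Some x \<in> Some ` D \<and> y \<notin> Some ` D"
    if "x \<in> topspace W" "y \<noteq> Some x" for x y
  proof -
    define U where "U = (if y = None then topspace W else topspace W - {the y})"
    have "openin W U"
      using H by (simp add: U_def open_in_Hausdorff_delete)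
    moreover have "x \<in> U" using that by (auto simp: U_def)
    ultimately obtain D where "openin W D" "compactin W D" "x \<in> D" "D \<subseteq> U"
      by (rule omega_Stone_compact_open_base[OF W])
    then show ?thesis
      by (intro bexI[of _ D]) (auto simp: U_def \<D>_def split: if_splits)
  qed
  show ?thesis
    unfolding Boolean_space_def
  proof (intro conjI exI[of _ "image Some ` \<D>"] ballI impI)
    show "countable (image Some ` \<D>)" using count by simp
    show "clopenin (Alexandroff_compactification W) C" if "C \<in> image Some ` \<D>" for C
      using that clo by blast
    fix x y
    assume x: "x \<in> topspace (Alexandroff_compactification W)"
      and y: "y \<in> topspace (Alexandroff_compactification W)"
      and eq: "\<forall>C\<in>image Some ` \<D>. x \<in> C \<longleftrightarrow> y \<in> C"
    show "x = y"
    proof (rule ccontr)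
      assume "x \<noteq> y"
      then consider x' where "x = Some x'" "x' \<in> topspace W" | y' where "y = Some y'" "y' \<in> topspace W"
        using x y by auto
      then show False
      proof cases
        case 1
        then show ?thesis using sep[of x' y] eq \<open>x \<noteq> y\<close> by blast
      next
        case 2
        then show ?thesis using sep[of y' x] eq \<open>x \<noteq> y\<close> by blast
      qed
    qed
  qed simp
qed

context CB_ranked_space
begin

lemma compact_ranked_space_Alexandroff:
  assumes "omega_Stone_space X"
  shows "compact_ranked_space (Alexandroff_compactification X) (insert None (Some ` K)) (case_option (rho X) rk)"
proof
  let ?X = "Alexandroff_compactification X" and ?K = "insert None (Some ` K)"
    and ?rk = "case_option (rho X) rk"
  show B: "Boolean_space ?X" by (rule Boolean_space_Alexandroff[OF assms])
  then show "Hausdorff_space ?X" by (rule Boolean_space_imp_Hausdorff)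
  have KX: "K \<subseteq> topspace X" using closed_kernel by (rule closedin_subset)
  have "topspace ?X - ?K = Some ` (topspace X - K)" by auto
  moreover have "openin X (topspace X - K)" using closed_kernel by blast
  ultimately show "closedin ?X ?K" using KX by (auto simp: closedin_def)
  fix x \<xi> assume x: "x \<in> topspace ?X"
  have high: "{p \<in> topspace ?X - ?K. \<xi> \<le> ?rk p} = Some ` high \<xi>" by (auto simp: high_def)
  show "x \<in> ?X derived_set_of {p \<in> topspace ?X - ?K. \<xi> \<le> ?rk p} \<longleftrightarrow> \<xi> < ?rk x"
  proof (cases x)
    case None
    have "high \<xi> \<subseteq> topspace X" by (auto simp: high_def)
    then show ?thesis
      unfolding high using None by (simp add: None_derived_set_of_Some compact_closure_high_iff not_le)
  next
    case (Some y)
    then show ?thesis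
      unfolding high using x by (auto simp: derived_set_of_Some derived_high)
  qed
qed

text \<open>This turns the pair (\<tau>, m) into (\<nu>, n). All levels below \<tau> are infinite
  because \<tau> is attained somewhere, possibly only at the point at infinity.\<close>

lemma CB_length_count_peak:
  assumes "omega_Stone_space X"
    and p: "peak (insert None (Some ` K)) (case_option (rho X) rk)
      (topspace (Alexandroff_compactification X)) \<tau> m"
  shows "CB_length X = (if m = 0 then \<tau> else osuc \<tau>)"
    and "CB_count X = (if m = 0 then -\<infinity> else ereal (real m))"
proof -
  let ?X = "Alexandroff_compactification X" and ?K = "insert None (Some ` K)"
    and ?rk = "case_option (rho X) rk"
  interpret C: compact_ranked_space ?X ?K ?rk
    by (rule compact_ranked_space_Alexandroff[OF assms(1)])
  have le: "rk y \<le> \<tau>" if "y \<in> topspace X" for y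
    using p that by (auto simp: peak_def)
  have "{x \<in> topspace ?X - ?K. ?rk x = \<tau>} = Some ` high \<tau>"
    using le by (auto simp: high_def intro: order_antisym)
  then have fin: "finite (high \<tau>)" and card: "card (high \<tau>) = m"
    using p by (auto simp: peak_def finite_image_iff card_image)
  have inf: "infinite (high \<xi>)" if "\<xi> < \<tau>" for \<xi>
  proof
    assume "finite (high \<xi>)"
    obtain x where "x \<in> topspace ?X" "?rk x = \<tau>" using p unfolding peak_def by blast
    then have "infinite {q \<in> topspace ?X - ?K. ?rk q = \<xi>}"
      using that by (intro C.infinite_rank_values_below[OF openin_topspace]) auto
    moreover have "{q \<in> topspace ?X - ?K. ?rk q = \<xi>} \<subseteq> Some ` high \<xi>" by (auto simp: high_def)
    ultimately show False using \<open>finite (high \<xi>)\<close> by (meson finite_imageI finite_subset)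
  qed
  show "CB_length X = (if m = 0 then \<tau> else osuc \<tau>)"
    and "CB_count X = (if m = 0 then -\<infinity> else ereal (real m))"
    using CB_length_count[OF fin card inf] by blast+
qed

end

section \<open>Uniqueness\<close>

lemma rank_homeomorphic_common:
  assumes U: "rank_homeomorphic U r K s" and V: "rank_homeomorphic V r' K s"
  shows "\<exists>\<phi> \<psi>. homeomorphic_maps U V \<phi> \<psi> \<and> (\<forall>u\<in>topspace U. r' (\<phi> u) = r u)"
proof -
  obtain f where f: "homeomorphic_map U K f" "\<And>u. u \<in> topspace U \<Longrightarrow> s (f u) = r u"
    using U by (auto simp: rank_homeomorphic_def)
  obtain g where g: "homeomorphic_map V K g" "\<And>v. v \<in> topspace V \<Longrightarrow> s (g v) = r' v"
    using V by (auto simp: rank_homeomorphic_def)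
  obtain f' where f': "homeomorphic_maps U K f f'" using f(1) homeomorphic_map_maps by blast
  obtain g' where g': "homeomorphic_maps V K g g'" using g(1) homeomorphic_map_maps by blast
  have "homeomorphic_maps U V (g' \<circ> f) (f' \<circ> g)"
    using homeomorphic_maps_compose f' g' by (metis homeomorphic_maps_sym)
  moreover have "r' ((g' \<circ> f) u) = r u" if "u \<in> topspace U" for u
    using f(2)[OF that] g(2)[of "g' (f u)"] f' g' that
    by (auto simp: homeomorphic_maps_def continuous_map_def Pi_iff)
  ultimately show ?thesis by blast
qed

text \<open>A closed set without \<open>None\<close> is a compact set of \<open>W\<close>, and
  compactness survives \<phi>. A closed set with \<open>None\<close> is a closed set of
  \<open>W\<close> plus that point, and its image is closed in \<open>V\<close> because
  \<open>L\<close> is.\<close>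

lemma closed_kernel_image:
  assumes V: "Hausdorff_space V" and K: "closedin W K" and L: "closedin V L"
    and \<phi>: "homeomorphic_map (subtopology W K) (subtopology V L) \<phi>"
    and S: "S \<subseteq> insert None (Some ` K)" "closedin (Alexandroff_compactification W) S"
  shows "closedin (Alexandroff_compactification V) (map_option \<phi> ` S)"
proof (cases "None \<in> S")
  case False
  then obtain C where C: "compactin W C" "S = Some ` C"
    using S(2) unfolding closedin_Alexandroff_compactification by auto
  then have CK: "C \<subseteq> K" using S(1) by auto
  then have "compactin (subtopology W K) C" using C by (simp add: compactin_subtopology)
  then have "compactin (subtopology V L) (\<phi> ` C)"
    by (rule image_compactin) (rule homeomorphic_imp_continuous_map[OF \<phi>])
  then have comp: "compactin V (\<phi> ` C)" by (simp add: compactin_subtopology)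
  have "map_option \<phi> ` S = Some ` \<phi> ` C" by (simp add: C image_image)
  then show ?thesis using comp V by (simp add: compactin_imp_closedin)
next
  case True
  then obtain U where U: "openin W U" "S = topspace (Alexandroff_compactification W) - Some ` U"
    using S(2) unfolding closedin_Alexandroff_compactification by auto
  let ?C = "topspace W - U"
  have eqS: "S = insert None (Some ` ?C)" using U(2) by auto
  have CK: "?C \<subseteq> K" using S(1) eqS by auto
  have "closedin W ?C" using U(1) by blast
  then have "closedin (subtopology W K) ?C" using CK by (simp add: closedin_subset_topspace)
  then have "closedin (subtopology V L) (\<phi> ` ?C)"
    using homeomorphic_imp_closed_map[OF \<phi>] by (simp add: closed_map_def)
  then have cl: "closedin V (\<phi> ` ?C)" using L closedin_trans_full by blast
  have "map_option \<phi> ` S = topspace (Alexandroff_compactification V) - Some ` (topspace V - \<phi> ` ?C)"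
  proof -
    have "map_option \<phi> ` S = insert None (Some ` \<phi> ` ?C)" by (simp add: eqS image_image)
    then show ?thesis using closedin_subset[OF cl] by auto
  qed
  moreover have "openin V (topspace V - \<phi> ` ?C)" using cl by blast
  ultimately show ?thesis unfolding closedin_Alexandroff_compactification by blast
qed

lemma kernel_iso_Alexandroff:
  assumes W: "Hausdorff_space W" and V: "Hausdorff_space V"
    and K: "closedin W K" and L: "closedin V L"
    and hom: "homeomorphic_maps (subtopology W K) (subtopology V L) \<phi> \<psi>"
    and rk: "\<And>u. u \<in> K \<Longrightarrow> rk' (\<phi> u) = rk u"
  shows "kernel_iso (Alexandroff_compactification W) (insert None (Some ` K)) (case_option \<rho> rk)
    (Alexandroff_compactification V) (insert None (Some ` L)) (case_option \<rho> rk') (map_option \<phi>)"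
  unfolding kernel_iso_def
proof (intro conjI allI impI ballI)
  let ?K = "insert None (Some ` K)" and ?L = "insert None (Some ` L)"
  have tK: "topspace (subtopology W K) = K" and tL: "topspace (subtopology V L) = L"
    using K L by (simp_all add: closedin_subset Int_absorb1)
  have \<phi>: "homeomorphic_map (subtopology W K) (subtopology V L) \<phi>"
    and \<psi>: "homeomorphic_map (subtopology V L) (subtopology W K) \<psi>"
    using hom homeomorphic_maps_map by blast+
  have inv: "\<And>u. u \<in> K \<Longrightarrow> \<psi> (\<phi> u) = u" "\<And>v. v \<in> L \<Longrightarrow> \<phi> (\<psi> v) = v"
    using hom tK tL unfolding homeomorphic_maps_def by auto
  have im: "\<phi> ` K = L" using homeomorphic_imp_surjective_map[OF \<phi>] tK tL by simp
  have inv': "map_option \<psi> (map_option \<phi> x) = x" if "x \<in> ?K" for x using that inv by auto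
  show "bij_betw (map_option \<phi>) ?K ?L"
    unfolding bij_betw_def
  proof
    show "inj_on (map_option \<phi>) ?K" using inv' by (rule inj_on_inverseI)
    show "map_option \<phi> ` ?K = ?L" using im by force
  qed
  show "case_option \<rho> rk' (map_option \<phi> x) = case_option \<rho> rk x" if "x \<in> ?K" for x
    using that rk by auto
  fix S assume S: "S \<subseteq> ?K"
  show "closedin (Alexandroff_compactification W) S \<longleftrightarrow>
    closedin (Alexandroff_compactification V) (map_option \<phi> ` S)"
  proof
    show "closedin (Alexandroff_compactification V) (map_option \<phi> ` S)"
      if "closedin (Alexandroff_compactification W) S"
      using closed_kernel_image[OF V K L \<phi> S that] .
    assume cl: "closedin (Alexandroff_compactification V) (map_option \<phi> ` S)"
    have "map_option \<phi> ` S \<subseteq> ?L" using S im by auto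
    then have "closedin (Alexandroff_compactification W) (map_option \<psi> ` map_option \<phi> ` S)"
      using closed_kernel_image[OF W L K \<psi> _ cl] by blast
    moreover have "map_option \<psi> ` map_option \<phi> ` S = S"
    proof -
      have "map_option \<psi> ` map_option \<phi> ` S = (\<lambda>x. x) ` S"
        unfolding image_image using S inv' by (intro image_cong) blast+
      then show ?thesis by simp
    qed
    ultimately show "closedin (Alexandroff_compactification W) S" by simp
  qed
qed

lemma homeomorphic_space_Alexandroff:
  assumes f: "homeomorphic_map (Alexandroff_compactification W) (Alexandroff_compactification V) f"
    and None: "f None = None"
  shows "W homeomorphic_space V"
proof -
  let ?W = "Alexandroff_compactification W" and ?V = "Alexandroff_compactification V"
  have inj: "inj_on f (topspace ?W)" and surj: "f ` topspace ?W = topspace ?V"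
    using f homeomorphic_imp_injective_map homeomorphic_imp_surjective_map by blast+
  have im: "f ` Some ` topspace W = Some ` topspace V"
  proof -
    have "f ` Some ` topspace W = f ` (topspace ?W - {None})"
      by (simp only: topspace_Alexandroff_compactification_delete)
    also have "\<dots> = f ` topspace ?W - f ` {None}"
      using inj by (rule inj_on_image_set_diff) auto
    also have "\<dots> = topspace ?V - {None}" by (simp only: surj None image_insert image_empty)
    also have "\<dots> = Some ` topspace V" by (rule topspace_Alexandroff_compactification_delete)
    finally show ?thesis .
  qed
  have "homeomorphic_map (subtopology ?W (Some ` topspace W)) (subtopology ?V (Some ` topspace V)) f"
    using f by (rule homeomorphic_map_subtopologies) (use im in auto)
  then have 1: "subtopology ?W (Some ` topspace W) homeomorphic_space subtopology ?V (Some ` topspace V)"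
    using homeomorphic_map_imp_homeomorphic_space by blast
  have 2: "X homeomorphic_space subtopology (Alexandroff_compactification X) (Some ` topspace X)"
    for X :: "'c topology"
    using embedding_map_Some[of X] unfolding embedding_map_def
    by (rule homeomorphic_map_imp_homeomorphic_space)
  show ?thesis
    using 1 2[of W] 2[of V] by (meson homeomorphic_space_sym homeomorphic_space_trans)
qed

theorem has_invariants_unique:
  assumes W: "omega_Stone_space W" "has_invariants W \<nu> \<rho> n K r"
    and V: "omega_Stone_space V" "has_invariants V \<nu> \<rho> n K r"
  shows "W homeomorphic_space V"
proof -
  have HW: "Hausdorff_space W" and sW: "second_countable W"
    and HV: "Hausdorff_space V" and sV: "second_countable V"
    using W V by (auto simp: omega_Stone_space_def second_countable_space_iff)
  let ?W = "Alexandroff_compactification W" and ?V = "Alexandroff_compactification V"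
  let ?K = "CB_kernel W" and ?L = "CB_kernel V"
  let ?rk = "case_option \<rho> (CB_rank W)" and ?rk' = "case_option \<rho> (CB_rank V)"
  interpret CW: CB_ranked_space W ?K "CB_rank W" by (rule CB_ranked_space_CB_rank[OF HW sW])
  interpret CV: CB_ranked_space V ?L "CB_rank V" by (rule CB_ranked_space_CB_rank[OF HV sV])
  have inv: "CB_length W = \<nu>" "rho W = \<rho>" "CB_count W = n" "CB_length V = \<nu>" "rho V = \<rho>" "CB_count V = n"
    and hW: "rank_homeomorphic (subtopology W ?K) (kernel_rank W) K r"
    and hV: "rank_homeomorphic (subtopology V ?L) (kernel_rank V) K r"
    using W V by (auto simp: has_invariants_def)
  have cW: "compact_ranked_space ?W (insert None (Some ` ?K)) ?rk"
    using CW.compact_ranked_space_Alexandroff[OF W(1)] inv by simp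
  have cV: "compact_ranked_space ?V (insert None (Some ` ?L)) ?rk'"
    using CV.compact_ranked_space_Alexandroff[OF V(1)] inv by simp
  obtain \<phi> \<psi> where hom: "homeomorphic_maps (subtopology W ?K) (subtopology V ?L) \<phi> \<psi>"
    and \<phi>: "\<forall>u\<in>topspace (subtopology W ?K). kernel_rank V (\<phi> u) = kernel_rank W u"
    using rank_homeomorphic_common[OF hW hV] by (elim exE conjE)
  have rk: "CB_rank V (\<phi> u) = CB_rank W u" if "u \<in> ?K" for u
  proof -
    have "u \<in> topspace (subtopology W ?K)"
      using that closedin_subset[OF CW.closed_kernel] by auto
    moreover from this have "\<phi> u \<in> topspace (subtopology V ?L)"
      using hom by (auto simp: homeomorphic_maps_def continuous_map_def Pi_iff)
    ultimately show ?thesis using \<phi> that by (simp add: CB_rank_def)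
  qed
  have iso: "kernel_iso ?W (insert None (Some ` ?K)) ?rk ?V (insert None (Some ` ?L)) ?rk' (map_option \<phi>)"
    by (rule kernel_iso_Alexandroff[OF HW HV CW.closed_kernel CV.closed_kernel hom]) (rule rk)
  \<comment> \<open>The point at infinity guarantees peaks even when \<open>W\<close> or
    \<open>V\<close> is empty.\<close>
  have ne: "topspace ?W \<noteq> {}" "topspace ?V \<noteq> {}" by auto
  obtain \<tau> m where p: "peak (insert None (Some ` ?K)) ?rk (topspace ?W) \<tau> m"
    using compact_ranked_space.ex_peak[OF cW clopenin_topspace ne(1)] by blast
  obtain \<sigma> k where q: "peak (insert None (Some ` ?L)) ?rk' (topspace ?V) \<sigma> k"
    using compact_ranked_space.ex_peak[OF cV clopenin_topspace ne(2)] by blast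
  \<comment> \<open>Equal counts give \<open>m = k\<close>, the value -\<infinity> standing for 0;
    then equal lengths give \<tau> = \<sigma> by injectivity of \<open>osuc\<close>.\<close>
  have len: "(if m = 0 then \<tau> else osuc \<tau>) = (if k = 0 then \<sigma> else osuc \<sigma>)"
    using CW.CB_length_count_peak(1)[OF W(1)] CV.CB_length_count_peak(1)[OF V(1)] p q inv by metis
  have "(if m = 0 then -\<infinity> else ereal (real m)) = (if k = 0 then -\<infinity> else ereal (real k))"
    using CW.CB_length_count_peak(2)[OF W(1)] CV.CB_length_count_peak(2)[OF V(1)] p q inv by metis
  then have mk: "m = k" by (cases "m = 0"; cases "k = 0") simp_all
  have "\<tau> = \<sigma>" using len injD[OF inj_osuc] by (cases "k = 0") (simp_all add: mk)
  with q mk have q': "peak (insert None (Some ` ?L)) ?rk' (topspace ?V) \<tau> m" by simp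
  show ?thesis
  proof (rule compact_ranked_space_homeomorphism[OF cW cV iso p q'])
    fix f assume "homeomorphic_map ?W ?V f" "\<And>x. x \<in> insert None (Some ` ?K) \<Longrightarrow> f x = map_option \<phi> x"
    then show ?thesis by (intro homeomorphic_space_Alexandroff[of W V f]) auto
  qed
qed

lemma derived_set_of_obtains:
  assumes "x \<in> X derived_set_of S" "openin X U" "x \<in> U"
  obtains y where "y \<noteq> x" "y \<in> S" "y \<in> U"
  using assms unfolding in_derived_set_of by metis

section \<open>Construction of spaces with prescribed ranks\<close>

instance bool :: second_countable_topology
proof
  have "open = generate_topology (UNIV :: bool set set)"
    by (intro ext) (simp add: open_discrete generate_topology.Basis)
  then show "\<exists>B::bool set set. countable B \<and> open = generate_topology B"
    by (intro exI[of _ UNIV]) simp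
qed

lemma second_countable_euclidean: "second_countable (euclidean :: 'a::second_countable_topology topology)"
proof -
  obtain B :: "'a set set" where "countable B" "topological_basis B"
    using ex_countable_basis by blast
  then show ?thesis
    unfolding second_countable_def
  proof (intro exI[of _ B] conjI ballI allI impI)
    show "openin euclidean V" if "V \<in> B" for V
      using topological_basis_open[OF \<open>topological_basis B\<close> that] by simp
    fix U x assume "openin euclidean U \<and> x \<in> (U :: 'a set)"
    then have U: "open U" "x \<in> U" by simp_all
    obtain V where "V \<in> B" "x \<in> V" "V \<subseteq> U"
      by (rule topological_basisE[OF \<open>topological_basis B\<close> U])
    then show "\<exists>V\<in>B. x \<in> V \<and> V \<subseteq> U" by blast
  qed
qed

lemma euclidean_bool: "(euclidean :: bool topology) = discrete_topology UNIV"
  by (simp add: topology_eq open_discrete)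

lemma euclidean_bool_fun: "(euclidean :: ('i \<Rightarrow> bool) topology) = product_topology (\<lambda>_. discrete_topology UNIV) UNIV"
  by (metis euclidean_bool euclidean_product_topology)

lemma compact_UNIV_bool_fun: "compact (UNIV :: ('i \<Rightarrow> bool) set)"
proof -
  have "compact_space (euclidean :: ('i \<Rightarrow> bool) topology)"
    unfolding euclidean_bool_fun
    by (simp add: compact_space_product_topology compact_space_discrete_topology)
  then show ?thesis by (simp add: compact_space_def)
qed

lemma metrizable_bool_fun: "metrizable_space (euclidean :: ('i::countable \<Rightarrow> bool) topology)"
  unfolding euclidean_bool_fun by (simp add: metrizable_space_product_topology)

lemma open_coordinate: "open {p :: 'i \<Rightarrow> bool. p i = b}"
proof -
  have "open ((\<lambda>p :: 'i \<Rightarrow> bool. p i) -` {b})"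
    by (intro open_vimage open_discrete continuous_on_product_coordinates)
  then show ?thesis by (simp add: vimage_def)
qed

lemma Hausdorff_bool_fun: "Hausdorff_space (euclidean :: ('i \<Rightarrow> bool) topology)"
  unfolding euclidean_bool_fun by (simp add: Hausdorff_space_product_topology)

lemma closed_singleton_bool_fun: "closed {y :: 'i \<Rightarrow> bool}"
  using Hausdorff_bool_fun closedin_Hausdorff_singleton by (metis UNIV_I closed_closedin topspace_euclidean)

lemma tendsto_bool_fun:
  fixes f :: "'a \<Rightarrow> 'i \<Rightarrow> bool"
  assumes "\<And>i. \<forall>\<^sub>F n in F. f n i = l i"
  shows "(f \<longlongrightarrow> l) F"
proof -
  have "limitin (discrete_topology UNIV) (\<lambda>n. f n i) (l i) F" for i
    unfolding limitin_def
    using assms[of i] by (auto elim: eventually_mono)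
  then have "limitin (euclidean :: ('i \<Rightarrow> bool) topology) f l F"
    unfolding euclidean_bool_fun limitin_componentwise by simp
  then show ?thesis by simp
qed

text \<open>A position in the Cantor set and a set of words. The ambient space is already compact,
  metrizable and second countable, so closedness is all that a compact carrier needs.\<close>

type_synonym word_point = "(nat \<Rightarrow> bool) \<times> (nat list \<Rightarrow> bool)"

lemma Hausdorff_word_point: "Hausdorff_space (euclidean :: word_point topology)"
  using Hausdorff_bool_fun
  by (metis Hausdorff_space_prod_topology prod_topology_euclidean)

lemma metrizable_word_point: "metrizable_space (euclidean :: word_point topology)"
  using metrizable_bool_fun
  by (metis metrizable_space_prod_topology prod_topology_euclidean)

definition base_point :: "(nat \<Rightarrow> bool) \<Rightarrow> word_point"
  where "base_point y = (y, \<lambda>_. False)"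

text \<open>
  Nodes of a forest of well-founded trees are words, written with the root as last letter.
  Node \<open>[i]\<close> has rank \<open>l i\<close> and is placed near \<open>a i\<close>; the children of a node of rank \<open>\<xi>\<close> have the
  ranks \<open>e \<xi> 0\<close>, \<open>e \<xi> 1\<close>, and so on. Adding to each node the set of its nonempty suffixes turns
  the nodes together with \<open>C\<close> into a closed subset of a Cantor space.
\<close>

locale word_space =
  fixes C :: "(nat \<Rightarrow> bool) set" and rs :: "(nat \<Rightarrow> bool) \<Rightarrow> omega1" and I :: "nat set"
    and a :: "nat \<Rightarrow> (nat \<Rightarrow> bool)" and l :: "nat \<Rightarrow> omega1" and e :: "omega1 \<Rightarrow> nat \<Rightarrow> omega1"
  assumes closed_C: "closed C"
    and a_in: "i \<in> I \<Longrightarrow> a i \<in> C"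
    and e_less: "\<xi> \<noteq> 0 \<Longrightarrow> e \<xi> n < \<xi>"
    and e_inf: "\<eta> < \<xi> \<Longrightarrow> infinite {n. e \<xi> n = \<eta>}"
    and roots_finite: "y \<in> C \<Longrightarrow> rs y \<le> \<xi> \<Longrightarrow> \<exists>U. open U \<and> y \<in> U \<and> finite {i \<in> I. a i \<in> U \<and> \<xi> \<le> l i}"
    and roots_infinite: "y \<in> C \<Longrightarrow> \<xi> < rs y \<Longrightarrow> open U \<Longrightarrow> y \<in> U \<Longrightarrow> infinite {i \<in> I. a i \<in> U \<and> l i = \<xi>}"
begin

primrec lab :: "nat list \<Rightarrow> omega1" where
  "lab [] = 0"
| "lab (n # w) = (if w = [] then l n else e (lab w) n)"

text \<open>Nodes of rank 0 are leaves, there being no smaller rank for a child.\<close>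

primrec valid :: "nat list \<Rightarrow> bool" where
  "valid [] = False"
| "valid (n # w) = (if w = [] then n \<in> I else valid w \<and> lab w \<noteq> 0)"

definition point :: "nat list \<Rightarrow> word_point"
  where "point w = (a (last w), \<lambda>v. v \<noteq> [] \<and> suffix v w)"

definition carrier :: "word_point set"
  where "carrier = base_point ` C \<union> point ` {w. valid w}"

lemma valid_nonempty: "valid w \<Longrightarrow> w \<noteq> []"
  by (cases w) auto

lemma valid_suffix: "valid w \<Longrightarrow> suffix v w \<Longrightarrow> v \<noteq> [] \<Longrightarrow> valid v"
  by (induction w) (auto simp: suffix_Cons split: if_splits)

text \<open>Ranks drop strictly from a node to its descendants. Hence a chain of valid words has a
  longest member, on which closedness of the carrier depends.\<close>

lemma lab_suffix: "valid w \<Longrightarrow> suffix v w \<Longrightarrow> v \<noteq> [] \<Longrightarrow> v = w \<or> lab w < lab v"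
proof (induction w)
  case (Cons n w)
  show ?case
  proof (cases "v = n # w")
    case False
    then have v: "suffix v w" using Cons.prems by (simp add: suffix_Cons)
    then have "w \<noteq> []" using Cons.prems by auto
    then have "valid w" "lab (n # w) < lab w" using Cons.prems e_less by auto
    then show ?thesis using Cons.IH[OF _ v] Cons.prems by auto
  qed simp
qed simp

lemma suffix_last: "w \<noteq> [] \<Longrightarrow> suffix [last w] w"
  using append_butlast_last_id[of w] by (auto simp: suffix_def intro: exI[of _ "butlast w"])

lemma last_suffix: "suffix v w \<Longrightarrow> v \<noteq> [] \<Longrightarrow> last v = last w"
  by (auto simp: suffix_def)

lemma valid_last: "valid w \<Longrightarrow> last w \<in> I"
  using valid_suffix[OF _ suffix_last, of w] valid_nonempty[of w] by simp

lemma lab_le_last: "valid w \<Longrightarrow> lab w \<le> l (last w)"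
  using lab_suffix[OF _ suffix_last, of w] valid_nonempty[of w] by (auto dest: arg_cong[of _ _ lab])

lemma point_inject: "w \<noteq> [] \<Longrightarrow> v \<noteq> [] \<Longrightarrow> point w = point v \<longleftrightarrow> w = v"
proof
  assume ne: "w \<noteq> []" "v \<noteq> []" and eq: "point w = point v"
  have "snd (point w) w" "snd (point v) v" using ne by (auto simp: point_def)
  then have "snd (point v) w" "snd (point w) v" by (simp_all add: eq)
  then have "suffix w v" "suffix v w" by (auto simp: point_def)
  then show "w = v" by (rule suffix_order.antisym)
qed simp

lemma point_not_base: "w \<noteq> [] \<Longrightarrow> point w \<noteq> base_point y"
proof
  assume "w \<noteq> []" "point w = base_point y"
  moreover from \<open>w \<noteq> []\<close> have "snd (point w) w" by (simp add: point_def)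
  ultimately show False by (simp add: base_point_def)
qed

text \<open>Each condition on the right is closed by itself. Conversely, the conditions make the
  words of \<open>p\<close> a chain under suffixes. If there are none, \<open>p\<close> is a base
  point; otherwise decreasing labels provide a longest word \<open>w\<close>, and
  \<open>p = point w\<close>.\<close>

lemma carrier_eq:
  "carrier = {p. fst p \<in> C \<and> (\<forall>v. snd p v \<longrightarrow> valid v) \<and>
     (\<forall>n w. w \<noteq> [] \<longrightarrow> snd p (n # w) \<longrightarrow> snd p w) \<and>
     (\<forall>v w. length v = length w \<longrightarrow> v \<noteq> w \<longrightarrow> snd p v \<longrightarrow> \<not> snd p w) \<and>
     (\<forall>i. snd p [i] \<longrightarrow> fst p = a i)}" (is "_ = ?R")
proof
  show "carrier \<subseteq> ?R"
  proof
    fix p assume "p \<in> carrier"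
    then consider y where "p = base_point y" "y \<in> C" | w where "p = point w" "valid w"
      by (auto simp: carrier_def)
    then show "p \<in> ?R"
    proof cases
      case 2
      have "fst p \<in> C" using 2 a_in valid_last by (simp add: point_def)
      moreover have "snd p v \<longrightarrow> valid v" for v using 2 valid_suffix by (auto simp: point_def)
      moreover have "w' \<noteq> [] \<longrightarrow> snd p (n # w') \<longrightarrow> snd p w'" for n w'
        using 2 by (auto simp: point_def dest: suffix_ConsD)
      moreover have "length v = length w' \<longrightarrow> v \<noteq> w' \<longrightarrow> snd p v \<longrightarrow> \<not> snd p w'" for v w'
        using 2 unfolding point_def
        by (metis suffix_length_suffix order_refl snd_conv suffix_order.antisym)
      moreover have "snd p [i] \<longrightarrow> fst p = a i" for i
        using 2 last_suffix[of "[i]" w] by (auto simp: point_def)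
      ultimately show ?thesis by blast
    qed (simp add: base_point_def)
  qed
  show "?R \<subseteq> carrier"
  proof
    fix p assume p: "p \<in> ?R"
    then have val: "\<And>v. snd p v \<Longrightarrow> valid v"
      and down: "\<And>n w. w \<noteq> [] \<Longrightarrow> snd p (n # w) \<Longrightarrow> snd p w"
      and uniq: "\<And>v w. length v = length w \<Longrightarrow> snd p v \<Longrightarrow> snd p w \<Longrightarrow> v = w"
      by blast+
    have down': "snd p v" if "snd p w" "suffix v w" "v \<noteq> []" for v w
      using that
    proof (induction w)
      case (Cons n w)
      show ?case
      proof (cases "v = n # w")
        case False
        then have "suffix v w" using Cons.prems(2) by (simp add: suffix_Cons)
        moreover from this have "w \<noteq> []" using Cons.prems(3) by auto
        ultimately show ?thesis using Cons down by blast
      qed (use Cons.prems in simp)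
    qed simp
    show "p \<in> carrier"
    proof (cases "\<exists>w. snd p w")
      case False
      then have "p = base_point (fst p)" by (auto simp: base_point_def prod_eq_iff)
      then show ?thesis using p by (auto simp: carrier_def)
    next
      case True
      \<comment> \<open>A word of least label is the longest one, because a proper extension within
        the chain would have a smaller label.\<close>
      define \<xi> where "\<xi> = (LEAST \<xi>. \<exists>v. snd p v \<and> lab v = \<xi>)"
      have "\<exists>v. snd p v \<and> lab v = \<xi>"
        unfolding \<xi>_def by (rule LeastI_ex) (use True in blast)
      moreover have "\<xi> \<le> lab v" if "snd p v" for v
        unfolding \<xi>_def by (rule Least_le) (use that in blast)
      ultimately obtain w where w: "snd p w" "\<And>v. snd p v \<Longrightarrow> lab w \<le> lab v" by blast
      have ne: "w \<noteq> []" using val[OF w(1)] valid_nonempty by blast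
      have suf: "suffix v w" if v: "snd p v" for v
      proof (cases "length w \<le> length v")
        case True
        let ?u = "drop (length v - length w) v"
        have "suffix ?u v" "length ?u = length w" using True by (simp_all add: suffix_drop)
        have "?u \<noteq> []" using \<open>length ?u = length w\<close> ne by (metis length_0_conv)
        then have "?u = w"
          using down'[OF v \<open>suffix ?u v\<close>] uniq[OF \<open>length ?u = length w\<close>] w(1) by blast
        then have "suffix w v" using \<open>suffix ?u v\<close> by simp
        then show ?thesis using lab_suffix[OF val[OF v] _ ne] w(2)[OF v] by auto
      next
        case False
        let ?u = "drop (length w - length v) w"
        have u: "suffix ?u w" "length ?u = length v" using False by (auto simp: suffix_drop)
        have "?u \<noteq> []" using u val[OF v] valid_nonempty by fastforce
        then have "?u = v" using down'[OF w(1) u(1)] uniq[of ?u v] v u by auto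
        then show ?thesis using u by simp
      qed
      have "snd p [last w]" using down'[OF w(1) suffix_last[OF ne]] by simp
      then have "fst p = a (last w)" using p by blast
      moreover have "snd p v \<longleftrightarrow> v \<noteq> [] \<and> suffix v w" for v
        using suf down'[OF w(1)] val valid_nonempty by blast
      ultimately have "p = point w" by (auto simp: point_def prod_eq_iff)
      then show ?thesis using val[OF w(1)] by (auto simp: carrier_def)
    qed
  qed
qed

lemma open_snd: "open {p :: word_point. snd p v = b}"
proof -
  have "open (snd -` {q :: nat list \<Rightarrow> bool. q v = b} :: word_point set)"
    by (intro open_vimage_snd open_coordinate)
  then show ?thesis by (simp add: vimage_def)
qed

lemma closed_snd: "closed {p :: word_point. snd p v = b}"
proof -
  have "- {p :: word_point. snd p v = b} = {p. snd p v = (\<not> b)}" by auto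
  then show ?thesis using open_snd by (simp add: closed_def)
qed

lemma closed_carrier: "closed carrier"
proof -
  have o: "open {p :: word_point. snd p v}" and c: "closed {p :: word_point. snd p v}"
    and c': "closed {p :: word_point. \<not> snd p v}" for v
    using open_snd[of v True] closed_snd[of v True] closed_snd[of v False] by simp_all
  have C: "closed {p :: word_point. fst p \<in> C}"
    using closed_vimage_fst[OF closed_C] by (simp add: vimage_def)
  have a: "closed {p :: word_point. fst p = a i}" for i
    using closed_vimage_fst[OF closed_singleton_bool_fun[of "a i"]] by (simp add: vimage_def)
  show ?thesis
    unfolding carrier_eq
    by (intro closed_Collect_conj closed_Collect_all closed_Collect_imp C a o c c' open_Collect_const
        closed_Collect_const)
qed

lemma compact_carrier: "compact carrier"
proof -
  have "compact (UNIV :: word_point set)"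
    using compact_Times[OF compact_UNIV_bool_fun compact_UNIV_bool_fun] by simp
  then show ?thesis using closed_carrier by (metis compact_Int_closed inf_top_left)
qed

definition rk :: "word_point \<Rightarrow> omega1"
  where "rk p = (if p \<in> point ` {w. valid w} then lab (inv_into {w. valid w} point p) else rs (fst p))"

lemma rk_point: "valid w \<Longrightarrow> rk (point w) = lab w"
proof -
  have "inj_on point {w. valid w}"
    using point_inject valid_nonempty by (auto simp: inj_on_def)
  then show "valid w \<Longrightarrow> rk (point w) = lab w" by (simp add: rk_def)
qed

lemma base_point_disjoint: "base_point y \<notin> point ` {w. valid w}"
proof
  assume "base_point y \<in> point ` {w. valid w}"
  then obtain w where "base_point y = point w" "valid w" by blast
  then show False using point_not_base[of w y] valid_nonempty[of w] by simp
qed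

lemma rk_base: "rk (base_point y) = rs y"
  using base_point_disjoint[of y] by (simp add: rk_def base_point_def)

lemma carrier_diff_base: "carrier - base_point ` C = point ` {w. valid w}"
proof -
  have "p \<notin> base_point ` C" if "p \<in> point ` {w. valid w}" for p
    using that base_point_disjoint by (metis imageE)
  then show ?thesis unfolding carrier_def by blast
qed

lemma closed_base: "closed (base_point ` C)"
proof -
  have "base_point ` C = C \<times> {\<lambda>_. False}" by (auto simp: base_point_def)
  moreover have "closed (C \<times> {\<lambda>_ :: nat list. False})" by (intro closed_Times closed_C closed_singleton_bool_fun)
  ultimately show ?thesis by simp
qed

text \<open>Child and parent share the position, and their word sets differ only in
  \<open>n # w\<close>. A fixed word \<open>v\<close> is this extra word for at most one
  \<open>n\<close>, namely \<open>hd v\<close>.\<close>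

lemma point_tendsto: "w \<noteq> [] \<Longrightarrow> (\<lambda>n. point (n # w)) \<longlonglongrightarrow> point w"
  unfolding point_def
proof (intro tendsto_Pair tendsto_bool_fun)
  fix v assume "w \<noteq> []"
  have "\<forall>\<^sub>F n in sequentially. n # w \<noteq> v"
  proof (rule eventually_sequentiallyI)
    fix n assume "Suc (hd v) \<le> n"
    then show "n # w \<noteq> v" by auto
  qed
  then show "\<forall>\<^sub>F n in sequentially. (v \<noteq> [] \<and> suffix v (n # w)) = (v \<noteq> [] \<and> suffix v w)"
    by (rule eventually_mono) (auto simp: suffix_Cons)
qed auto

lemma chain_tendsto: "(\<lambda>n v. v \<noteq> [] \<and> suffix v [n]) \<longlonglongrightarrow> (\<lambda>_. False)"
proof (intro tendsto_bool_fun)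
  fix v :: "nat list"
  have "\<forall>\<^sub>F n in sequentially. [n] \<noteq> v"
  proof (rule eventually_sequentiallyI)
    fix n assume "Suc (hd v) \<le> n"
    then show "[n] \<noteq> v" by auto
  qed
  then show "\<forall>\<^sub>F n in sequentially. (v \<noteq> [] \<and> suffix v [n]) = False"
    by (rule eventually_mono) (auto simp: suffix_Cons)
qed

lemma infinite_sequence_meets:
  assumes "infinite N" "\<forall>\<^sub>F n in sequentially. P n" shows "\<exists>n\<in>N. P (n::nat)"
  using assms by (metis eventually_sequentially infinite_nat_iff_unbounded_le)

text \<open>Infinitely many children of \<open>w\<close> have rank \<xi>, and the children converge
  to \<open>w\<close>. Conversely, the points whose word set contains \<open>w\<close> form an open
  set consisting of \<open>w\<close> and its descendants, which have smaller ranks.\<close>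

lemma rank_point:
  assumes w: "valid w"
  shows "point w \<in> top_of_set carrier derived_set_of (point ` {v. valid v \<and> \<xi> \<le> lab v}) \<longleftrightarrow> \<xi> < lab w"
    (is "?L \<longleftrightarrow> ?R")
proof
  have ne: "w \<noteq> []" using w valid_nonempty by blast
  show ?L if R: ?R
    unfolding in_derived_set_of
  proof (intro conjI allI impI)
    show "point w \<in> topspace (top_of_set carrier)" using w by (simp add: carrier_def)
    fix T assume "point w \<in> T \<and> openin (top_of_set carrier) T"
    then obtain G where G: "open G" "T = carrier \<inter> G" "point w \<in> G" by (auto simp: openin_open)
    have "\<forall>\<^sub>F n in sequentially. point (n # w) \<in> G"
      using topological_tendstoD[OF point_tendsto[OF ne] G(1,3)] .
    then obtain n where n: "e (lab w) n = \<xi>" "point (n # w) \<in> G"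
      using infinite_sequence_meets[OF e_inf[OF R]] by blast
    have "lab w \<noteq> 0" using R omega1_zero_le[of \<xi>] by (metis leD)
    then have v: "valid (n # w)" "lab (n # w) = \<xi>" using w ne n by auto
    then have "point (n # w) \<noteq> point w" using point_inject ne by auto
    then show "\<exists>y. y \<noteq> point w \<and> y \<in> point ` {v. valid v \<and> \<xi> \<le> lab v} \<and> y \<in> T"
      using v n(2) G(2) by (intro exI[of _ "point (n # w)"]) (auto simp: carrier_def)
  qed
  show ?R if L: ?L
  proof (rule ccontr)
    assume "\<not> \<xi> < lab w"
    have G: "openin (top_of_set carrier) (carrier \<inter> {p. snd p w = True})"
      using open_snd by (intro openin_open_Int)
    have in_G: "point w \<in> carrier \<inter> {p. snd p w = True}"
      using w ne by (auto simp: carrier_def point_def)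
    obtain y where "y \<noteq> point w" "y \<in> point ` {v. valid v \<and> \<xi> \<le> lab v}"
        "y \<in> carrier \<inter> {p. snd p w = True}"
      by (rule derived_set_of_obtains[OF L G in_G])
    then obtain v where y: "y = point v" and v: "valid v" "\<xi> \<le> lab v" "snd y w = True" by auto
    have "v \<noteq> w" using y \<open>y \<noteq> point w\<close> by auto
    moreover have "suffix w v" using v(3) y by (simp add: point_def)
    ultimately have v: "valid v" "\<xi> \<le> lab v" "suffix w v" "v \<noteq> w" using v by auto
    then have "lab v < lab w" using lab_suffix[OF v(1) v(3) ne] by auto
    then show False using v(2) \<open>\<not> \<xi> < lab w\<close> by (meson order_le_less_trans)
  qed
qed

text \<open>Infinitely many roots of rank \<xi> lie near \<open>y\<close>, and their word sets tend
  to the empty set. Conversely, near \<open>y\<close> only finitely many trees have a root of rank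
  at least \<xi>; excluding these trees by their roots leaves only nodes of rank below
  \<xi>.\<close>

lemma rank_base_point:
  assumes y: "y \<in> C"
  shows "base_point y \<in> top_of_set carrier derived_set_of (point ` {v. valid v \<and> \<xi> \<le> lab v}) \<longleftrightarrow> \<xi> < rs y"
    (is "?L \<longleftrightarrow> ?R")
proof
  show ?L if R: ?R
    unfolding in_derived_set_of
  proof (intro conjI allI impI)
    show "base_point y \<in> topspace (top_of_set carrier)" using y by (simp add: carrier_def)
    fix T assume "base_point y \<in> T \<and> openin (top_of_set carrier) T"
    then obtain G where G: "open G" "T = carrier \<inter> G" "(y, \<lambda>_. False) \<in> G"
      by (auto simp: openin_open base_point_def)
    obtain A B where "open A" "open B" "(y, \<lambda>_. False) \<in> A \<times> B" "A \<times> B \<subseteq> G"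
      by (rule open_prod_elim[OF G(1,3)])
    then have AB: "open A" "open B" "y \<in> A" "(\<lambda>_. False) \<in> B" "A \<times> B \<subseteq> G" by simp_all
    have "\<forall>\<^sub>F n in sequentially. (\<lambda>v. v \<noteq> [] \<and> suffix v [n]) \<in> B"
      using topological_tendstoD[OF chain_tendsto AB(2,4)] .
    then obtain i where i: "i \<in> I" "a i \<in> A" "l i = \<xi>" "(\<lambda>v. v \<noteq> [] \<and> suffix v [i]) \<in> B"
      using infinite_sequence_meets[OF roots_infinite[OF y R AB(1,3)]] by blast
    then have "point [i] \<in> G" using AB(5) by (auto simp: point_def)
    moreover have "valid [i]" "lab [i] = \<xi>" using i by auto
    ultimately show "\<exists>z. z \<noteq> base_point y \<and> z \<in> point ` {v. valid v \<and> \<xi> \<le> lab v} \<and> z \<in> T"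
      using G(2) point_not_base[of "[i]" y] by (intro exI[of _ "point [i]"]) (auto simp: carrier_def)
  qed
  show ?R if L: ?L
  proof (rule ccontr)
    assume "\<not> \<xi> < rs y"
    then have "rs y \<le> \<xi>" by simp
    then obtain U where U: "open U" "y \<in> U" "finite {i \<in> I. a i \<in> U \<and> \<xi> \<le> l i}"
      using roots_finite[OF y] by blast
    let ?F = "{i \<in> I. a i \<in> U \<and> \<xi> \<le> l i}"
    let ?G = "fst -` U \<inter> (\<Inter>i\<in>?F. {p. snd p [i] = False}) :: word_point set"
    have "open ?G" using U(1,3) open_snd[of _ False] by (intro open_Int open_INT open_vimage_fst) blast+
    then have G: "openin (top_of_set carrier) (carrier \<inter> ?G)" by (rule openin_open_Int)
    have in_G: "base_point y \<in> carrier \<inter> ?G"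
      using y U(2) by (auto simp: carrier_def base_point_def)
    obtain z where "z \<in> point ` {v. valid v \<and> \<xi> \<le> lab v}" "z \<in> carrier \<inter> ?G"
      by (rule derived_set_of_obtains[OF L G in_G])
    then obtain v where v: "valid v" "\<xi> \<le> lab v" "point v \<in> ?G" by blast
    then have "last v \<in> ?F" using valid_last lab_le_last by (fastforce simp: point_def)
    then have "\<not> suffix [last v] v" using v(3) by (auto simp: point_def)
    then show False using suffix_last valid_nonempty v(1) by blast
  qed
qed

lemma ranked: "ranked_space (top_of_set carrier) (base_point ` C) rk"
proof
  show "Hausdorff_space (top_of_set carrier)"
    by (rule Hausdorff_space_subtopology) (rule Hausdorff_word_point)
  show "closedin (top_of_set carrier) (base_point ` C)"
    using closed_base by (rule closed_subset[rotated]) (auto simp: carrier_def)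
  fix x \<xi> assume "x \<in> topspace (top_of_set carrier)"
  then consider y where "x = base_point y" "y \<in> C" | w where "x = point w" "valid w"
    by (auto simp: carrier_def)
  moreover have "{p \<in> topspace (top_of_set carrier) - base_point ` C. \<xi> \<le> rk p} =
      point ` {v. valid v \<and> \<xi> \<le> lab v}"
    using carrier_diff_base rk_point by auto
  ultimately show "x \<in> top_of_set carrier derived_set_of
      {p \<in> topspace (top_of_set carrier) - base_point ` C. \<xi> \<le> rk p} \<longleftrightarrow> \<xi> < rk x"
    by cases (simp_all only: rank_point rank_base_point rk_point rk_base)
qed

end

text \<open>Perfectness keeps \<open>K\<close> in every derivative, while the rank law removes
  exactly the non-kernel points of the current rank. No rank is skipped at a limit, as a rank below
  it has its successor below it too.\<close>

lemma (in ranked_space) CB_eq_high_Un: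
  assumes perfect: "K \<subseteq> X derived_set_of K"
  shows "CB X \<xi> = high \<xi> \<union> K"
proof (induction \<xi> rule: less_induct)
  case (less \<xi>)
  have KX: "K \<subseteq> topspace X" using closed_kernel by (rule closedin_subset)
  show ?case
  proof (cases \<xi> rule: omega1_cases)
    case zero
    then show ?thesis using KX by (auto simp: CB_zero high_def)
  next
    case (succ \<mu>)
    have "X derived_set_of K = K"
      using perfect closed_kernel unfolding closedin_contains_derived_set by blast
    then have "CB X \<xi> = {x \<in> topspace X. \<mu> < rk x} \<union> K"
      using less[of \<mu>] by (simp add: succ CB_osuc derived_set_of_Un derived_high)
    then show ?thesis using KX by (auto simp: high_def succ osuc_le_iff)
  next
    case limit
    have "CB X \<xi> = (\<Inter>\<eta>\<in>{..<\<xi>}. high \<eta> \<union> K)"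
      using limit less by (simp add: CB_limit)
    also have "\<dots> = high \<xi> \<union> K"
    proof (intro equalityI subsetI)
      fix x assume x: "x \<in> (\<Inter>\<eta>\<in>{..<\<xi>}. high \<eta> \<union> K)"
      show "x \<in> high \<xi> \<union> K"
      proof (cases "x \<in> K")
        case False
        then have h: "x \<in> high \<eta>" if "\<eta> < \<xi>" for \<eta> using x that by blast
        have "\<not> rk x < \<xi>"
        proof
          assume "rk x < \<xi>"
          then have "osuc (rk x) < \<xi>" using limit(2) by (rule limit_ordinal_less[rotated])
          then have "osuc (rk x) \<le> rk x" using h by (simp add: high_def)
          then show False by (simp add: osuc_le_iff)
        qed
        moreover have "x \<in> topspace X" using h[OF omega1_pos[OF limit(1)]] by (simp add: high_def)
        ultimately show ?thesis using False by (simp add: high_def)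
      qed simp
    next
      fix x assume "x \<in> high \<xi> \<union> K"
      then show "x \<in> (\<Inter>\<eta>\<in>{..<\<xi>}. high \<eta> \<union> K)"
        using high_antimono[OF less_imp_le] by blast
    qed
    finally show ?thesis .
  qed
qed

text \<open>The rank law concerns accumulation of non-kernel points only, so it survives the removal
  of kernel points. This will allow the point at infinity to be deleted.\<close>

lemma (in ranked_space) ranked_space_subtopology:
  assumes "topspace X - K \<subseteq> S"
  shows "ranked_space (subtopology X S) (K \<inter> S) rk"
proof
  show "Hausdorff_space (subtopology X S)" using Hausdorff by (rule Hausdorff_space_subtopology)
  show "closedin (subtopology X S) (K \<inter> S)" using closed_kernel by (auto simp: closedin_subtopology)
  fix x \<xi> assume x: "x \<in> topspace (subtopology X S)"
  have eq: "{p \<in> topspace (subtopology X S) - K \<inter> S. \<xi> \<le> rk p} = high \<xi>"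
    and "S \<inter> high \<xi> = high \<xi>"
    using assms by (auto simp: high_def)
  then show "x \<in> subtopology X S derived_set_of {p \<in> topspace (subtopology X S) - K \<inter> S. \<xi> \<le> rk p} \<longleftrightarrow>
      \<xi> < rk x"
    using x by (simp only: derived_set_of_subtopology eq) (simp add: derived_high)
qed

section \<open>Invariance under homeomorphisms\<close>

lemma totally_disconnected_space_homeomorphic:
  assumes "X homeomorphic_space Y" "totally_disconnected_space X"
  shows "totally_disconnected_space Y"
  unfolding totally_disconnected_space_def
proof (intro allI impI)
  fix S assume S: "connectedin Y S"
  obtain f g where fg: "homeomorphic_maps X Y f g" using assms(1) by (auto simp: homeomorphic_space_def)
  then have "connectedin X (g ` S)"
    using S connectedin_continuous_map_image by (metis homeomorphic_maps_def)
  then obtain a where a: "g ` S \<subseteq> {a}" using assms(2) by (auto simp: totally_disconnected_space_def)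
  have "y = f a" if "y \<in> S" for y
  proof -
    have "y \<in> topspace Y" using S that connectedin_subset_topspace by blast
    moreover have "g y = a" using a that by blast
    ultimately show ?thesis using fg by (auto simp: homeomorphic_maps_def)
  qed
  then show "\<exists>a. S \<subseteq> {a}" by blast
qed

lemma omega_Stone_space_homeomorphic:
  assumes "X homeomorphic_space Y" "omega_Stone_space X"
  shows "omega_Stone_space Y"
  using assms totally_disconnected_space_homeomorphic[OF assms(1)]
    homeomorphic_locally_compact_space homeomorphic_metrizable_space
    homeomorphic_space_second_countability homeomorphic_Hausdorff_space
  unfolding omega_Stone_space_def second_countable_space_iff by metis

lemma CB_homeomorphic_map:
  assumes h: "homeomorphic_map X Y h" and X: "Hausdorff_space X"
  shows "CB Y \<xi> = h ` CB X \<xi>"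
proof (induction \<xi> rule: less_induct)
  case (less \<xi>)
  have sub: "CB X \<eta> \<subseteq> topspace X" for \<eta> using closedin_CB[OF X] by (rule closedin_subset)
  have inj: "inj_on h (topspace X)" using h by (rule homeomorphic_imp_injective_map)
  show ?case
  proof (cases \<xi> rule: omega1_cases)
    case zero
    then show ?thesis using homeomorphic_imp_surjective_map[OF h] by (simp add: CB_zero)
  next
    case (succ \<mu>)
    then show ?thesis
      using less[of \<mu>] homeomorphic_map_derived_set_of[OF h sub] by (simp add: CB_osuc)
  next
    case limit
    have "0 \<in> {..<\<xi>}" using omega1_pos[OF limit(1)] by simp
    then have "h ` (\<Inter>\<eta>\<in>{..<\<xi>}. CB X \<eta>) = (\<Inter>\<eta>\<in>{..<\<xi>}. h ` CB X \<eta>)"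
      using inj sub by (intro image_INT[of _ "topspace X"]) auto
    then show ?thesis using limit less by (simp add: CB_limit)
  qed
qed

lemma has_invariants_homeomorphic:
  assumes h: "homeomorphic_map X Y h" and X: "Hausdorff_space X"
    and inv: "has_invariants X \<nu> \<rho> n K r"
  shows "has_invariants Y \<nu> \<rho> n K r"
proof -
  note CB = CB_homeomorphic_map[OF h X]
  have sub: "CB X \<eta> \<subseteq> topspace X" for \<eta> using closedin_CB[OF X] by (rule closedin_subset)
  have inj: "inj_on h (topspace X)" using h by (rule homeomorphic_imp_injective_map)
  have len: "CB_length Y = CB_length X"
    unfolding CB_length_def CB using inj_on_image_eq_iff[OF inj sub sub] by simp
  have ker: "CB_kernel Y = h ` CB_kernel X" by (simp add: CB_kernel_def len CB)
  have kersub: "CB_kernel X \<subseteq> topspace X" using sub by (simp add: CB_kernel_def)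
  have diff: "CB Y \<eta> - CB_kernel Y = h ` (CB X \<eta> - CB_kernel X)" for \<eta>
    unfolding ker CB using sub kersub by (intro inj_on_image_set_diff[OF inj, symmetric]) auto
  have count: "CB_count Y = CB_count X"
  proof -
    have "inj_on h (CB X \<eta> - CB_kernel X)" for \<eta>
      using sub by (intro inj_on_subset[OF inj]) blast
    then show ?thesis
      unfolding CB_count_def len diff by (simp add: finite_image_iff card_image)
  qed
  have "CB_diff Y \<eta> = h ` CB_diff X \<eta>" for \<eta>
    unfolding CB_diff_def CB using sub by (intro inj_on_image_set_diff[OF inj, symmetric]) auto
  moreover have "CB_diff X \<eta> \<subseteq> topspace X" for \<eta> using sub by (auto simp: CB_diff_def)
  ultimately have "compactin Y (Y closure_of CB_diff Y \<eta>) \<longleftrightarrow> compactin X (X closure_of CB_diff X \<eta>)" for \<eta>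
    using homeomorphic_map_closure_of[OF h] homeomorphic_map_compactness[OF h] closure_of_subset_topspace
    by metis
  then have rho: "rho Y = rho X" by (simp add: rho_def)
  have krank: "kernel_rank Y (h x) = kernel_rank X x" if "x \<in> topspace X" for x
  proof -
    have "h x \<in> Y closure_of (CB Y \<eta> - CB_kernel Y) \<longleftrightarrow> x \<in> X closure_of (CB X \<eta> - CB_kernel X)" for \<eta>
    proof -
      have "CB X \<eta> - CB_kernel X \<subseteq> topspace X" using sub by blast
      then have "Y closure_of (CB Y \<eta> - CB_kernel Y) = h ` (X closure_of (CB X \<eta> - CB_kernel X))"
        unfolding diff by (rule homeomorphic_map_closure_of[OF h])
      then show ?thesis
        using inj_on_image_mem_iff[OF inj that closure_of_subset_topspace] by simp
    qed
    then show ?thesis by (simp add: kernel_rank_def)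
  qed
  obtain \<phi> where \<phi>: "homeomorphic_map (subtopology X (CB_kernel X)) K \<phi>"
      "\<forall>u\<in>topspace (subtopology X (CB_kernel X)). r (\<phi> u) = kernel_rank X u"
    using inv by (auto simp: has_invariants_def rank_homeomorphic_def)
  obtain g where hg: "homeomorphic_maps X Y h g" using h homeomorphic_map_maps by blast
  have gh: "g (h x) = x" if "x \<in> topspace X" for x using hg that by (simp add: homeomorphic_maps_def)
  have "homeomorphic_map Y X g" using hg homeomorphic_maps_map by blast
  then have g: "homeomorphic_map (subtopology Y (CB_kernel Y)) (subtopology X (CB_kernel X)) g"
  proof (rule homeomorphic_map_subtopologies)
    have "topspace Y \<inter> CB_kernel Y = h ` CB_kernel X"
      using kersub homeomorphic_imp_surjective_map[OF h] by (auto simp: ker)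
    moreover have "g ` h ` CB_kernel X = CB_kernel X"
      using kersub gh by (force simp: image_image)
    ultimately show "g ` (topspace Y \<inter> CB_kernel Y) = topspace X \<inter> CB_kernel X"
      using kersub by auto
  qed
  have "rank_homeomorphic (subtopology Y (CB_kernel Y)) (kernel_rank Y) K r"
    unfolding rank_homeomorphic_def
  proof (intro exI[of _ "\<phi> \<circ> g"] conjI ballI)
    show "homeomorphic_map (subtopology Y (CB_kernel Y)) K (\<phi> \<circ> g)"
      using g \<phi>(1) by (rule homeomorphic_map_compose)
    fix u assume "u \<in> topspace (subtopology Y (CB_kernel Y))"
    then have "u \<in> h ` CB_kernel X" by (simp add: ker)
    then obtain x where x: "x \<in> CB_kernel X" "u = h x" by blast
    then have "x \<in> topspace X" using kersub by blast
    then show "r ((\<phi> \<circ> g) u) = kernel_rank Y u"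
      using x \<phi>(2) gh krank by simp
  qed
  then show ?thesis
    using inv by (simp add: has_invariants_def len rho count)
qed

lemma homeomorphic_copy:
  assumes inj: "inj_on j (topspace X)"
  obtains Y where "homeomorphic_map X Y j"
proof -
  let ?i = "inv_into (topspace X) j"
  define Y where "Y = pullback_topology (j ` topspace X) ?i X"
  have top: "topspace Y = j ` topspace X"
    using inj by (auto simp: Y_def topspace_pullback_topology)
  have "continuous_map Y X ?i"
    using continuous_map_pullback[OF continuous_map_id, of "j ` topspace X" ?i X] by (simp add: Y_def)
  moreover have "continuous_map X Y j"
    unfolding Y_def
  proof (rule continuous_map_pullback')
    show "continuous_map X X (?i \<circ> j)"
      by (rule continuous_map_eq[OF continuous_map_id]) (simp add: inj)
    show "topspace X \<subseteq> j -` (j ` topspace X)" by blast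
  qed
  ultimately have "homeomorphic_maps X Y j ?i"
    unfolding homeomorphic_maps_def using inj by (auto simp: top)
  then show thesis using that homeomorphic_maps_map by blast
qed

text \<open>A word point is coded by a set of naturals. The constructed space can therefore be
  copied onto a set of reals, the type on which existence is claimed.\<close>

lemma inj_word_point_real: "\<exists>j :: word_point \<Rightarrow> real. inj j"
proof -
  let ?k = "\<lambda>p :: word_point. {to_nat (Inl n :: nat + nat list) |n. fst p n} \<union> {to_nat (Inr v :: nat + nat list) |v. snd p v}"
  have "inj ?k"
  proof (rule injI)
    fix p q assume eq: "?k p = ?k q"
    have k: "to_nat (Inl n :: nat + nat list) \<in> ?k p \<longleftrightarrow> fst p n"
      "to_nat (Inr v :: nat + nat list) \<in> ?k p \<longleftrightarrow> snd p v" for p :: word_point and n v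
      by auto
    have "fst p n = fst q n" for n using k(1)[of n p] k(1)[of n q] unfolding eq by simp
    moreover have "snd p v = snd q v" for v using k(2)[of v p] k(2)[of v q] unfolding eq by simp
    ultimately show "p = q" by (simp add: prod_eq_iff fun_eq_iff)
  qed
  moreover obtain f :: "nat set \<Rightarrow> real" where "inj f"
    using nat_sets_eqpoll_reals unfolding eqpoll_def bij_betw_def by blast
  ultimately have "inj (f \<circ> ?k)" using inj_compose by blast
  then show ?thesis by blast
qed

section \<open>Existence\<close>

lemma continuous_base_point: "continuous_on S base_point"
  unfolding base_point_def by (intro continuous_on_Pair continuous_on_id continuous_on_const)

text \<open>Removing the base point of \<open>c\<close> turns its rank \<open>rs c\<close> into \<open>\<rho>\<close>.\<close>

locale pointed_word_space = word_space +
  fixes c :: "nat \<Rightarrow> bool" and \<tau> :: omega1 and m :: nat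
  assumes c: "c \<in> C"
    and perfect: "C - {c} \<subseteq> top_of_set (C - {c}) derived_set_of (C - {c})"
    and l_le: "i \<in> I \<Longrightarrow> l i \<le> \<tau>"
    and finite_top: "finite {i \<in> I. l i = \<tau>}" and card_top: "card {i \<in> I. l i = \<tau>} = m"
    and top_attained: "m = 0 \<Longrightarrow> \<xi> < \<tau> \<Longrightarrow> \<exists>y\<in>C. \<xi> < rs y"
begin

abbreviation "W \<equiv> top_of_set (carrier - {base_point c})"
abbreviation "L \<equiv> base_point ` (C - {c})"

sublocale X: ranked_space "top_of_set carrier" "base_point ` C" rk
  by (rule ranked)

lemma inj_base_point: "inj base_point"
  by (auto simp: inj_def base_point_def)

lemma high_eq: "X.high \<xi> = point ` {w. valid w \<and> \<xi> \<le> lab w}"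
  using carrier_diff_base rk_point by (auto simp: X.high_def)

lemma W_eq: "W = subtopology (top_of_set carrier) (carrier - {base_point c})"
  by (simp add: subtopology_subtopology Int_absorb1)

lemma L_eq: "base_point ` C \<inter> (carrier - {base_point c}) = L"
  using inj_base_point by (auto simp: carrier_def inj_def)

lemma point_in_W: "valid w \<Longrightarrow> point w \<in> carrier - {base_point c}"
  using point_not_base valid_nonempty by (auto simp: carrier_def)

sublocale W: ranked_space W L rk
proof -
  have "topspace (top_of_set carrier) - base_point ` C \<subseteq> carrier - {base_point c}"
    using c by auto
  from X.ranked_space_subtopology[OF this] show "ranked_space W L rk"
    by (simp only: L_eq W_eq)
qed

lemma W_high: "W.high \<xi> = X.high \<xi>"
proof -
  have "topspace W - L = topspace (top_of_set carrier) - base_point ` C"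
    using c by (auto simp: carrier_def)
  then show ?thesis by (simp add: W.high_def X.high_def)
qed

lemma L_perfect: "L \<subseteq> W derived_set_of L"
proof
  fix p assume "p \<in> L"
  then obtain y where y: "y \<in> C - {c}" "p = base_point y" by blast
  show "p \<in> W derived_set_of L"
    unfolding in_derived_set_of
  proof (intro conjI allI impI)
    show "p \<in> topspace W" using y inj_base_point by (auto simp: carrier_def inj_def)
    fix T assume "p \<in> T \<and> openin W T"
    then obtain G where G: "open G" "T = (carrier - {base_point c}) \<inter> G" "p \<in> G"
      by (auto simp: openin_open)
    have "open (base_point -` G)" using G(1) continuous_base_point by (rule open_vimage)
    then have "openin (top_of_set (C - {c})) ((C - {c}) \<inter> base_point -` G)" by (rule openin_open_Int)
    moreover have "y \<in> (C - {c}) \<inter> base_point -` G" using y G(3) by simp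
    moreover have "y \<in> top_of_set (C - {c}) derived_set_of (C - {c})" using perfect y(1) by blast
    ultimately obtain z where z: "z \<noteq> y" "z \<in> C - {c}" "z \<in> (C - {c}) \<inter> base_point -` G"
      using derived_set_of_obtains by metis
    then have "base_point z \<noteq> p" "base_point z \<in> L" "base_point z \<in> T"
      using y G(2) inj_base_point by (auto simp: carrier_def inj_def)
    then show "\<exists>q. q \<noteq> p \<and> q \<in> L \<and> q \<in> T" by blast
  qed
qed

sublocale W: CB_ranked_space W L rk
proof
  show "CB W \<xi> = W.high \<xi> \<union> L" for \<xi> using L_perfect by (rule W.CB_eq_high_Un)
  have "\<not> osuc \<tau> \<le> lab w" if "valid w" for w
    using lab_le_last[OF that] l_le[OF valid_last[OF that]] by (simp add: osuc_le_iff not_less)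
  then show "\<exists>\<xi>. W.high \<xi> = {}"
    by (intro exI[of _ "osuc \<tau>"]) (auto simp: W_high high_eq)
qed

lemma omega_Stone_W: "omega_Stone_space W"
  unfolding omega_Stone_space_def
proof (intro conjI)
  have H: "Hausdorff_space (top_of_set carrier)"
    using Hausdorff_word_point by (rule Hausdorff_space_subtopology)
  show "Hausdorff_space W" using Hausdorff_word_point by (rule Hausdorff_space_subtopology)
  show "metrizable_space W" using metrizable_word_point by (rule metrizable_space_subtopology)
  show "second_countable_space W"
    unfolding second_countable_space_iff using second_countable_euclidean by (rule second_countable_subtopology)
  have "openin (top_of_set carrier) (carrier - {base_point c})"
    using open_in_Hausdorff_delete[OF H openin_topspace, of "base_point c"] by simp
  moreover have "locally_compact_space (top_of_set carrier)"
    using compact_carrier by (intro compact_imp_locally_compact_space) (simp add: compact_space_subtopology)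
  ultimately show "locally_compact_space W"
    unfolding W_eq by (rule locally_compact_space_open_subset[OF disjI1[OF H], rotated])
  show "totally_disconnected_space W"
    unfolding totally_disconnected_space_def
  proof (intro allI impI)
    fix S assume "connectedin W S"
    then have S: "connected S" by (simp add: connectedin_subtopology)
    have const: "f p = f q" if f: "continuous_on UNIV f" "p \<in> S" "q \<in> S" for f :: "word_point \<Rightarrow> bool" and p q
    proof (rule ccontr)
      assume ne: "f p \<noteq> f q"
      have o: "open (f -` {b})" for b using f(1) by (intro open_vimage open_discrete)
      have "f -` {True} \<inter> S = {} \<or> f -` {False} \<inter> S = {}"
      proof (rule connectedD[OF S o o])
        show "f -` {True} \<inter> f -` {False} \<inter> S = {}" by blast
        show "S \<subseteq> f -` {True} \<union> f -` {False}" by auto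
      qed
      moreover have "p \<in> f -` {f p} \<inter> S" "q \<in> f -` {f q} \<inter> S" using f(2,3) by simp_all
      ultimately show False using ne by (cases "f p"; cases "f q") auto
    qed
    have "p = q" if "p \<in> S" "q \<in> S" for p q
    proof -
      have "fst p i = fst q i" for i
        by (rule const[OF continuous_on_compose2[OF continuous_on_product_coordinates continuous_on_fst[OF continuous_on_id]] that]) simp
      moreover have "snd p v = snd q v" for v
        by (rule const[OF continuous_on_compose2[OF continuous_on_product_coordinates continuous_on_snd[OF continuous_on_id]] that]) simp
      ultimately show ?thesis by (simp add: prod_eq_iff fun_eq_iff)
    qed
    then show "\<exists>p. S \<subseteq> {p}" by blast
  qed
qed

text \<open>The closure of \<open>high \<xi>\<close> in \<open>W\<close> is its closure in the
  compact carrier without the base point of \<open>c\<close>. It is compact exactly when that point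
  was not in the closure, and the rank law there compares \<xi> with \<open>rs c\<close>.\<close>

lemma rho_W: "rho W = rs c"
proof -
  let ?X = "top_of_set carrier" and ?b = "base_point c"
  have H: "Hausdorff_space ?X" by (rule X.Hausdorff)
  have comp: "compact_space ?X" using compact_carrier by (simp add: compact_space_subtopology)
  have "compactin W (W closure_of W.high \<xi>) \<longleftrightarrow> rs c \<le> \<xi>" for \<xi>
  proof -
    let ?S = "X.high \<xi>"
    have S: "?S \<subseteq> carrier - {?b}"
    proof
      fix p assume "p \<in> ?S"
      then obtain w where "p = point w" "valid w" unfolding high_eq by (elim imageE) simp
      then show "p \<in> carrier - {?b}" using point_in_W by simp
    qed
    have cl: "W closure_of W.high \<xi> = (carrier - {?b}) \<inter> ?X closure_of ?S"
    proof -
      have "W closure_of W.high \<xi> = subtopology ?X (carrier - {?b}) closure_of ?S"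
        unfolding W_high by (subst W_eq) (rule refl)
      also have "\<dots> = (carrier - {?b}) \<inter> ?X closure_of ((carrier - {?b}) \<inter> ?S)"
        by (rule closure_of_subtopology)
      also have "(carrier - {?b}) \<inter> ?S = ?S" using S by (rule Int_absorb1)
      finally show ?thesis .
    qed
    have b: "?b \<in> ?X closure_of ?S \<longleftrightarrow> \<xi> < rs c"
    proof -
      have "?b \<in> carrier" using c unfolding carrier_def by blast
      moreover have "?b \<notin> ?S" using S by blast
      ultimately show ?thesis by (simp add: closure_of_alt X.derived_high rk_base)
    qed
    have "compactin W (W closure_of W.high \<xi>) \<longleftrightarrow> compactin ?X ((carrier - {?b}) \<inter> ?X closure_of ?S)"
      unfolding cl unfolding W_eq by (simp add: compactin_subtopology)
    also have "\<dots> \<longleftrightarrow> ?b \<notin> ?X closure_of ?S"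
    proof
      assume "compactin ?X ((carrier - {?b}) \<inter> ?X closure_of ?S)"
      then have "closedin ?X ((carrier - {?b}) \<inter> ?X closure_of ?S)" using H by (rule compactin_imp_closedin[rotated])
      moreover have "?S \<subseteq> (carrier - {?b}) \<inter> ?X closure_of ?S"
        using S closure_of_subset[of ?S ?X] by auto
      ultimately have "?X closure_of ?S \<subseteq> (carrier - {?b}) \<inter> ?X closure_of ?S" by (intro closure_of_minimal)
      then show "?b \<notin> ?X closure_of ?S" by blast
    next
      assume "?b \<notin> ?X closure_of ?S"
      then have "(carrier - {?b}) \<inter> ?X closure_of ?S = ?X closure_of ?S"
        using closure_of_subset_topspace[of ?X ?S] by auto
      then show "compactin ?X ((carrier - {?b}) \<inter> ?X closure_of ?S)"
        using comp by (simp add: closedin_compact_space)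
    qed
    finally show ?thesis using b by (simp add: not_less)
  qed
  then have "rs c \<le> \<xi> \<longleftrightarrow> rho W \<le> \<xi>" for \<xi> using W.compact_closure_high_iff by simp
  then show ?thesis by (metis order_antisym order_refl)
qed

lemma rank_homeomorphic_W:
  "rank_homeomorphic (subtopology W (CB_kernel W)) (kernel_rank W) (top_of_set (C - {c})) rs"
proof -
  have LW: "L \<subseteq> carrier - {base_point c}" using inj_base_point by (auto simp: carrier_def inj_def)
  then have eq: "subtopology W (CB_kernel W) = top_of_set L"
    by (simp add: W.CB_kernel_eq subtopology_subtopology Int_absorb1)
  have "homeomorphic_maps (top_of_set L) (top_of_set (C - {c})) fst base_point"
    unfolding homeomorphic_maps_def
  proof (intro conjI ballI)
    show "continuous_map (top_of_set L) (top_of_set (C - {c})) fst"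
      by (auto simp: base_point_def intro!: continuous_on_fst continuous_on_id)
    show "continuous_map (top_of_set (C - {c})) (top_of_set L) base_point"
      using continuous_base_point by auto
  qed (auto simp: base_point_def)
  then have "homeomorphic_map (top_of_set L) (top_of_set (C - {c})) fst"
    using homeomorphic_maps_map by blast
  moreover have "rs (fst u) = kernel_rank W u" if u: "u \<in> L" for u
  proof -
    have "kernel_rank W u = rk u" using u by (rule W.kernel_rank_eq)
    moreover obtain y where "u = base_point y" using u by blast
    ultimately show ?thesis by (simp add: rk_base) (simp add: base_point_def)
  qed
  ultimately show ?thesis unfolding rank_homeomorphic_def eq by (intro exI[of _ fst]) auto
qed

lemma has_invariants_W:
  "has_invariants W (if m = 0 then \<tau> else osuc \<tau>) (rs c) (if m = 0 then -\<infinity> else ereal (real m))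
    (top_of_set (C - {c})) rs"
proof -
  \<comment> \<open>Labels of roots are at most \<tau> and those of other nodes are strictly below
    the label of their root, so only roots can reach \<tau>.\<close>
  have "W.high \<tau> = (\<lambda>i. point [i]) ` {i \<in> I. l i = \<tau>}"
  proof (intro equalityI subsetI)
    fix p assume "p \<in> W.high \<tau>"
    then obtain w where w: "p = point w" "valid w" "\<tau> \<le> lab w" by (auto simp: W_high high_eq)
    have ne: "w \<noteq> []" using w valid_nonempty by blast
    have I: "last w \<in> I" using w valid_last by blast
    have "[last w] = w \<or> lab w < lab [last w]"
      using lab_suffix[OF w(2) suffix_last[OF ne]] by simp
    moreover have "\<not> lab w < lab [last w]" using l_le[OF I] w(3) by auto
    ultimately have eq: "[last w] = w" by blast
    then have "lab w = l (last w)" by (metis lab.simps(2))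
    then have "l (last w) = \<tau>" using l_le[OF I] w(3) by (metis order_antisym)
    then show "p \<in> (\<lambda>i. point [i]) ` {i \<in> I. l i = \<tau>}"
      using I w(1) eq by (intro image_eqI[of _ _ "last w"]) auto
  next
    fix p assume "p \<in> (\<lambda>i. point [i]) ` {i \<in> I. l i = \<tau>}"
    then obtain i where "p = point [i]" "i \<in> I" "l i = \<tau>" by blast
    then show "p \<in> W.high \<tau>"
      unfolding W_high high_eq by (intro image_eqI[of _ _ "[i]"]) auto
  qed
  moreover have "inj (\<lambda>i. point [i])" using point_inject by (auto simp: inj_def)
  ultimately have fin: "finite (W.high \<tau>)" and card: "card (W.high \<tau>) = m"
    using finite_top card_top by (auto simp: card_image inj_on_subset)
  have inf: "infinite (W.high \<xi>)" if lt: "\<xi> < \<tau>" for \<xi>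
  proof -
    \<comment> \<open>For \<open>m = 0\<close> the ranks up to \<tau> are forced by
      \<open>C\<close>; for \<open>m > 0\<close> a root of rank \<tau> does the same.\<close>
    have "\<exists>x\<in>carrier. \<xi> < rk x"
    proof (cases "m = 0")
      case True
      then obtain y where "y \<in> C" "\<xi> < rs y" using top_attained[OF True lt] by blast
      then show ?thesis by (intro bexI[of _ "base_point y"]) (auto simp: rk_base carrier_def)
    next
      case False
      then have "{i \<in> I. l i = \<tau>} \<noteq> {}" using card_top by (metis card.empty)
      then obtain i where "i \<in> I" "l i = \<tau>" by blast
      then have "valid [i]" "rk (point [i]) = \<tau>" using rk_point[of "[i]"] by auto
      then show ?thesis using lt by (intro bexI[of _ "point [i]"]) (auto simp: carrier_def)
    qed
    then have "infinite {q \<in> topspace (top_of_set carrier) - base_point ` C. rk q = \<xi>}"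
      using X.infinite_rank_values_below[OF openin_topspace] by auto
    moreover have "{q \<in> topspace (top_of_set carrier) - base_point ` C. rk q = \<xi>} \<subseteq> W.high \<xi>"
      unfolding W_high by (auto simp: X.high_def)
    ultimately show ?thesis using finite_subset by blast
  qed
  show ?thesis
    unfolding has_invariants_def
    using W.CB_length_count[OF fin card inf] rho_W rank_homeomorphic_W by blast
qed

lemma realization:
  "\<exists>Y :: real topology. omega_Stone_space Y \<and>
    has_invariants Y (if m = 0 then \<tau> else osuc \<tau>) (rs c) (if m = 0 then -\<infinity> else ereal (real m))
      (top_of_set (C - {c})) rs"
proof -
  obtain j :: "word_point \<Rightarrow> real" where "inj j" using inj_word_point_real by blast
  then have "inj_on j (topspace W)" by (rule inj_on_subset) simp
  then obtain Y where Y: "homeomorphic_map W Y j" by (rule homeomorphic_copy)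
  then have "W homeomorphic_space Y" by (rule homeomorphic_map_imp_homeomorphic_space)
  then show ?thesis
    using omega_Stone_space_homeomorphic[OF _ omega_Stone_W]
      has_invariants_homeomorphic[OF Y W.Hausdorff has_invariants_W] by blast
qed

end

text \<open>Enumerating pairs of a smaller rank and a natural number, and then forgetting the
  number, repeats every smaller rank infinitely often.\<close>

lemma ex_recurrent_enumeration:
  "\<exists>e :: omega1 \<Rightarrow> nat \<Rightarrow> omega1. (\<forall>\<xi> n. \<xi> \<noteq> 0 \<longrightarrow> e \<xi> n < \<xi>) \<and> (\<forall>\<eta> \<xi>. \<eta> < \<xi> \<longrightarrow> infinite {n. e \<xi> n = \<eta>})"
proof -
  define e where "e \<xi> n = fst (from_nat_into ({..<\<xi>} \<times> (UNIV :: nat set)) n)" for \<xi> :: omega1 and n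
  have "e \<xi> n < \<xi>" if "\<xi> \<noteq> 0" for \<xi> n
  proof -
    have "{..<\<xi>} \<times> (UNIV :: nat set) \<noteq> {}" using omega1_pos[OF that] by auto
    then have "from_nat_into ({..<\<xi>} \<times> UNIV) n \<in> {..<\<xi>} \<times> (UNIV :: nat set)" by (rule from_nat_into)
    then show ?thesis by (auto simp: e_def)
  qed
  moreover have "infinite {n. e \<xi> n = \<eta>}" if "\<eta> < \<xi>" for \<eta> \<xi>
  proof
    assume fin: "finite {n. e \<xi> n = \<eta>}"
    let ?S = "{..<\<xi>} \<times> (UNIV :: nat set)"
    have "countable ?S" using countable_below_omega1 by simp
    then have sub: "?S \<subseteq> range (from_nat_into ?S)" by (rule subset_range_from_nat_into)
    have "{\<eta>} \<times> UNIV \<subseteq> from_nat_into ?S ` {n. e \<xi> n = \<eta>}"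
    proof
      fix p :: "omega1 \<times> nat" assume p: "p \<in> {\<eta>} \<times> UNIV"
      then have "p \<in> ?S" using that by auto
      then obtain n where n: "p = from_nat_into ?S n" using sub by blast
      then have "e \<xi> n = \<eta>" using p by (simp add: e_def flip: n) auto
      then show "p \<in> from_nat_into ?S ` {n. e \<xi> n = \<eta>}" using n by simp
    qed
    then have "finite ({\<eta>} \<times> (UNIV :: nat set))" using fin finite_surj by blast
    then show False by (simp add: finite_cartesian_product_iff)
  qed
  ultimately show ?thesis by blast
qed

lemma ex_countable_dense_subset:
  fixes F :: "'a::second_countable_topology set"
  shows "\<exists>D\<subseteq>F. countable D \<and> (\<forall>U y. open U \<longrightarrow> y \<in> U \<longrightarrow> y \<in> F \<longrightarrow> U \<inter> D \<noteq> {})"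
proof -
  obtain B :: "'a set set" where B: "countable B" "topological_basis B"
    using ex_countable_basis by blast
  let ?p = "\<lambda>V. SOME x. x \<in> V \<inter> F"
  let ?D = "?p ` {V \<in> B. V \<inter> F \<noteq> {}}"
  have p: "?p V \<in> V \<inter> F" if "V \<inter> F \<noteq> {}" for V
    by (rule someI_ex[of "\<lambda>x. x \<in> V \<inter> F"]) (use that in blast)
  have "countable {V \<in> B. V \<inter> F \<noteq> {}}" using B(1) by (rule countable_subset[rotated]) blast
  then have "countable ?D" by (rule countable_image)
  moreover have "?D \<subseteq> F"
  proof
    fix x assume "x \<in> ?D"
    then obtain V where "x = ?p V" "V \<inter> F \<noteq> {}" by (elim imageE) simp
    then show "x \<in> F" using p[of V] by simp
  qed
  moreover have "U \<inter> ?D \<noteq> {}" if U: "open U" "y \<in> U" "y \<in> F" for U y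
  proof -
    obtain V where V: "V \<in> B" "y \<in> V" "V \<subseteq> U" by (rule topological_basisE[OF B(2) U(1,2)])
    then have "V \<inter> F \<noteq> {}" using U(3) by blast
    then have "?p V \<in> ?D" using V(1) by (intro imageI) simp
    moreover have "?p V \<in> U" using p[OF \<open>V \<inter> F \<noteq> {}\<close>] V(3) by (elim IntE) (rule subsetD)
    ultimately have "?p V \<in> U \<inter> ?D" by (rule IntI[rotated])
    then show ?thesis by (metis emptyE)
  qed
  ultimately show ?thesis by blast
qed

text \<open>
  The roots are copies \<open>Inl ((x, \<xi>), k)\<close> of the pairs of a rank \<open>\<xi>\<close> and a point \<open>x\<close> of the dense
  set for \<open>\<xi>\<close>, and \<open>m\<close> further roots \<open>Inr j\<close> of rank \<open>\<tau>\<close>.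
\<close>

lemma realization_of_ranks:
  fixes C :: "(nat \<Rightarrow> bool) set"
  assumes C: "closed C" and c: "c \<in> C"
    and perfect: "C - {c} \<subseteq> top_of_set (C - {c}) derived_set_of (C - {c})"
    and closed: "\<And>\<xi>. closed {y \<in> C. \<xi> < rs y}"
    and le: "\<And>y. y \<in> C \<Longrightarrow> rs y \<le> M" and M\<tau>: "M \<le> \<tau>"
    and attained: "\<And>\<xi>. m = 0 \<Longrightarrow> \<xi> < \<tau> \<Longrightarrow> \<exists>y\<in>C. \<xi> < rs y"
  shows "\<exists>Y :: real topology. omega_Stone_space Y \<and>
    has_invariants Y (if m = 0 then \<tau> else osuc \<tau>) (rs c) (if m = 0 then -\<infinity> else ereal (real m))
      (top_of_set (C - {c})) rs"
proof -
  obtain e :: "omega1 \<Rightarrow> nat \<Rightarrow> omega1" where e: "\<And>\<xi> n. \<xi> \<noteq> 0 \<Longrightarrow> e \<xi> n < \<xi>"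
    "\<And>\<eta> \<xi>. \<eta> < \<xi> \<Longrightarrow> infinite {n. e \<xi> n = \<eta>}"
    using ex_recurrent_enumeration by blast
  define F where "F \<xi> = {y \<in> C. \<xi> < rs y}" for \<xi>
  have "\<forall>\<xi>. \<exists>D\<subseteq>F \<xi>. countable D \<and> (\<forall>U y. open U \<longrightarrow> y \<in> U \<longrightarrow> y \<in> F \<xi> \<longrightarrow> U \<inter> D \<noteq> {})"
    using ex_countable_dense_subset by blast
  then obtain D where D: "\<And>\<xi>. D \<xi> \<subseteq> F \<xi>" "\<And>\<xi>. countable (D \<xi>)"
    "\<And>\<xi> U y. open U \<Longrightarrow> y \<in> U \<Longrightarrow> y \<in> F \<xi> \<Longrightarrow> U \<inter> D \<xi> \<noteq> {}"
    by metis
  \<comment> \<open>From \<open>M\<close> on the sets \<open>F \<xi>\<close> are empty; stopping at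
    \<open>M\<close> makes \<open>Q\<close> a countable union.\<close>
  define Q where "Q = (\<Union>\<xi>\<in>{..<M}. D \<xi> \<times> {\<xi>})"
  define Z :: "(((nat \<Rightarrow> bool) \<times> omega1) \<times> nat + nat) set" where "Z = Inl ` (Q \<times> UNIV) \<union> Inr ` {..<m}"
  define pos where "pos z = (case z of Inl p \<Rightarrow> fst (fst p) | Inr j \<Rightarrow> c)"
    for z :: "((nat \<Rightarrow> bool) \<times> omega1) \<times> nat + nat"
  define lev where "lev z = (case z of Inl p \<Rightarrow> snd (fst p) | Inr j \<Rightarrow> \<tau>)"
    for z :: "((nat \<Rightarrow> bool) \<times> omega1) \<times> nat + nat"
  have "countable Q" unfolding Q_def using D(2) countable_below_omega1 by simp
  then have "countable Z" unfolding Z_def by simp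
  then have inj: "inj_on (to_nat_on Z) Z" by (rule inj_on_to_nat_on)
  define g where "g = to_nat_on Z"
  define I where "I = g ` Z"
  define a where "a i = pos (inv_into Z g i)" for i
  define l where "l i = lev (inv_into Z g i)" for i
  have I: "{i \<in> I. P (a i) (l i)} = g ` {z \<in> Z. P (pos z) (lev z)}" for P
    using inj unfolding I_def a_def l_def g_def by auto
  have Zcases: "(\<exists>x \<xi> k. z = Inl ((x, \<xi>), k) \<and> \<xi> < M \<and> x \<in> D \<xi>) \<or> (\<exists>j<m. z = Inr j)" if "z \<in> Z" for z
    using that by (auto simp: Z_def Q_def)
  have pos_in: "pos z \<in> C" if "z \<in> Z" for z
    using Zcases[OF that] c D(1) by (fastforce simp: pos_def F_def)
  have lev_le: "lev z \<le> \<tau>" if "z \<in> Z" for z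
    using Zcases[OF that] M\<tau> by (auto simp: lev_def)
  \<comment> \<open>Roots attached along the dense sets have ranks below \<open>M\<close>, hence
    below \<tau>, so they do not disturb the count of the top level.\<close>
  have "{z \<in> Z. lev z = \<tau>} = Inr ` {..<m}"
  proof (intro equalityI subsetI)
    fix z assume "z \<in> {z \<in> Z. lev z = \<tau>}"
    then show "z \<in> Inr ` {..<m}" using Zcases[of z] M\<tau> by (auto simp: lev_def)
  qed (auto simp: Z_def lev_def)
  then have top: "{i \<in> I. l i = \<tau>} = g ` Inr ` {..<m}"
    using I[of "\<lambda>_ \<xi>. \<xi> = \<tau>"] by simp
  have inj_top: "inj_on g (Inr ` {..<m})" using inj unfolding g_def by (rule inj_on_subset) (simp add: Z_def)
  interpret pointed_word_space C rs I a l e c \<tau> m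
  proof
    show "a i \<in> C" if "i \<in> I" for i
      using that pos_in unfolding I_def a_def by (simp add: inv_into_into)
    show "l i \<le> \<tau>" if "i \<in> I" for i
      using that lev_le unfolding I_def l_def by (simp add: inv_into_into)
    show "finite {i \<in> I. l i = \<tau>}" unfolding top by simp
    show "card {i \<in> I. l i = \<tau>} = m" unfolding top using inj_top by (simp add: card_image)
    show "\<exists>U. open U \<and> y \<in> U \<and> finite {i \<in> I. a i \<in> U \<and> \<xi> \<le> l i}" if y: "y \<in> C" "rs y \<le> \<xi>" for y \<xi>
    \<comment> \<open>A root of rank \<zeta> \<ge> \<xi> from the dense sets sits in
      \<open>F \<zeta>\<close>, which is inside \<open>F \<xi>\<close>. Off \<open>F \<xi>\<close>
      only the \<open>m\<close> extra roots can have rank at least \<xi>.\<close>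
    proof (intro exI[of _ "- F \<xi>"] conjI)
      show "open (- F \<xi>)" using closed by (simp add: F_def open_Compl)
      show "y \<in> - F \<xi>" using y by (auto simp: F_def)
      have "{z \<in> Z. pos z \<in> - F \<xi> \<and> \<xi> \<le> lev z} \<subseteq> Inr ` {..<m}"
      proof
        fix z assume z: "z \<in> {z \<in> Z. pos z \<in> - F \<xi> \<and> \<xi> \<le> lev z}"
        show "z \<in> Inr ` {..<m}"
        proof (rule ccontr)
          assume "z \<notin> Inr ` {..<m}"
          then obtain x \<zeta> k where x: "z = Inl ((x, \<zeta>), k)" "x \<in> D \<zeta>" using Zcases[of z] z by blast
          then have "x \<in> F \<zeta>" "\<xi> \<le> \<zeta>" "x \<notin> F \<xi>" using D(1) z by (auto simp: pos_def lev_def)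
          then show False by (auto simp: F_def)
        qed
      qed
      then have "finite {z \<in> Z. pos z \<in> - F \<xi> \<and> \<xi> \<le> lev z}" by (rule finite_subset) simp
      then show "finite {i \<in> I. a i \<in> - F \<xi> \<and> \<xi> \<le> l i}"
        unfolding I[of "\<lambda>x \<zeta>. x \<in> - F \<xi> \<and> \<xi> \<le> \<zeta>"] by (rule finite_imageI)
    qed
    show "infinite {i \<in> I. a i \<in> U \<and> l i = \<xi>}" if y: "y \<in> C" "\<xi> < rs y" "open U" "y \<in> U" for y \<xi> U
    proof -
      have "y \<in> F \<xi>" using y by (simp add: F_def)
      then obtain x where x: "x \<in> U" "x \<in> D \<xi>" using D(3)[OF y(3,4)] by blast
      have "\<xi> < M" using y(2) le[OF y(1)] by (rule order_less_le_trans)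
      then have sub: "range (\<lambda>k. Inl ((x, \<xi>), k)) \<subseteq> {z \<in> Z. pos z \<in> U \<and> lev z = \<xi>}"
        using x by (auto simp: Z_def Q_def pos_def lev_def)
      have "infinite (range (\<lambda>k :: nat. Inl ((x, \<xi>), k) :: ((nat \<Rightarrow> bool) \<times> omega1) \<times> nat + nat))"
        by (rule range_inj_infinite) (simp add: inj_def)
      then have "infinite {z \<in> Z. pos z \<in> U \<and> lev z = \<xi>}" using sub infinite_super by blast
      moreover have "inj_on g {z \<in> Z. pos z \<in> U \<and> lev z = \<xi>}"
        using inj unfolding g_def by (rule inj_on_subset) blast
      ultimately show ?thesis
        using I[of "\<lambda>x \<zeta>. x \<in> U \<and> \<zeta> = \<xi>"] by (simp add: finite_image_iff)
    qed
  qed (use C c perfect e attained in auto)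
  show ?thesis by (rule realization)
qed

text \<open>One point for each value of \<open>r\<close> gives a right-separated family: the set of
  points of rank at most \<xi> is open and misses the points chosen for larger values. So there are
  countably many values, and they are bounded.\<close>

lemma usc_map_bounded:
  assumes usc: "usc_map K r" and sc: "second_countable K"
  shows "\<exists>\<beta>. \<forall>x\<in>topspace K. r x \<le> \<beta>"
proof -
  have "countable (r ` topspace K)"
  proof (rule second_countable_right_separated[OF sc])
    let ?p = "inv_into (topspace K) r" and ?V = "\<lambda>\<xi>. topspace K - {x \<in> topspace K. osuc \<xi> \<le> r x}"
    show "openin K (?V \<xi>) \<and> ?p \<xi> \<in> ?V \<xi>" if "\<xi> \<in> r ` topspace K" for \<xi>
    proof
      show "openin K (?V \<xi>)" using usc by (auto simp: usc_map_def)
      show "?p \<xi> \<in> ?V \<xi>" using that by (simp add: inv_into_into f_inv_into_f osuc_le_iff)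
    qed
    show "?p \<eta> \<notin> ?V \<xi>" if "\<eta> \<in> r ` topspace K" "\<xi> < \<eta>" for \<xi> \<eta>
      using that by (simp add: inv_into_into f_inv_into_f osuc_le_iff)
  qed
  then obtain \<beta> where "\<forall>\<xi>\<in>r ` topspace K. \<xi> \<le> \<beta>" using countable_omega1_bounded by metis
  then show ?thesis by (intro exI[of _ \<beta>]) simp
qed

text \<open>Here \<open>C\<close> is \<open>K\<close> with the point \<open>c\<close> of rank \<rho>
  added, and upper semi-continuity has to be extended to \<open>c\<close>. For \<xi> < \<rho> the
  set of higher rank contains \<open>c\<close>, and closedness in \<open>K\<close> is enough; for
  \<xi> \<ge> \<rho> it misses \<open>c\<close> and must be compact, which
  \<open>rho_U K r \<le> \<rho>\<close> ensures.\<close>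

lemma existence_from_model:
  fixes C :: "(nat \<Rightarrow> bool) set" and K :: "'k topology"
  assumes C: "closed C" and c: "c \<in> C"
    and perfect: "C - {c} \<subseteq> top_of_set (C - {c}) derived_set_of (C - {c})"
    and h: "homeomorphic_map (top_of_set (C - {c})) K h"
    and usc: "usc_map K r"
    and n: "n \<in> {ereal (real k) | k. k > 0} \<union> {-\<infinity>}"
    and \<rho>: "rho_U K r \<le> \<rho>" and \<nu>: "max \<rho> (rank_sup K r) \<le> \<nu>"
    and succ: "\<rho> < \<nu> \<Longrightarrow> is_osuc \<nu>" and n_iff: "n = -\<infinity> \<longleftrightarrow> max \<rho> (rank_sup K r) = \<nu>"
  shows "\<exists>Y :: real topology. omega_Stone_space Y \<and> has_invariants Y \<nu> \<rho> n K r"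
proof -
  let ?M = "max \<rho> (rank_sup K r)"
  define rs where "rs y = (if y = c then \<rho> else r (h y))" for y
  have "second_countable (top_of_set (C - {c}))"
    using second_countable_euclidean by (rule second_countable_subtopology)
  then have scK: "second_countable K"
    using h homeomorphic_map_imp_homeomorphic_space homeomorphic_space_second_countability by blast
  obtain \<beta> where \<beta>: "\<And>x. x \<in> topspace K \<Longrightarrow> r x \<le> \<beta>" using usc_map_bounded[OF usc scK] by blast
  have him: "h ` (C - {c}) = topspace K" using homeomorphic_imp_surjective_map[OF h] by simp
  have closedK: "closedin K {x \<in> topspace K. \<xi> < r x}" for \<xi>
    using usc by (simp add: usc_map_def flip: osuc_le_iff)
  have le_sup: "r x \<le> rank_sup K r" if "x \<in> topspace K" for x
    unfolding rank_sup_def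
  proof (rule cSUP_upper[OF that])
    show "bdd_above (r ` topspace K)" by (rule bdd_aboveI2) (rule \<beta>)
  qed
  have less_sup: "\<exists>x\<in>topspace K. \<xi> < r x" if "\<xi> < rank_sup K r" for \<xi>
  proof (rule ccontr)
    assume "\<not> ?thesis"
    \<comment> \<open>The definition of \<open>Sup\<close> by a least upper bound covers the empty
      kernel as well.\<close>
    then have "rank_sup K r \<le> \<xi>"
      unfolding rank_sup_def Sup_omega1_def by (intro Least_le) (auto simp: not_less)
    then show False using that by simp
  qed
  have compactK: "compactin K {x \<in> topspace K. \<xi> < r x}" if "\<rho> \<le> \<xi>" for \<xi>
  proof -
    have "rank_above K r \<beta> = {}" using \<beta> by (auto simp: rank_above_def not_less)
    then have "\<exists>\<xi>. compactin K (rank_above K r \<xi>)" by (metis compactin_empty)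
    then have "compactin K (rank_above K r (rho_U K r))"
      unfolding rho_U_def by (rule LeastI_ex)
    then show ?thesis
    proof (rule closed_compactin[OF _ _ closedK])
      show "{x \<in> topspace K. \<xi> < r x} \<subseteq> rank_above K r (rho_U K r)"
        using that \<rho> by (auto simp: rank_above_def)
    qed
  qed
  have closed: "closed {y \<in> C. \<xi> < rs y}" for \<xi>
  proof (cases "\<rho> \<le> \<xi>")
    case True
    let ?B = "{y \<in> C - {c}. \<xi> < r (h y)}"
    have "h ` ?B = {x \<in> topspace K. \<xi> < r x}" unfolding him[symmetric] by blast
    moreover have "?B \<subseteq> topspace (top_of_set (C - {c}))" by auto
    ultimately have "compactin (top_of_set (C - {c})) ?B"
      using homeomorphic_map_compactness[OF h] compactK[OF True] by metis
    then have "compactin euclidean ?B" by (simp add: compactin_subtopology)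
    then have "closedin euclidean ?B" by (rule compactin_imp_closedin[OF Hausdorff_bool_fun])
    moreover have "{y \<in> C. \<xi> < rs y} = ?B" using True by (auto simp: rs_def)
    ultimately show ?thesis by simp
  next
    case False
    have "closedin (top_of_set (C - {c})) {y \<in> topspace (top_of_set (C - {c})). h y \<in> {x \<in> topspace K. \<xi> < r x}}"
      using homeomorphic_imp_continuous_map[OF h] closedK by (rule closedin_continuous_map_preimage)
    then obtain T where T: "closed T"
      "{y \<in> topspace (top_of_set (C - {c})). h y \<in> {x \<in> topspace K. \<xi> < r x}} = (C - {c}) \<inter> T"
      by (auto simp: closedin_closed)
    have "y \<in> T \<longleftrightarrow> \<xi> < r (h y)" if "y \<in> C - {c}" for y
    proof -
      have "y \<in> (C - {c}) \<inter> T \<longleftrightarrow> \<xi> < r (h y)"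
        unfolding T(2)[symmetric] using that him by auto
      then show ?thesis using that by blast
    qed
    then have "{y \<in> C. \<xi> < rs y} = C \<inter> (T \<union> {c})"
      using False c by (auto simp: rs_def not_le)
    moreover have "closed (C \<inter> (T \<union> {c}))"
      using C T(1) closed_singleton_bool_fun by (intro closed_Int closed_Un)
    ultimately show ?thesis by simp
  qed
  have le: "rs y \<le> ?M" if "y \<in> C" for y
    using that le_sup him by (auto simp: rs_def le_max_iff_disj)
  have attained: "\<exists>y\<in>C. \<xi> < rs y" if "\<xi> < ?M" for \<xi>
  proof (cases "\<xi> < \<rho>")
    case True
    then show ?thesis using c by (intro bexI[of _ c]) (simp_all add: rs_def)
  next
    case False
    then have "\<xi> < rank_sup K r" using that by (simp add: less_max_iff_disj)
    then obtain x where "x \<in> topspace K" "\<xi> < r x" using less_sup by blast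
    moreover from this(1) obtain y where "y \<in> C - {c}" "x = h y" unfolding him[symmetric] by (rule imageE)
    ultimately have "y \<in> C - {c}" "\<xi> < r (h y)" by simp_all
    then show ?thesis by (intro bexI[of _ y]) (simp_all add: rs_def)
  qed
  \<comment> \<open>If n = -\<infinity>, no extra roots are needed and \<tau> = \<nu>. Otherwise
    \<open>?M < \<nu>\<close>, so \<rho> < \<nu> and \<nu> is a successor; the extra roots have its
    predecessor as rank.\<close>
  have "\<exists>\<tau> m. ?M \<le> \<tau> \<and> \<nu> = (if m = 0 then \<tau> else osuc \<tau>) \<and>
      n = (if m = 0 then -\<infinity> else ereal (real m)) \<and> (m = 0 \<longrightarrow> \<tau> = ?M)"
  proof (cases "n = -\<infinity>")
    case True
    then show ?thesis using n_iff by (intro exI[of _ ?M] exI[of _ 0]) simp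
  next
    case False
    then obtain k where k: "k > 0" "n = ereal (real k)" using n by auto
    have "?M < \<nu>" using False n_iff \<nu> by (metis order_le_less)
    then obtain \<mu> where "\<nu> = osuc \<mu>" using succ by (auto simp: is_osuc_def)
    then show ?thesis
      using k \<open>?M < \<nu>\<close> by (intro exI[of _ \<mu>] exI[of _ k]) (simp add: less_osuc_iff)
  qed
  then obtain \<tau> m where \<tau>: "?M \<le> \<tau>" and eq: "\<nu> = (if m = 0 then \<tau> else osuc \<tau>)"
    "n = (if m = 0 then -\<infinity> else ereal (real m))" and m0: "m = 0 \<Longrightarrow> \<tau> = ?M" by blast
  obtain Y :: "real topology" where Y: "omega_Stone_space Y"
    "has_invariants Y \<nu> (rs c) n (top_of_set (C - {c})) rs"
    using realization_of_ranks[OF C c perfect closed le \<tau>, of m] attained m0 unfolding eq[symmetric] by blast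
  have "rs c = \<rho>" by (simp add: rs_def)
  obtain \<phi> where \<phi>: "homeomorphic_map (subtopology Y (CB_kernel Y)) (top_of_set (C - {c})) \<phi>"
    "\<forall>u\<in>topspace (subtopology Y (CB_kernel Y)). rs (\<phi> u) = kernel_rank Y u"
    using Y(2) unfolding has_invariants_def rank_homeomorphic_def by blast
  have "rank_homeomorphic (subtopology Y (CB_kernel Y)) (kernel_rank Y) K r"
    unfolding rank_homeomorphic_def
  proof (intro exI[of _ "h \<circ> \<phi>"] conjI ballI)
    show "homeomorphic_map (subtopology Y (CB_kernel Y)) K (h \<circ> \<phi>)"
      using \<phi>(1) h by (rule homeomorphic_map_compose)
    fix u assume u: "u \<in> topspace (subtopology Y (CB_kernel Y))"
    then have "\<phi> u \<in> C - {c}" using homeomorphic_imp_surjective_map[OF \<phi>(1)] by auto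
    moreover have "rs (\<phi> u) = kernel_rank Y u" using \<phi>(2) u by (rule bspec)
    ultimately show "r ((h \<circ> \<phi>) u) = kernel_rank Y u" by (simp add: rs_def)
  qed
  then show ?thesis using Y \<open>rs c = \<rho>\<close> unfolding has_invariants_def by blast
qed

text \<open>Flipping the coordinate \<open>n\<close> of \<open>y\<close> gives points different from
  \<open>y\<close> that converge to it.\<close>

lemma open_bool_fun_perfect:
  fixes S :: "(nat \<Rightarrow> bool) set"
  assumes "open S" shows "S \<subseteq> top_of_set S derived_set_of S"
proof
  fix y assume y: "y \<in> S"
  show "y \<in> top_of_set S derived_set_of S"
    unfolding in_derived_set_of
  proof (intro conjI allI impI)
    show "y \<in> topspace (top_of_set S)" using y by simp
    fix T assume T: "y \<in> T \<and> openin (top_of_set S) T"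
    then have "open T" using assms openin_open_trans by blast
    have "(\<lambda>n. y(n := \<not> y n)) \<longlonglongrightarrow> y"
    proof (rule tendsto_bool_fun)
      fix i show "\<forall>\<^sub>F n in sequentially. (y(n := \<not> y n)) i = y i"
        by (rule eventually_sequentiallyI[of "Suc i"]) auto
    qed
    then have "\<forall>\<^sub>F n in sequentially. y(n := \<not> y n) \<in> T"
      using T \<open>open T\<close> by (intro topological_tendstoD) auto
    then obtain n where "y(n := \<not> y n) \<in> T" using eventually_happens trivial_limit_sequentially by blast
    moreover have "y(n := \<not> y n) \<noteq> y" by (metis fun_upd_same)
    moreover have "T \<subseteq> S" using T openin_subset by fastforce
    ultimately show "\<exists>z. z \<noteq> y \<and> z \<in> S \<and> z \<in> T" by blast
  qed
qed

text \<open>A compact kernel needs an isolated point at infinity. The clopen half \<open>y 0\<close>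
  is a copy of the Cantor set that leaves the constant sequence \<open>False\<close> free for this
  purpose.\<close>

lemma homeomorphic_map_shift:
  "homeomorphic_map (top_of_set {y. y 0}) Cantor_space (\<lambda>y n. y (Suc n))"
proof -
  have "homeomorphic_maps (top_of_set {y. y 0}) (euclidean :: (nat \<Rightarrow> bool) topology)
      (\<lambda>y n. y (Suc n)) (case_nat True)"
    unfolding homeomorphic_maps_def
  proof (intro conjI ballI)
    show "continuous_map (top_of_set {y. y 0}) (euclidean :: (nat \<Rightarrow> bool) topology) (\<lambda>y n. y (Suc n))"
    proof -
      have "continuous_on {y. y 0} (\<lambda>(y :: nat \<Rightarrow> bool) n. y (Suc n))"
        by (intro continuous_on_coordinatewise_then_product continuous_on_subset[OF continuous_on_product_coordinates]) simp
      then show ?thesis by simp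
    qed
    have "continuous_on UNIV (\<lambda>y :: nat \<Rightarrow> bool. case_nat True y)"
    proof (rule continuous_on_coordinatewise_then_product)
      fix i show "continuous_on UNIV (\<lambda>y :: nat \<Rightarrow> bool. case_nat True y i)"
        by (cases i) simp_all
    qed
    then show "continuous_map (euclidean :: (nat \<Rightarrow> bool) topology) (top_of_set {y. y 0}) (case_nat True)"
      by (simp add: continuous_map_in_subtopology image_subset_iff)
    show "case_nat True (\<lambda>n. y (Suc n)) = y" if "y \<in> topspace (top_of_set {y. y 0})" for y
      using that by (auto simp: fun_eq_iff split: nat.split)
  qed simp
  then show ?thesis
    unfolding Cantor_space_def euclidean_bool_fun[symmetric] using homeomorphic_maps_map by blast
qed

lemma existence:
  fixes K :: "(nat \<Rightarrow> bool) topology"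
  assumes K: "K \<in> {trivial_topology, Cantor_space_minus_point, Cantor_space}"
    and "usc_map K r" "n \<in> {ereal (real k) | k. k > 0} \<union> {-\<infinity>}"
    and "rho_U K r \<le> \<rho>" "max \<rho> (rank_sup K r) \<le> \<nu>"
    and "\<rho> < \<nu> \<Longrightarrow> is_osuc \<nu>" "n = -\<infinity> \<longleftrightarrow> max \<rho> (rank_sup K r) = \<nu>"
  shows "\<exists>Y :: real topology. omega_Stone_space Y \<and> has_invariants Y \<nu> \<rho> n K r"
proof -
  let ?c = "\<lambda>_ :: nat. False"
  \<comment> \<open>The model is \<open>{?c}\<close> for the empty kernel, the whole Cantor set for
    the punctured one, and the half \<open>y 0\<close> together with the isolated point
    \<open>?c\<close> for the full one.\<close>
  have "\<exists>C h. closed C \<and> ?c \<in> C \<and> C - {?c} \<subseteq> top_of_set (C - {?c}) derived_set_of (C - {?c}) \<and>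
      homeomorphic_map (top_of_set (C - {?c})) K h"
  proof -
    consider "K = trivial_topology" | "K = Cantor_space_minus_point" | "K = Cantor_space" using K by blast
    then show ?thesis
    proof cases
      case 1
      then show ?thesis
        using closed_singleton_bool_fun[of ?c]
        by (intro exI[of _ "{?c}"] exI[of _ id]) (simp add: homeomorphic_map_id)
    next
      case 2
      have "open (UNIV - {?c})" using closed_singleton_bool_fun by (intro open_Diff) auto
      moreover have "K = top_of_set (UNIV - {?c})"
        using 2 by (simp add: Cantor_space_minus_point_def Cantor_space_def euclidean_bool_fun)
      ultimately show ?thesis
        using open_bool_fun_perfect
        by (intro exI[of _ UNIV] exI[of _ id]) (simp add: homeomorphic_map_id)
    next
      case 3
      let ?C = "insert ?c {y. y 0}"
      have C: "?C - {?c} = {y. y 0}" by auto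
      have o: "open {y :: nat \<Rightarrow> bool. y 0 = b}" for b by (rule open_coordinate)
      have "closed {y :: nat \<Rightarrow> bool. y 0}" using o[of False] by (simp add: closed_def Collect_neg_eq)
      then have "closed ?C"
        using closed_Un[OF closed_singleton_bool_fun[of ?c], of "{y. y 0}"] by simp
      moreover have "?C - {?c} \<subseteq> top_of_set (?C - {?c}) derived_set_of (?C - {?c})"
        unfolding C using o[of True] by (intro open_bool_fun_perfect) simp
      moreover have "homeomorphic_map (top_of_set (?C - {?c})) K (\<lambda>y n. y (Suc n))"
        unfolding C 3 by (rule homeomorphic_map_shift)
      ultimately show ?thesis by blast
    qed
  qed
  then obtain C h where "closed C" "?c \<in> C" "C - {?c} \<subseteq> top_of_set (C - {?c}) derived_set_of (C - {?c})"
    "homeomorphic_map (top_of_set (C - {?c})) K h" by blast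
  then show ?thesis by (rule existence_from_model) (use assms in auto)
qed

theorem theorem11:
  fixes K :: "(nat \<Rightarrow> bool) topology" and r :: "(nat \<Rightarrow> bool) \<Rightarrow> omega1"
    and n :: ereal and \<nu> \<rho> :: omega1
  assumes "K \<in> {trivial_topology, Cantor_space_minus_point, Cantor_space}"
    and "usc_map K r"
    and "n \<in> {ereal (real k) | k. k > 0} \<union> {-\<infinity>}"
    and "rho_U K r \<le> \<rho>"
    and "max \<rho> (rank_sup K r) \<le> \<nu>"
    and "\<rho> < \<nu> \<Longrightarrow> is_osuc \<nu>"
    and "n = -\<infinity> \<longleftrightarrow> max \<rho> (rank_sup K r) = \<nu>"
  shows "(\<exists>W :: real topology. omega_Stone_space W \<and> has_invariants W \<nu> \<rho> n K r) \<and>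
    (\<forall>(W :: 'a topology) (V :: 'b topology).
       omega_Stone_space W \<and> has_invariants W \<nu> \<rho> n K r \<and>
       omega_Stone_space V \<and> has_invariants V \<nu> \<rho> n K r \<longrightarrow>
       W homeomorphic_space V)"
  using existence[OF assms] has_invariants_unique by blast

end
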